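(* Let $u\in\mathfrak{B}^{s}(\Omega)$ with $s\ge 3$, and let $B=\left(1+\frac{2d}{\pi s}\right)\|u\|_{\mathfrak{B}^{s}(\Omega)}$. Then for every positive integer $m$ there exists $v_m\in\mathcal{F}_{\mathrm{ReLU},m}(B)$ such that $$\|u-\varphi v_m\|_{H^1(\Omega)}\le\frac{28B}{\sqrt m}.$$
   Context: $\Omega=(0,1)^d$, $d\ge 1$. For $k\in\mathbb{N}_+^d$ (positive integer vectors) let $\Phi_k(x)=\prod_{i=1}^d\sin(\pi k_i x_i)$, and for $u\in L^1(\Omega)$ let $\hat u(k)=2^d\int_\Omega u\,\Phi_k\,dx$ be its sine coefficients. With $|k|_1$ the $\ell^1$-norm, $\|u\|_{\mathfrak{B}^s(\Omega)}=\sum_{k\in\mathbb{N}_+^d}(1+\pi^s|k|_1^s)|\hat u(k)|$, and $\mathfrak{B}^s(\Omega)=\{u\in L^1(\Omega):\|u\|_{\mathfrak{B}^s(\Omega)}<\infty\}$ (sine spectral Barron space). The cut-off function is $\varphi(x)=\left[\sum_{i=1}^d\frac{1}{\sin(\pi x_i)}\right]^{-1}$ for $x\in\Omega$ (extended by $0$ to $\partial\Omega$). For an activation function $\phi:\mathbb{R}\to\mathbb{R}$, a positive integer $m$ and $B\geq 0$, $$\mathcal{F}_{\phi,m}(B)=\Big\{x\mapsto c+\sum_{i=1}^m\gamma_i\phi(w_i\cdot x-t_i):\ |c|\le B,\ w_i\in\mathbb{R}^d,\ |w_i|_1=1,\ |t_i|\le1,\ \sum_{i=1}^m|\gamma_i|\le4B\Big\}.$$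 $\mathrm{ReLU}(z)=\max\{z,0\}$. $\|f\|_{H^1(\Omega)}^2=\|f\|_{L^2(\Omega)}^2+\|\nabla f\|_{L^2(\Omega)}^2$. *)

theory Defs
  imports "HOL-Analysis.Analysis"
begin

definition unit_cube :: "(real ^ 'd) set" where
  "unit_cube = {x. \<forall>i. 0 < x $ i \<and> x $ i < 1}"


subsection \<open>The sine spectral Barron space\<close>

definition pos_multi_indices :: "(nat ^ 'd) set" where
  "pos_multi_indices = {k. \<forall>i. 0 < k $ i}"

definition sine_basis :: "nat ^ 'd \<Rightarrow> real ^ 'd \<Rightarrow> real" where
  "sine_basis k x = (\<Prod>i\<in>UNIV. sin (pi * real (k $ i) * x $ i))"

definition sine_coeff :: "(real ^ 'd \<Rightarrow> real) \<Rightarrow> nat ^ 'd \<Rightarrow> real" where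
  "sine_coeff u k =
     2 ^ CARD('d) * (LINT x:unit_cube|lebesgue. u x * sine_basis k x)"

definition barron_term :: "real \<Rightarrow> (real ^ 'd \<Rightarrow> real) \<Rightarrow> nat ^ 'd \<Rightarrow> real" where
  "barron_term s u k =
     (1 + pi powr s * real (\<Sum>i\<in>UNIV. k $ i) powr s) * \<bar>sine_coeff u k\<bar>"

text \<open>All terms are nonnegative, so summability is finiteness of the norm.
  The real-valued \<^const>\<open>infsum\<close> below is meaningful on the Barron space only
  (it is \<open>0\<close> for a divergent sum).\<close>

definition barron_norm :: "real \<Rightarrow> (real ^ 'd \<Rightarrow> real) \<Rightarrow> real" where
  "barron_norm s u = (\<Sum>\<^sub>\<infinity>k\<in>pos_multi_indices. barron_term s u k)"

definition barron_space :: "real \<Rightarrow> (real ^ 'd \<Rightarrow> real) set" where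
  "barron_space s = {u. set_integrable lebesgue unit_cube u \<and>
     barron_term s u summable_on pos_multi_indices}"


subsection \<open>Cut-off function and shallow networks\<close>

definition cutoff :: "real ^ 'd \<Rightarrow> real" where
  "cutoff x =
     (if x \<in> unit_cube then inverse (\<Sum>i\<in>UNIV. 1 / sin (pi * x $ i)) else 0)"

definition relu :: "real \<Rightarrow> real" where
  "relu z = max z 0"

definition l1_norm :: "real ^ 'd \<Rightarrow> real" where
  "l1_norm w = (\<Sum>i\<in>UNIV. \<bar>w $ i\<bar>)"

definition networks :: "(real \<Rightarrow> real) \<Rightarrow> nat \<Rightarrow> real \<Rightarrow> (real ^ 'd \<Rightarrow> real) set" where
  "networks \<phi> m B =
     {(\<lambda>x. c + (\<Sum>i<m. \<gamma> i * \<phi> (w i \<bullet> x - t i))) | c \<gamma> w t.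
        \<bar>c\<bar> \<le> B \<and>
        (\<forall>i<m. l1_norm (w i) = 1 \<and> \<bar>t i\<bar> \<le> 1) \<and>
        (\<Sum>i<m. \<bar>\<gamma> i\<bar>) \<le> 4 * B}"


subsection \<open>The Sobolev space \<open>H\<^sup>1\<close> of an open set\<close>

definition partial_deriv :: "'d \<Rightarrow> (real ^ 'd \<Rightarrow> real) \<Rightarrow> real ^ 'd \<Rightarrow> real" where
  "partial_deriv i f x = frechet_derivative f (at x) (axis i 1)"

primrec times_differentiable :: "nat \<Rightarrow> (real ^ 'd \<Rightarrow> real) \<Rightarrow> bool" where
  "times_differentiable 0 f \<longleftrightarrow> True"
| "times_differentiable (Suc n) f \<longleftrightarrow>
     (\<forall>x. f differentiable (at x)) \<and> (\<forall>i. times_differentiable n (partial_deriv i f))"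

definition test_functions :: "(real ^ 'd) set \<Rightarrow> (real ^ 'd \<Rightarrow> real) set" where
  "test_functions \<Omega> = {\<psi>. (\<forall>n. times_differentiable n \<psi>) \<and>
     compact (closure {x. \<psi> x \<noteq> 0}) \<and> closure {x. \<psi> x \<noteq> 0} \<subseteq> \<Omega>}"

definition locally_integrable :: "(real ^ 'd) set \<Rightarrow> (real ^ 'd \<Rightarrow> 'b::euclidean_space) \<Rightarrow> bool" where
  "locally_integrable \<Omega> f \<longleftrightarrow>
     (\<forall>K. compact K \<and> K \<subseteq> \<Omega> \<longrightarrow> set_integrable lebesgue K f)"

definition has_weak_gradient ::
  "(real ^ 'd) set \<Rightarrow> (real ^ 'd \<Rightarrow> real) \<Rightarrow> (real ^ 'd \<Rightarrow> real ^ 'd) \<Rightarrow> bool" where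
  "has_weak_gradient \<Omega> f G \<longleftrightarrow>
     locally_integrable \<Omega> f \<and> locally_integrable \<Omega> G \<and>
     (\<forall>\<psi>\<in>test_functions \<Omega>. \<forall>i.
        (LINT x:\<Omega>|lebesgue. f x * partial_deriv i \<psi> x) =
        - (LINT x:\<Omega>|lebesgue. G x $ i * \<psi> x))"

text \<open>On an open set a weak gradient is unique up to null sets, so the choice
  below does not affect integrals.\<close>

definition weak_gradient ::
  "(real ^ 'd) set \<Rightarrow> (real ^ 'd \<Rightarrow> real) \<Rightarrow> real ^ 'd \<Rightarrow> real ^ 'd" where
  "weak_gradient \<Omega> f = (SOME G. has_weak_gradient \<Omega> f G)"

definition square_integrable :: "(real ^ 'd) set \<Rightarrow> (real ^ 'd \<Rightarrow> 'b::euclidean_space) \<Rightarrow> bool" where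
  "square_integrable \<Omega> f \<longleftrightarrow>
     set_borel_measurable lebesgue \<Omega> f \<and>
     set_integrable lebesgue \<Omega> (\<lambda>x. (norm (f x))\<^sup>2)"

definition H1_space :: "(real ^ 'd) set \<Rightarrow> (real ^ 'd \<Rightarrow> real) set" where
  "H1_space \<Omega> = {f. square_integrable \<Omega> f \<and>
     (\<exists>G. has_weak_gradient \<Omega> f G \<and> square_integrable \<Omega> G)}"

text \<open>Meaningful for members of \<^const>\<open>H1_space\<close> only.\<close>

definition H1_norm :: "(real ^ 'd) set \<Rightarrow> (real ^ 'd \<Rightarrow> real) \<Rightarrow> real" where
  "H1_norm \<Omega> f =
     sqrt ((LINT x:\<Omega>|lebesgue. (f x)\<^sup>2) +
           (LINT x:\<Omega>|lebesgue. (norm (weak_gradient \<Omega> f x))\<^sup>2))"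

end

theory Submission
  imports Defs
begin

text \<open>
  Write \<open>\<phi>\<close> for the cut-off function, \<open>\<Phi>\<^sub>k\<close> for the sine products, \<open>|k|\<close> and \<open>|w|\<close> for the
  \<open>l1\<close>-norm of a frequency vector, and \<open>N\<close> for the Barron norm of \<open>u\<close>, so that \<open>N \<le> B\<close>.

  The cut-off function is chosen so that dividing by it does not spoil a sine series.  Since, on the cube,
  \<open>1/\<phi> = \<Sum>\<^sub>i 1/sin(\<pi>x\<^sub>i)\<close> and since \<open>sin(\<pi>k\<^sub>ix\<^sub>i)/sin(\<pi>x\<^sub>i)\<close> is a sum of \<open>k\<^sub>i\<close> cosines,
  \<open>\<Phi>\<^sub>k/\<phi>\<close> is a sum of \<open>|k|\<close> products of one cosine with sines, and product-to-sum formulas turn each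
  of these into an average of ridge functions \<open>cos(w\<bullet>x + b)\<close> with \<open>|w| \<le> \<pi>|k|\<close>
  (\<open>sine_basis_eq_cutoff_times_quotient\<close>, \<open>approximable_cos_times_sines\<close>).  A ridge function with \<open>w \<noteq> 0\<close> depends
  on the single variable \<open>w\<bullet>x/|w|\<close> in \<open>[-1,1)\<close>; replacing its derivative by a step function shows that it
  is a limit, in \<open>C\<^sup>1\<close> off the kinks, of constants of size at most \<open>1\<close> plus combinations of rectified
  linear units with total outer weight at most \<open>|w| + 2|w|\<^sup>2\<close>
  (\<open>relu_approximation_of_C1_function\<close>).  Hence \<open>\<Phi>\<^sub>k/\<phi>\<close> costs at most
  \<open>|k|(\<pi>|k| + 2(\<pi>|k|)\<^sup>2) \<le> (\<pi>|k|)\<^sup>3\<close>, which for \<open>s \<ge> 3\<close> is below the Barron weight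
  (\<open>barron_weight_bounds\<close>).  Summing over \<open>k\<close>, the quotient \<open>u/\<phi>\<close> is approximated to any accuracy by wide
  networks whose constant and whose total outer weight are bounded by \<open>N\<close>.

  On the cube \<open>0 < \<phi> \<le> 1\<close> and \<open>\<parallel>\<nabla>\<phi>\<parallel> \<le> \<pi>\<close>, so multiplication by \<open>\<phi>\<close> carries \<open>C\<^sup>1\<close>-approximation to
  \<open>H\<^sup>1\<close>-approximation.  A wide network times \<open>\<phi>\<close>, read as the pair of its value and its gradient, is
  its constant part plus a convex combination of functions bounded by \<open>11N\<close>, and Maurey's
  sampling argument (\<open>maurey_sampling\<close>) selects \<open>m\<close> of them with mean square error at most
  \<open>121N\<^sup>2/m\<close>.  Together with an approximation error of \<open>N/\<surd>m\<close> this gives the squared error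
  \<open>2N\<^sup>2/m + 2\<cdot>121N\<^sup>2/m = 244N\<^sup>2/m \<le> (28B)\<^sup>2/m\<close>.

  What remains is the passage from pointwise statements to the \<open>H\<^sup>1\<close>-norm, which is defined by weak
  gradients.  A function that is Lipschitz on the cube and differentiable almost everywhere has its
  pointwise gradient as weak gradient (\<open>has_weak_gradient_unit_cubeI\<close>), weak gradients survive uniform
  limits, and they are unique almost everywhere by the fundamental lemma of the calculus of
  variations (\<open>AE_eq_0_of_test_function_integrals\<close>).  Finally \<open>u\<close>, which is only given as an integrable
  function, agrees almost everywhere with its sine series because the sine products are complete in
  \<open>L\<^sup>1\<close> (\<open>sine_basis_complete\<close>).
\<close>

section \<open>Smooth test functions\<close>

lemma partial_deriv_eqI:
  "(f has_derivative f') (at x) \<Longrightarrow> partial_deriv i f x = f' (axis i 1)"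
  unfolding partial_deriv_def using frechet_derivative_at by metis

lemma times_differentiable_Suc_D:
  "times_differentiable (Suc n) f \<Longrightarrow> times_differentiable n f"
  by (induction n arbitrary: f) auto

lemma times_differentiable_const: "times_differentiable n (\<lambda>x. c)"
proof (induction n arbitrary: c)
  case (Suc n)
  have "partial_deriv i (\<lambda>x::real^'a. c) = (\<lambda>x. 0)" for i :: 'a
    by (rule ext, rule partial_deriv_eqI[THEN trans]) (auto intro!: derivative_eq_intros)
  then show ?case using Suc by simp
qed simp

lemma times_differentiable_add:
  assumes "times_differentiable n f" "times_differentiable n g"
  shows "times_differentiable n (\<lambda>x. f x + g x)"
  using assms
proof (induction n arbitrary: f g)
  case (Suc n)
  have "partial_deriv i (\<lambda>x. f x + g x) = (\<lambda>x. partial_deriv i f x + partial_deriv i g x)" for i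
  proof
    fix x
    from Suc.prems obtain f' g' where "(f has_derivative f') (at x)" "(g has_derivative g') (at x)"
      unfolding times_differentiable.simps differentiable_def by metis
    then show "partial_deriv i (\<lambda>x. f x + g x) x = partial_deriv i f x + partial_deriv i g x"
      by (simp add: partial_deriv_eqI[OF has_derivative_add] partial_deriv_eqI)
  qed
  with Suc show ?case by simp
qed simp

lemma times_differentiable_mult:
  assumes "times_differentiable n f" "times_differentiable n g"
  shows "times_differentiable n (\<lambda>x. f x * g x)"
  using assms
proof (induction n arbitrary: f g)
  case (Suc n)
  have "partial_deriv i (\<lambda>x. f x * g x) = (\<lambda>x. f x * partial_deriv i g x + partial_deriv i f x * g x)" for i
  proof
    fix x
    from Suc.prems obtain f' g' where "(f has_derivative f') (at x)" "(g has_derivative g') (at x)"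
      unfolding times_differentiable.simps differentiable_def by metis
    then show "partial_deriv i (\<lambda>x. f x * g x) x = f x * partial_deriv i g x + partial_deriv i f x * g x"
      by (simp add: partial_deriv_eqI[OF has_derivative_mult] partial_deriv_eqI)
  qed
  moreover from Suc.prems have "times_differentiable n f" "times_differentiable n g"
    by (auto intro: times_differentiable_Suc_D)
  ultimately show ?case using Suc by (auto intro!: times_differentiable_add)
qed simp

lemma times_differentiable_prod:
  assumes "finite S" "\<And>i. i \<in> S \<Longrightarrow> times_differentiable n (f i)"
  shows "times_differentiable n (\<lambda>x. \<Prod>i\<in>S. f i x)"
  using assms by (induction S) (auto intro: times_differentiable_const times_differentiable_mult)

text \<open>
  For \<open>p = 1\<close> this is the classical smooth function that vanishes to infinite order at \<open>0\<close>.  The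
  polynomial in \<open>1/t\<close> makes the family closed under differentiation, so that smoothness is a single
  induction over all \<open>p\<close>.
\<close>

definition flat :: "real poly \<Rightarrow> real \<Rightarrow> real" where
  "flat p t = (if t > 0 then poly p (1 / t) * exp (- 1 / t) else 0)"

lemma poly_times_exp_minus_tendsto_0: "((\<lambda>y::real. poly p y * exp (- y)) \<longlongrightarrow> 0) at_top"
proof -
  have "((\<lambda>y. \<Sum>i\<le>degree p. coeff p i * (y ^ i / exp y)) \<longlongrightarrow> (\<Sum>i\<le>degree p. coeff p i * 0)) at_top"
    by (intro tendsto_intros tendsto_power_div_exp_0)
  moreover have "(\<lambda>y. \<Sum>i\<le>degree p. coeff p i * (y ^ i / exp y)) = (\<lambda>y. poly p y * exp (- y))"
    by (simp add: poly_altdef sum_distrib_right exp_minus divide_inverse mult.assoc)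
  ultimately show ?thesis by simp
qed

text \<open>
  The substitution \<open>y = 1/t\<close> turns the limit from the right into the decay of a polynomial times
  \<open>exp (-y)\<close>.
\<close>

lemma flat_tendsto_0: "(flat p \<longlongrightarrow> 0) (at 0)"
proof -
  have "((\<lambda>t. poly p (inverse t) * exp (- inverse t)) \<longlongrightarrow> 0) (at_right 0)"
    by (rule filterlim_compose[OF poly_times_exp_minus_tendsto_0 filterlim_inverse_at_top_right])
  moreover have "\<forall>\<^sub>F t in at_right 0. poly p (inverse t) * exp (- inverse t) = flat p t"
    by (auto simp: eventually_at_filter flat_def field_simps)
  ultimately have "(flat p \<longlongrightarrow> 0) (at_right 0)"
    by (rule Lim_transform_eventually)
  moreover have "(flat p \<longlongrightarrow> 0) (at_left 0)"
    by (rule Lim_transform_eventually[OF tendsto_const]) (auto simp: eventually_at_filter flat_def)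
  ultimately show ?thesis by (simp add: filterlim_split_at)
qed

lemma flat_has_derivative:
  "(flat p has_real_derivative flat ([:0, 0, 1:] * (p - pderiv p)) t) (at t)"
proof -
  consider "t > 0" | "t < 0" | "t = 0" by linarith
  then show ?thesis
  proof cases
    case 1
    have "((\<lambda>t. poly p (1 / t) * exp (- 1 / t)) has_real_derivative
            flat ([:0, 0, 1:] * (p - pderiv p)) t) (at t)"
      using 1 by (auto intro!: derivative_eq_intros poly_DERIV simp: flat_def field_simps power2_eq_square)
    then show ?thesis
      by (rule has_field_derivative_transform_within_open[of _ _ _ "{0<..}"])
         (use 1 in \<open>auto simp: flat_def\<close>)
  next
    case 2
    have "((\<lambda>t. 0) has_real_derivative flat ([:0, 0, 1:] * (p - pderiv p)) t) (at t)"
      using 2 by (simp add: flat_def)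
    then show ?thesis
      by (rule has_field_derivative_transform_within_open[of _ _ _ "{..<0}"])
         (use 2 in \<open>auto simp: flat_def\<close>)
  next
    case 3
    have "(\<lambda>h. (flat p (0 + h) - flat p 0) / h) = flat (pCons 0 p)"
      by (auto simp: flat_def fun_eq_iff)
    with flat_tendsto_0[of "pCons 0 p"] show ?thesis
      unfolding 3 DERIV_def by (simp add: flat_def)
  qed
qed

lemma times_differentiable_flat: "times_differentiable n (\<lambda>x. flat p (r * x $ i + c))"
proof (induction n arbitrary: p)
  case (Suc n)
  let ?p' = "smult r ([:0, 0, 1:] * (p - pderiv p))"
  have D: "((\<lambda>x. flat p (r * x $ i + c)) has_derivative
       (\<lambda>v. v $ i * flat ?p' (r * x $ i + c))) (at x)" for x :: "real^'a"
  proof -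
    have "((\<lambda>x. r * x $ i + c) has_derivative (\<lambda>v. r * v $ i)) (at x)"
      by (auto intro!: derivative_eq_intros bounded_linear.has_derivative[OF bounded_linear_vec_nth])
    from has_derivative_compose[OF this flat_has_derivative[THEN has_field_derivative_imp_has_derivative]]
    show ?thesis by (rule has_derivative_eq_rhs) (auto simp: flat_def algebra_simps fun_eq_iff)
  qed
  have "partial_deriv j (\<lambda>x. flat p (r * x $ i + c)) =
      (if j = i then (\<lambda>x. flat ?p' (r * x $ i + c)) else (\<lambda>x. 0))" for j
    by (rule ext, subst partial_deriv_eqI[OF D]) (auto simp: axis_def)
  then show ?case using Suc D times_differentiable_const by (auto simp: differentiable_def)
qed simp

text \<open>
  A product of one-dimensional bumps.  The factor \<open>Suc n\<close> stretches the argument, which makes the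
  bumps converge to the indicator function of the box while their support stays fixed.
\<close>

definition box_bump :: "real^'d \<Rightarrow> real^'d \<Rightarrow> nat \<Rightarrow> real^'d \<Rightarrow> real" where
  "box_bump a b n x = (\<Prod>i\<in>UNIV. flat 1 (real (Suc n) * (x $ i - a $ i)) * flat 1 (real (Suc n) * (b $ i - x $ i)))"

lemma times_differentiable_box_bump: "times_differentiable k (box_bump a b n)"
proof -
  have "times_differentiable k (\<lambda>x. \<Prod>i\<in>UNIV. flat 1 (real (Suc n) * x $ i + (- real (Suc n) * a $ i)) *
          flat 1 (- real (Suc n) * x $ i + real (Suc n) * b $ i))"
    by (intro times_differentiable_prod times_differentiable_mult times_differentiable_flat) auto
  then show ?thesis by (simp add: box_bump_def[abs_def] algebra_simps)
qed

lemma flat_1_bounds: "0 \<le> flat 1 t" "flat 1 t \<le> 1"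
  by (auto simp: flat_def)

lemma abs_box_bump_le: "\<bar>box_bump a b n x\<bar> \<le> 1"
  unfolding box_bump_def abs_prod
  by (rule prod_le_1) (auto simp: abs_mult flat_1_bounds mult_le_one)

lemma box_bump_eq_0: "x \<notin> box a b \<Longrightarrow> box_bump a b n x = 0"
proof -
  assume "x \<notin> box a b"
  then obtain i where "x $ i - a $ i \<le> 0 \<or> b $ i - x $ i \<le> 0"
    by (auto simp: mem_box_cart not_less)
  then have "flat 1 (real (Suc n) * (x $ i - a $ i)) * flat 1 (real (Suc n) * (b $ i - x $ i)) = 0"
    by (auto simp: flat_def zero_less_mult_iff simp del: of_nat_Suc)
  then show ?thesis unfolding box_bump_def by (intro prod_zero) auto
qed

lemma box_bump_tendsto: "(\<lambda>n. box_bump a b n x) \<longlonglongrightarrow> indicator (box a b) x"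
proof (cases "x \<in> box a b")
  case True
  have lim: "(\<lambda>n. flat 1 (real (Suc n) * t)) \<longlonglongrightarrow> 1" if "t > 0" for t
  proof -
    have "(\<lambda>n. exp (- (1 / t) * inverse (real (Suc n)))) \<longlonglongrightarrow> exp (- (1 / t) * 0)"
      by (intro tendsto_intros LIMSEQ_inverse_real_of_nat)
    moreover have "flat 1 (real (Suc n) * t) = exp (- (1 / t) * inverse (real (Suc n)))" for n
      using mult_pos_pos[OF _ that, of "real (Suc n)"] by (simp add: flat_def divide_inverse del: of_nat_Suc)
    ultimately show ?thesis by simp
  qed
  have "(\<lambda>n. box_bump a b n x) \<longlonglongrightarrow> (\<Prod>i\<in>(UNIV::'a set). 1 * 1)"
    unfolding box_bump_def using True
    by (intro tendsto_prod tendsto_mult lim) (auto simp: mem_box_cart)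
  then show ?thesis using True by simp
qed (simp add: box_bump_eq_0)

lemma box_bump_test_function:
  assumes "cbox a b \<subseteq> \<Omega>"
  shows "box_bump a b n \<in> test_functions \<Omega>"
proof -
  have "closure {x. box_bump a b n x \<noteq> 0} \<subseteq> cbox a b"
    using box_bump_eq_0[of _ a b n] box_subset_cbox[of a b]
    by (intro closure_minimal) (auto simp: closed_cbox)
  then show ?thesis
    using assms times_differentiable_box_bump unfolding test_functions_def
    by (auto simp: compact_eq_bounded_closed intro: bounded_subset[OF bounded_cbox])
qed

section \<open>The fundamental lemma of the calculus of variations\<close>

text \<open>
  The Borel sets over which \<open>f\<close> integrates to \<open>0\<close> are closed under complements and countable disjoint
  unions; the boxes form an intersection-stable generator.
\<close>

lemma lborel_AE_eq_0_of_box_integrals: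
  fixes f :: "'a::euclidean_space \<Rightarrow> real"
  assumes f[measurable]: "integrable lborel f"
    and box: "\<And>a b. (LINT x:box a b|lborel. f x) = 0"
  shows "AE x in lborel. f x = 0"
proof -
  let ?E = "range (\<lambda>(a, b). box a b :: 'a set)"
  have set_int: "set_integrable lborel A f" if "A \<in> sets borel" for A
    using f that unfolding set_integrable_def by (intro integrable_mult_indicator) auto
  have total: "(LINT x|lborel. f x) = 0"
  proof -
    let ?A = "\<lambda>n::nat. box (- (real n *\<^sub>R One)) (real n *\<^sub>R One) :: 'a set"
    have "(\<lambda>n. LINT x:?A n|lborel. f x) \<longlonglongrightarrow> (LINT x:(\<Union>n. ?A n)|lborel. f x)"
    proof (rule set_integral_cont_up)
      show "incseq ?A"
        by (rule incseq_SucI) (auto simp: box_def inner_Basis intro: less_le_trans order.strict_trans1)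
    qed (use set_int UN_box_eq_UNIV in auto)
    then have "(\<lambda>n. 0) \<longlonglongrightarrow> (LINT x|lborel. f x)"
      unfolding box UN_box_eq_UNIV by (simp add: set_lebesgue_integral_def)
    then show ?thesis by (simp add: LIMSEQ_const_iff)
  qed
  have stable: "Int_stable ?E" by (auto simp: Int_stable_def box_Int_box)
  have sub: "?E \<subseteq> Pow UNIV" by simp
  have zero: "(LINT x:A|lborel. f x) = 0" if "A \<in> sigma_sets UNIV ?E" for A
    using stable sub that
  proof (induction rule: sigma_sets_induct_disjoint)
    case (basic A)
    then show ?case by (auto simp: box)
  next
    case empty show ?case by (simp add: set_lebesgue_integral_def)
  next
    case (compl A)
    then have A: "A \<in> sets borel" by (simp add: borel_eq_box)
    have "(LINT x:A \<union> (UNIV - A)|lborel. f x) = (LINT x:A|lborel. f x) + (LINT x:UNIV - A|lborel. f x)"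
      by (rule set_integral_Un) (use A set_int in auto)
    then show ?case using total compl by (simp add: set_lebesgue_integral_def)
  next
    case (union A)
    then have A: "A i \<in> sets borel" for i by (auto simp: borel_eq_box)
    have "(LINT x:(\<Union>i. A i)|lborel. f x) = (\<Sum>i. (LINT x:(A i)|lborel. f x))"
      by (rule lebesgue_integral_countable_add)
         (use A union set_int in \<open>auto simp: disjoint_family_on_def\<close>)
    then show ?case using union by simp
  qed
  show ?thesis
  proof (rule density_unique_real[of lborel f "\<lambda>x. 0"])
    fix A :: "'a set" assume "A \<in> sets lborel"
    then show "(LINT x:A|lborel. f x) = (LINT x:A|lborel. 0)"
      using zero[of A] by (simp add: borel_eq_box)
  qed (use f in auto)
qed

lemma lebesgue_AE_eq_0_of_box_integrals:
  fixes f :: "'a::euclidean_space \<Rightarrow> real"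
  assumes f: "integrable lebesgue f"
    and box: "\<And>a b. (LINT x:box a b|lebesgue. f x) = 0"
  shows "AE x in lebesgue. f x = 0"
proof -
  from f have "f \<in> borel_measurable lebesgue" by simp
  then obtain g where [measurable]: "g \<in> borel_measurable lborel" and fg: "AE x in lborel. f x = g x"
    using completion_ex_borel_measurable_real by blast
  have g_leb: "g \<in> borel_measurable lebesgue" by (intro measurable_completion) simp
  have fg': "AE x in lebesgue. f x = g x" by (rule AE_completion) fact
  have "integrable lebesgue g"
    using integrable_cong_AE[OF _ g_leb fg'] f by simp
  then have g: "integrable lborel g" by (simp add: integrable_completion)
  have "AE x in lborel. g x = 0"
  proof (rule lborel_AE_eq_0_of_box_integrals[OF g])
    fix a b :: 'a
    have "(LINT x:box a b|lebesgue. f x) = (LINT x:box a b|lebesgue. g x)"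
      by (rule set_lebesgue_integral_cong_AE) (use f g_leb fg' in auto)
    also have "\<dots> = (LINT x:box a b|lborel. g x)"
      unfolding set_lebesgue_integral_def by (rule integral_completion) measurable
    finally show "(LINT x:box a b|lborel. g x) = 0" using box by simp
  qed
  from AE_completion[OF this] fg' show ?thesis by eventually_elim simp
qed

text \<open>
  Bounded convergence of the bumps transfers the hypothesis from test functions to indicator
  functions of boxes whose closure lies in \<open>\<Omega>\<close>.  Countably many closed boxes cover \<open>\<Omega>\<close>, and inside
  each of them all box integrals vanish.
\<close>

lemma AE_eq_0_of_test_function_integrals:
  fixes g :: "real^'d \<Rightarrow> real"
  assumes "open \<Omega>" and g: "locally_integrable \<Omega> g"
    and test: "\<And>\<psi>. \<psi> \<in> test_functions \<Omega> \<Longrightarrow> (LINT x:\<Omega>|lebesgue. g x * \<psi> x) = 0"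
  shows "AE x in lebesgue. x \<in> \<Omega> \<longrightarrow> g x = 0"
proof -
  have box0: "(LINT x:box a b|lebesgue. g x) = 0" if ab: "cbox a b \<subseteq> \<Omega>" for a b
  proof -
    have int: "integrable lebesgue (\<lambda>x. indicator (cbox a b) x *\<^sub>R g x)"
      using g ab unfolding locally_integrable_def set_integrable_def by auto
    let ?s = "\<lambda>n x. indicator (cbox a b) x *\<^sub>R g x * box_bump a b n x"
    have meas: "box_bump a b n \<in> borel_measurable lebesgue" for n
    proof -
      have "continuous_on UNIV (box_bump a b n)"
        using times_differentiable_box_bump[of 1 a b n]
        by (auto intro!: differentiable_imp_continuous_on simp: differentiable_on_def differentiable_at_withinI)
      then show ?thesis by (simp add: borel_measurable_continuous_onI measurable_completion)
    qed
    have "(\<lambda>n. LINT x|lebesgue. ?s n x) \<longlonglongrightarrow> (LINT x|lebesgue. indicator (box a b) x *\<^sub>R g x)"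
    proof (rule integral_dominated_convergence[where w = "\<lambda>x. norm (indicator (cbox a b) x *\<^sub>R g x)"])
      have "(\<lambda>x. indicator (box a b) x * (indicator (cbox a b) x *\<^sub>R g x)) \<in> borel_measurable lebesgue"
        using int by (intro borel_measurable_times borel_measurable_indicator) auto
      also have "(\<lambda>x. indicator (box a b) x * (indicator (cbox a b) x *\<^sub>R g x)) = (\<lambda>x. indicator (box a b) x *\<^sub>R g x)"
        using box_subset_cbox[of a b] by (auto simp: indicator_def fun_eq_iff)
      finally show "(\<lambda>x. indicator (box a b) x *\<^sub>R g x) \<in> borel_measurable lebesgue" .
      show "?s n \<in> borel_measurable lebesgue" for n
        using int meas by (intro borel_measurable_times) auto
      show "integrable lebesgue (\<lambda>x. norm (indicator (cbox a b) x *\<^sub>R g x))"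
        using int by (rule integrable_norm)
      show "AE x in lebesgue. (\<lambda>n. ?s n x) \<longlonglongrightarrow> indicator (box a b) x *\<^sub>R g x"
      proof (rule AE_I2)
        fix x
        have "(\<lambda>n. ?s n x) \<longlonglongrightarrow> indicator (cbox a b) x *\<^sub>R g x * indicator (box a b) x"
          by (intro tendsto_intros box_bump_tendsto)
        then show "(\<lambda>n. ?s n x) \<longlonglongrightarrow> indicator (box a b) x *\<^sub>R g x"
          using box_subset_cbox[of a b] by (auto simp: indicator_def split: if_splits)
      qed
      show "AE x in lebesgue. norm (?s n x) \<le> norm (indicator (cbox a b) x *\<^sub>R g x)" for n
        using abs_box_bump_le[of a b n] by (auto simp: abs_mult mult_left_le)
    qed
    moreover have "(LINT x|lebesgue. ?s n x) = 0" for n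
    proof -
      have "?s n x = indicator \<Omega> x *\<^sub>R (g x * box_bump a b n x)" for x
        using box_bump_eq_0[of x a b n] box_subset_cbox[of a b] ab by (auto simp: indicator_def)
      then have "?s n = (\<lambda>x. indicator \<Omega> x *\<^sub>R (g x * box_bump a b n x))" by (rule ext)
      then have "(LINT x|lebesgue. ?s n x) = (LINT x:\<Omega>|lebesgue. g x * box_bump a b n x)"
        by (simp only: set_lebesgue_integral_def)
      also have "\<dots> = 0" by (rule test[OF box_bump_test_function[OF ab]])
      finally show ?thesis .
    qed
    ultimately show ?thesis by (simp add: set_lebesgue_integral_def LIMSEQ_const_iff)
  qed
  obtain D where D: "countable D" "D \<subseteq> Pow \<Omega>" "\<And>X. X \<in> D \<Longrightarrow> \<exists>a b. X = cbox a b" "\<Union>D = \<Omega>"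
    using open_countable_Union_open_cbox[OF \<open>open \<Omega>\<close>] by metis
  have "AE x in lebesgue. x \<in> X \<longrightarrow> g x = 0" if "X \<in> D" for X
  proof -
    from D(2,3) that obtain c d where X: "X = cbox c d" "cbox c d \<subseteq> \<Omega>" by blast
    have "AE x in lebesgue. indicator (cbox c d) x *\<^sub>R g x = 0"
    proof (rule lebesgue_AE_eq_0_of_box_integrals)
      show int: "integrable lebesgue (\<lambda>x. indicator (cbox c d) x *\<^sub>R g x)"
        using g X unfolding locally_integrable_def set_integrable_def by auto
      fix a b
      obtain a' b' where ab: "cbox a b \<inter> cbox c d = cbox a' b'" "box a b \<inter> box c d = box a' b'"
        unfolding Int_interval box_Int_box by blast
      have "AE x in lebesgue. x \<notin> cbox c d - box c d"
        by (rule AE_not_in) (use negligible_frontier_interval negligible_iff_null_sets in blast)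
      then have "AE x in lebesgue. indicator (box a b) x *\<^sub>R (indicator (cbox c d) x *\<^sub>R g x) = indicator (box a' b') x *\<^sub>R g x"
      proof eventually_elim
        case (elim x)
        have "x \<in> box a' b' \<longleftrightarrow> x \<in> box a b \<and> x \<in> cbox c d"
          using elim box_subset_cbox[of c d] unfolding ab(2)[symmetric] by auto
        then show ?case by (auto simp: indicator_def)
      qed
      moreover have "(\<lambda>x. indicator (box a' b') x *\<^sub>R g x) \<in> borel_measurable lebesgue"
      proof -
        have "set_integrable lebesgue (cbox c d) g" using g X unfolding locally_integrable_def by auto
        then have "set_integrable lebesgue (box a' b') g"
          by (rule set_integrable_subset) (use ab box_subset_cbox[of c d] in auto)
        then show ?thesis unfolding set_integrable_def by simp
      qed
      moreover have "(\<lambda>x. indicator (box a b) x *\<^sub>R (indicator (cbox c d) x *\<^sub>R g x)) \<in> borel_measurable lebesgue"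
        by (intro borel_measurable_scaleR[OF borel_measurable_indicator borel_measurable_integrable[OF int]]) auto
      ultimately have "(LINT x:box a b|lebesgue. indicator (cbox c d) x *\<^sub>R g x) = (LINT x:box a' b'|lebesgue. g x)"
        unfolding set_lebesgue_integral_def by (intro integral_cong_AE)
      also have "\<dots> = 0"
      proof (cases "box a' b' = {}")
        case False
        then have "cbox a' b' \<subseteq> \<Omega>" using ab X by auto
        then show ?thesis by (rule box0)
      qed (simp add: set_lebesgue_integral_def)
      finally show "(LINT x:box a b|lebesgue. indicator (cbox c d) x *\<^sub>R g x) = 0" .
    qed
    then show ?thesis unfolding X by eventually_elim (auto simp: indicator_def split: if_splits)
  qed
  then have "AE x in lebesgue. \<forall>X\<in>D. x \<in> X \<longrightarrow> g x = 0"
    using AE_ball_countable[OF D(1), of "\<lambda>x X. x \<in> X \<longrightarrow> g x = 0"] by blast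
  then show ?thesis by eventually_elim (use D(4) in blast)
qed

section \<open>Measurability and integrals on the unit cube\<close>

lemma unit_cube_eq_box: "unit_cube = box 0 1"
  by (auto simp: unit_cube_def mem_box_cart)

lemma open_unit_cube: "open unit_cube" and bounded_unit_cube: "bounded unit_cube"
  and convex_unit_cube: "convex unit_cube" and unit_cube_borel[measurable]: "unit_cube \<in> sets borel"
  by (auto simp: unit_cube_eq_box bounded_box)

lemma emeasure_unit_cube: "emeasure lborel (unit_cube :: (real^'d) set) = 1"
proof -
  have "(1 :: real^'d) \<bullet> b = 1" if "b \<in> Basis" for b
    using that by (auto simp: Basis_vec_def inner_axis)
  then show ?thesis by (simp add: unit_cube_eq_box emeasure_lborel_box_eq)
qed

lemma measure_unit_cube: "measure lebesgue (unit_cube :: (real^'d) set) = 1"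
  by (simp add: measure_def emeasure_unit_cube)

lemma set_integrable_bounded:
  fixes f :: "'a::euclidean_space \<Rightarrow> 'b::euclidean_space"
  assumes "f \<in> borel_measurable borel" "bounded A" "A \<in> sets borel" "\<And>x. x \<in> A \<Longrightarrow> norm (f x) \<le> C"
  shows "set_integrable lebesgue A f"
proof -
  have "set_integrable lborel A f" unfolding set_integrable_def
  proof (rule integrableI_bounded_set_indicator[where B = C])
    show "emeasure lborel A < \<infinity>" by (rule emeasure_bounded_finite) fact
  qed (use assms in auto)
  then show ?thesis unfolding set_integrable_def by (subst integrable_completion) auto
qed

lemma set_integral_abs_le_unit_cube:
  fixes f :: "real^'d \<Rightarrow> real"
  assumes "f \<in> borel_measurable borel" "\<And>x. x \<in> unit_cube \<Longrightarrow> \<bar>f x\<bar> \<le> C"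
  shows "\<bar>LINT x:unit_cube|lebesgue. f x\<bar> \<le> C"
proof -
  have f: "set_integrable lebesgue unit_cube f"
    using assms by (intro set_integrable_bounded[where C = C]) (auto simp: bounded_unit_cube)
  have C: "set_integrable lebesgue unit_cube (\<lambda>x::real^'d. C)"
    by (intro set_integrable_bounded[where C = "\<bar>C\<bar>"]) (auto simp: bounded_unit_cube)
  have "\<bar>LINT x:unit_cube|lebesgue. f x\<bar> \<le> (LINT x:unit_cube|lebesgue. \<bar>f x\<bar>)"
    using set_integral_norm_bound[OF f] by (simp only: real_norm_def)
  also have "\<dots> \<le> (LINT x:unit_cube|lebesgue. (\<lambda>x::real^'d. C) x)"
    by (rule set_integral_mono[OF set_integrable_abs[OF f] C]) (rule assms(2))
  also have "\<dots> = C"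
    using measure_unit_cube[where 'd = 'd] emeasure_unit_cube[where 'd = 'd]
    by (subst set_integral_const) auto
  finally show ?thesis .
qed

lemma borel_measurable_vecI:
  fixes G :: "'a \<Rightarrow> real^'d"
  assumes "\<And>i. (\<lambda>x. G x $ i) \<in> borel_measurable M"
  shows "G \<in> borel_measurable M"
  using assms by (subst borel_measurable_euclidean_space) (auto simp: Basis_vec_def inner_axis)

lemma borel_measurable_uniform_approx:
  fixes f :: "'a \<Rightarrow> 'b::metric_space"
  assumes "\<And>\<epsilon>. \<epsilon> > 0 \<Longrightarrow> \<exists>g\<in>borel_measurable M. \<forall>x. dist (g x) (f x) \<le> \<epsilon>"
  shows "f \<in> borel_measurable M"
proof -
  have "\<forall>n. \<exists>g. g \<in> borel_measurable M \<and> (\<forall>x. dist (g x) (f x) \<le> inverse (real (Suc n)))"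
  proof
    fix n
    have "0 < inverse (real (Suc n))" by simp
    from assms[OF this] show "\<exists>g. g \<in> borel_measurable M \<and> (\<forall>x. dist (g x) (f x) \<le> inverse (real (Suc n)))" by blast
  qed
  from choice[OF this] obtain g
    where "\<forall>n. g n \<in> borel_measurable M \<and> (\<forall>x. dist (g n x) (f x) \<le> inverse (real (Suc n)))" ..
  then have g: "\<And>n. g n \<in> borel_measurable M" "\<And>n x. dist (g n x) (f x) \<le> inverse (real (Suc n))"
    by (simp_all del: of_nat_Suc)
  show ?thesis
  proof (rule borel_measurable_LIMSEQ_metric[OF g(1)])
    fix x
    have "(\<lambda>n. dist (g n x) (f x)) \<longlonglongrightarrow> 0"
      by (rule tendsto_sandwich[OF _ _ tendsto_const LIMSEQ_inverse_real_of_nat])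
         (rule always_eventually, use g(2) in simp)+
    then show "(\<lambda>n. g n x) \<longlonglongrightarrow> f x" by (rule iffD2[OF tendsto_dist_iff])
  qed
qed

lemma set_integrable_imp_locally_integrable:
  assumes "set_integrable lebesgue \<Omega> f"
  shows "locally_integrable \<Omega> f"
  unfolding locally_integrable_def
proof (intro allI impI)
  fix K assume "compact K \<and> K \<subseteq> \<Omega>"
  then show "set_integrable lebesgue K f"
    by (intro set_integrable_subset[OF assms]) (auto intro: fmeasurableD lmeasurable_compact)
qed

section \<open>Weak gradients\<close>

text \<open>
  By translation invariance the difference quotients \<open>(F(x + he) - F(x))/h\<close> integrate to \<open>0\<close>; the local
  Lipschitz bound dominates them, so the integral of their limit is \<open>0\<close> as well.  This replaces
  integration by parts on lines and needs no Fubini theorem.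
\<close>

lemma integral_directional_derivative_eq_0:
  fixes F F' :: "'a::euclidean_space \<Rightarrow> real"
  assumes [measurable]: "F \<in> borel_measurable borel" "F' \<in> borel_measurable borel"
    and K: "bounded K" "\<And>x. x \<notin> K \<Longrightarrow> F x = 0"
    and F: "integrable lborel F"
    and \<delta>: "\<delta> > 0" "\<And>x h. 0 < h \<Longrightarrow> h < \<delta> \<Longrightarrow> \<bar>F (x + h *\<^sub>R e) - F x\<bar> \<le> C * h"
    and deriv: "AE x in lborel. ((\<lambda>h. F (x + h *\<^sub>R e)) has_real_derivative F' x) (at 0)"
  shows "(LINT x|lborel. F' x) = 0"
proof -
  \<comment> \<open>Any null sequence of step sizes below \<open>\<delta>\<close> will do.\<close>
  define h where "h n = \<delta> / 2 * inverse (real (Suc n))" for n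
  have h: "0 < h n" "h n < \<delta>" for n using \<open>\<delta> > 0\<close> by (auto simp: h_def field_simps intro: add_strict_increasing)
  have h0: "h \<longlonglongrightarrow> 0"
    unfolding h_def[abs_def] by (rule tendsto_mult_right_zero[OF LIMSEQ_inverse_real_of_nat])
  let ?D = "\<lambda>n x. (F (x + h n *\<^sub>R e) - F x) / h n"
  have trans: "integrable lborel (\<lambda>x. F (x + c))" "(LINT x|lborel. F (x + c)) = (LINT x|lborel. F x)" for c
  proof -
    have "integrable (distr lborel borel ((+) c)) F" by (simp add: lborel_distr_plus F)
    then show "integrable lborel (\<lambda>x. F (x + c))"
      by (subst (asm) integrable_distr_eq) (auto simp: add.commute)
    have "(LINT x|distr lborel borel ((+) c). F x) = (LINT x|lborel. F (c + x))"
      by (rule integral_distr) auto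
    then show "(LINT x|lborel. F (x + c)) = (LINT x|lborel. F x)"
      by (simp add: lborel_distr_plus add.commute)
  qed
  have D0: "(LINT x|lborel. ?D n x) = 0" for n
    using F trans[of "h n *\<^sub>R e"] by simp
  \<comment> \<open>All difference quotients vanish outside one ball, which makes the dominating function integrable.\<close>
  obtain r where r: "K \<subseteq> ball 0 r" using bounded_subset_ballD[OF K(1)] by blast
  define R where "R = r + \<delta> * norm e"
  have far: "F x = 0" "F (x + h n *\<^sub>R e) = 0" if "x \<notin> ball 0 R" for x n
  proof -
    have "R \<le> norm x" using that by simp
    moreover have "norm x - h n * norm e \<le> norm (x + h n *\<^sub>R e)"
      using norm_diff_ineq[of x "h n *\<^sub>R e"] h[of n] by simp
    moreover have "h n * norm e \<le> \<delta> * norm e" "0 \<le> \<delta> * norm e" using h[of n] \<open>\<delta> > 0\<close> by (auto intro!: mult_right_mono)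
    ultimately have "x \<notin> ball 0 r" "x + h n *\<^sub>R e \<notin> ball 0 r" by (auto simp: R_def)
    then show "F x = 0" "F (x + h n *\<^sub>R e) = 0" using r K(2) by blast+
  qed
  have "(\<lambda>n. LINT x|lborel. ?D n x) \<longlonglongrightarrow> (LINT x|lborel. F' x)"
  proof (rule integral_dominated_convergence[where w = "\<lambda>x. C * indicator (ball 0 R) x"])
    have "emeasure lborel (ball (0::'a) R) < \<infinity>" by (rule emeasure_bounded_finite) simp
    then show "integrable lborel (\<lambda>x::'a. C * indicator (ball 0 R) x :: real)"
      by (intro integrable_mult_right integrable_real_indicator) auto
    show "AE x in lborel. (\<lambda>n. ?D n x) \<longlonglongrightarrow> F' x"
      using deriv
    proof eventually_elim
      case (elim x)
      then have "((\<lambda>k. (F (x + k *\<^sub>R e) - F x) / k) \<longlongrightarrow> F' x) (at 0)"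
        by (simp add: DERIV_def)
      moreover have "filterlim h (at 0) sequentially"
        unfolding filterlim_at using h0 h by (auto simp: less_imp_neq[symmetric] intro!: always_eventually)
      ultimately show ?case by (rule filterlim_compose)
    qed
    show "AE x in lborel. norm (?D n x) \<le> C * indicator (ball 0 R) x" for n
    proof (rule AE_I2)
      fix x
      show "norm (?D n x) \<le> C * indicator (ball 0 R) x"
      proof (cases "x \<in> ball 0 R")
        case True
        then show ?thesis using \<delta>(2)[OF h, of x n] h[of n] by (simp add: divide_le_eq)
      qed (simp add: far)
    qed
    have "integrable lborel (?D n)" for n
      using F trans(1)[of "h n *\<^sub>R e"] by simp
    then show "?D n \<in> borel_measurable lborel" for n by (rule borel_measurable_integrable)
  qed simp
  then show ?thesis unfolding D0 by (simp add: LIMSEQ_const_iff)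
qed

text \<open>
  The facts about a test function on which all estimates rest, with one bound \<open>P\<close> for the function
  and all its first partial derivatives.
\<close>

lemma test_functionE:
  fixes \<psi> :: "real^'d \<Rightarrow> real"
  assumes "\<psi> \<in> test_functions \<Omega>"
  obtains K P where "compact K" "K \<subseteq> \<Omega>" "0 \<le> P" "continuous_on UNIV \<psi>" "\<And>i. continuous_on UNIV (partial_deriv i \<psi>)"
    "\<And>x. x \<notin> K \<Longrightarrow> \<psi> x = 0" "\<And>i x. x \<notin> K \<Longrightarrow> partial_deriv i \<psi> x = 0"
    "\<And>x. \<bar>\<psi> x\<bar> \<le> P" "\<And>i x. \<bar>partial_deriv i \<psi> x\<bar> \<le> P"
    "\<And>x. (\<psi> has_derivative frechet_derivative \<psi> (at x)) (at x)"
proof -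
  let ?K = "closure {x. \<psi> x \<noteq> 0}"
  from assms have td: "times_differentiable (Suc (Suc 0)) \<psi>" and K: "compact ?K" "?K \<subseteq> \<Omega>"
    unfolding test_functions_def by blast+
  have diff: "(\<psi> has_derivative frechet_derivative \<psi> (at x)) (at x)" for x
    using td by (intro iffD1[OF frechet_derivative_works]) simp
  have cont: "continuous_on UNIV \<psi>" "continuous_on UNIV (partial_deriv i \<psi>)" for i
    using td by (simp_all add: continuous_at_imp_continuous_on differentiable_imp_continuous_within)
  have out: "\<psi> x = 0" if "x \<notin> ?K" for x using that closure_subset[of "{x. \<psi> x \<noteq> 0}"] by auto
  have out': "partial_deriv i \<psi> x = 0" if "x \<notin> ?K" for x i
  proof -
    have "open (- ?K)" "x \<in> - ?K" using that by auto
    moreover have "0 = \<psi> y" if "y \<in> - ?K" for y using out[of y] that by simp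
    ultimately have "(\<psi> has_derivative (\<lambda>v. 0)) (at x)"
      by (rule has_derivative_transform_within_open[OF has_derivative_const])
    from partial_deriv_eqI[OF this] show ?thesis by simp
  qed
  have bd: "\<exists>P. \<forall>x. \<bar>g x\<bar> \<le> P" if g: "continuous_on UNIV g" "\<And>x. x \<notin> ?K \<Longrightarrow> g x = 0" for g :: "real^'d \<Rightarrow> real"
  proof -
    have "compact (g ` ?K)" by (rule compact_continuous_image[OF continuous_on_subset[OF g(1)] K(1)]) simp
    then have "bounded (g ` ?K)" by (rule compact_imp_bounded)
    then obtain P where P: "\<forall>y\<in>g ` ?K. norm y \<le> P" unfolding bounded_iff by blast
    have "\<bar>g x\<bar> \<le> max P 0" for x
      using P g(2)[of x] by (cases "x \<in> ?K") (simp_all add: max.coboundedI1)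
    then show ?thesis by blast
  qed
  obtain P0 where P0: "\<And>x. \<bar>\<psi> x\<bar> \<le> P0" using bd[OF cont(1) out] by blast
  have "\<forall>i. \<exists>P. \<forall>x. \<bar>partial_deriv i \<psi> x\<bar> \<le> P" using bd[OF cont(2) out'] by blast
  then obtain P where P: "\<And>i x. \<bar>partial_deriv i \<psi> x\<bar> \<le> P i" by metis
  have P0': "0 \<le> P0" using P0[of undefined] by linarith
  have P': "0 \<le> P i" for i using P[of i undefined] by linarith
  have bound: "\<bar>\<psi> x\<bar> \<le> P0 + (\<Sum>i\<in>UNIV. P i)" for x
    using P0[of x] P' by (simp add: sum_nonneg add_increasing2)
  have bound': "\<bar>partial_deriv i \<psi> x\<bar> \<le> P0 + (\<Sum>i\<in>UNIV. P i)" for i x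
    using P[of i x] P' P0' member_le_sum[of i UNIV P] by force
  have "0 \<le> P0 + (\<Sum>i\<in>UNIV. P i)" using P' P0' by (simp add: sum_nonneg)
  then show thesis by (rule that[OF K _ cont out out' bound bound' diff])
qed

lemma has_derivative_along_line:
  fixes f :: "'a::real_normed_vector \<Rightarrow> real"
  assumes "(f has_derivative D) (at (x + t *\<^sub>R e))"
  shows "((\<lambda>h. f (x + h *\<^sub>R e)) has_real_derivative D e) (at t)"
proof -
  have "((\<lambda>h. x + h *\<^sub>R e) has_derivative (\<lambda>h. h *\<^sub>R e)) (at t)"
    by (auto intro!: derivative_eq_intros)
  from has_derivative_compose[OF this assms]
  have "((\<lambda>h. f (x + h *\<^sub>R e)) has_derivative (\<lambda>h. D (h *\<^sub>R e))) (at t)" .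
  then show ?thesis
    unfolding has_field_derivative_def
    by (rule has_derivative_eq_rhs) (simp add: linear_cmul[OF has_derivative_linear[OF assms]] fun_eq_iff)
qed

text \<open>
  For a test function \<open>\<psi>\<close> the product \<open>f\<psi>\<close>, which vanishes outside the support of \<open>\<psi>\<close>, satisfies the
  hypotheses of \<open>integral_directional_derivative_eq_0\<close>, and the integral of its derivative \<open>f \<partial>\<^sub>i\<psi> + G\<^sub>i\<psi>\<close> vanishing is the
  defining identity of a weak gradient.
\<close>

lemma has_weak_gradient_unit_cubeI:
  fixes f :: "real^'d \<Rightarrow> real" and G :: "real^'d \<Rightarrow> real^'d"
  assumes [measurable]: "f \<in> borel_measurable borel" "G \<in> borel_measurable borel"
    and bd: "\<And>x. x \<in> unit_cube \<Longrightarrow> \<bar>f x\<bar> \<le> C" "\<And>x. x \<in> unit_cube \<Longrightarrow> norm (G x) \<le> C'"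
    and lip: "L-lipschitz_on unit_cube f"
    and deriv: "AE x in lborel. x \<in> unit_cube \<longrightarrow> (f has_derivative (\<lambda>v. G x \<bullet> v)) (at x)"
  shows "has_weak_gradient unit_cube f G"
  unfolding has_weak_gradient_def
proof (intro conjI ballI allI)
  show "locally_integrable unit_cube f" "locally_integrable unit_cube G"
    unfolding locally_integrable_def using bd
    by (auto intro!: set_integrable_bounded[of f _ C] set_integrable_bounded[of G _ C'] compact_imp_bounded compact_imp_closed borel_closed)
  fix \<psi> :: "real^'d \<Rightarrow> real" and i :: 'd
  assume "\<psi> \<in> test_functions unit_cube"
  then obtain K P where K: "compact K" "K \<subseteq> unit_cube" and P: "0 \<le> P" "\<And>x. \<bar>\<psi> x\<bar> \<le> P" "\<And>i x. \<bar>partial_deriv i \<psi> x\<bar> \<le> P"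
    and cont: "continuous_on UNIV \<psi>" "\<And>i. continuous_on UNIV (partial_deriv i \<psi>)"
    and out: "\<And>x. x \<notin> K \<Longrightarrow> \<psi> x = 0" "\<And>i x. x \<notin> K \<Longrightarrow> partial_deriv i \<psi> x = 0"
    and diff: "\<And>x. (\<psi> has_derivative frechet_derivative \<psi> (at x)) (at x)"
    by (rule test_functionE) blast
  have [measurable]: "\<psi> \<in> borel_measurable borel" "partial_deriv i \<psi> \<in> borel_measurable borel"
    using cont by (blast intro: borel_measurable_continuous_onI)+
  have [measurable]: "(\<lambda>x. G x $ i) \<in> borel_measurable borel"
    by (rule measurable_compose[OF assms(2)]) (intro borel_measurable_continuous_onI continuous_intros)
  let ?e = "axis i 1 :: real^'d"
  define F where "F x = f x * \<psi> x" for x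
  define F' where "F' x = indicator unit_cube x * (f x * partial_deriv i \<psi> x) + indicator unit_cube x * (G x $ i * \<psi> x)" for x
  have F0: "F x = 0" if "x \<notin> K" for x using out that by (simp add: F_def)
  have [measurable]: "F \<in> borel_measurable borel" "F' \<in> borel_measurable borel"
    unfolding F_def[abs_def] F'_def[abs_def] by measurable
  \<comment> \<open>For steps below the distance of the support from the boundary, both end points lie in the cube
    as soon as one lies in the support; so the Lipschitz bound on the cube is enough.\<close>
  obtain \<delta> where \<delta>: "\<delta> > 0" "\<And>x y. x \<in> K \<Longrightarrow> y \<notin> unit_cube \<Longrightarrow> \<delta> \<le> dist x y"
    using separate_compact_closed[OF K(1), of "- unit_cube"] K(2) open_unit_cube
    by (metis ComplI Diff_eq Diff_eq_empty_iff closed_Compl)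
  have along: "((\<lambda>h. \<psi> (x + h *\<^sub>R ?e)) has_real_derivative partial_deriv i \<psi> (x + t *\<^sub>R ?e)) (at t)" for x t
    unfolding partial_deriv_def by (rule has_derivative_along_line[OF diff])
  have "(LINT x|lborel. F' x) = 0"
  proof (rule integral_directional_derivative_eq_0)
    show "bounded K" using K(1) by (rule compact_imp_bounded)
    have "set_integrable lebesgue K F"
    proof (rule set_integrable_bounded)
      show "norm (F x) \<le> C * P" if "x \<in> K" for x
        using bd(1)[of x] P(2)[of x] that K(2) by (auto simp: F_def abs_mult intro!: mult_mono')
    qed (use K(1) in \<open>auto intro: compact_imp_bounded compact_imp_closed borel_closed\<close>)
    moreover have "(\<lambda>x. indicator K x *\<^sub>R F x) = F" using F0 by (auto simp: indicator_def fun_eq_iff)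
    ultimately show "integrable lborel F" by (simp add: set_integrable_def integrable_completion)
    show "\<delta> > 0" by fact
    show "\<bar>F (x + h *\<^sub>R ?e) - F x\<bar> \<le> (C * P + P * L) * h" if h: "0 < h" "h < \<delta>" for x h
    proof (cases "x \<in> K \<or> x + h *\<^sub>R ?e \<in> K")
      case True
      let ?y = "x + h *\<^sub>R ?e"
      have "dist x ?y = h" using h by (simp add: dist_norm)
      then have in_cube: "x \<in> unit_cube" "?y \<in> unit_cube"
        using True K(2) h \<delta>(2)[of x ?y] \<delta>(2)[of ?y x] by (auto simp: dist_commute)
      obtain z where "\<psi> (x + h *\<^sub>R ?e) - \<psi> (x + 0 *\<^sub>R ?e) = (h - 0) * partial_deriv i \<psi> (x + z *\<^sub>R ?e)"
        using MVT2[OF h(1), of "\<lambda>h. \<psi> (x + h *\<^sub>R ?e)", OF along] by blast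
      then have "\<bar>\<psi> ?y - \<psi> x\<bar> \<le> P * h"
        using P(3)[of i "x + z *\<^sub>R ?e"] h by (simp add: abs_mult mult.commute)
      then have "\<bar>f ?y * (\<psi> ?y - \<psi> x)\<bar> \<le> C * (P * h)"
        unfolding abs_mult using bd(1)[OF in_cube(2)] by (intro mult_mono) auto
      moreover have "\<bar>f ?y - f x\<bar> \<le> L * h"
        using lipschitz_onD[OF lip in_cube(2,1)] \<open>dist x ?y = h\<close> by (simp add: dist_commute dist_real_def)
      then have "\<bar>\<psi> x * (f ?y - f x)\<bar> \<le> P * (L * h)"
        unfolding abs_mult using P(2)[of x] by (intro mult_mono) auto
      moreover have "F ?y - F x = f ?y * (\<psi> ?y - \<psi> x) + \<psi> x * (f ?y - f x)"
        by (simp add: F_def algebra_simps)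
      ultimately show ?thesis by (simp add: algebra_simps)
    next
      case False
      moreover have "0 \<le> C" using bd(1)[of "\<chi> i. 1/2"] by (simp add: unit_cube_def)
      ultimately show ?thesis using F0 P(1) h lipschitz_on_nonneg[OF lip] by auto
    qed
    show "AE x in lborel. ((\<lambda>h. F (x + h *\<^sub>R ?e)) has_real_derivative F' x) (at 0)"
      using deriv
    proof eventually_elim
      case (elim x)
      show ?case
      proof (cases "x \<in> unit_cube")
        case True
        with elim have "(f has_derivative (\<lambda>v. G x \<bullet> v)) (at (x + 0 *\<^sub>R ?e))" by simp
        from has_derivative_along_line[OF this]
        have "((\<lambda>h. f (x + h *\<^sub>R ?e)) has_real_derivative G x $ i) (at 0)" by (simp add: inner_axis)
        from DERIV_mult[OF this along[of x 0]] show ?thesis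
          using True by (simp add: F_def F'_def ac_simps)
      next
        case False
        then have x: "x \<in> - K" using K(2) by auto
        let ?U = "(\<lambda>h::real. x + h *\<^sub>R ?e) -` (- K)"
        have U: "open ?U"
          using K(1) by (intro open_vimage) (auto intro!: continuous_intros compact_imp_closed)
        have zero: "((\<lambda>h. 0) has_real_derivative F' x) (at 0)"
          using False by (simp add: F'_def)
        show ?thesis
          by (rule has_field_derivative_transform_within_open[OF zero U]) (use x F0 in simp_all)
      qed
    qed
  qed (use F0 in auto)
  moreover have "set_integrable lebesgue unit_cube (\<lambda>x::real^'d. f x * partial_deriv i \<psi> x)"
    by (rule set_integrable_bounded[where C = "C * P"])
       (use bd(1) P in \<open>auto simp: bounded_unit_cube abs_mult intro!: mult_mono'\<close>)
  moreover have "set_integrable lebesgue unit_cube (\<lambda>x::real^'d. G x $ i * \<psi> x)"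
  proof (rule set_integrable_bounded[where C = "C' * P"])
    fix x :: "real^'d" assume "x \<in> unit_cube"
    then have "\<bar>G x $ i\<bar> \<le> C'" using bd(2)[of x] component_le_norm_cart[of "G x" i] by simp
    then show "norm (G x $ i * \<psi> x) \<le> C' * P" using P(2)[of x] by (auto simp: abs_mult intro!: mult_mono')
  qed (auto simp: bounded_unit_cube)
  ultimately show "(LINT x:unit_cube|lebesgue. f x * partial_deriv i \<psi> x) = - (LINT x:unit_cube|lebesgue. G x $ i * \<psi> x)"
    unfolding set_lebesgue_integral_def set_integrable_def F'_def
    by (simp add: integral_completion integrable_completion)
qed

lemma set_integrable_times_test_function:
  fixes f :: "real^'d \<Rightarrow> real"
  assumes \<Omega>: "\<Omega> \<in> sets borel" and f: "locally_integrable \<Omega> f" and K: "compact K" "K \<subseteq> \<Omega>"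
    and \<eta>: "continuous_on UNIV \<eta>" "\<And>x. x \<notin> K \<Longrightarrow> \<eta> x = 0" "\<And>x. \<bar>\<eta> x\<bar> \<le> P"
  shows "set_integrable lebesgue \<Omega> (\<lambda>x. f x * \<eta> x)"
proof -
  have int: "integrable lebesgue (\<lambda>x. indicator K x *\<^sub>R f x)"
    using f K unfolding locally_integrable_def set_integrable_def by blast
  have [measurable]: "\<eta> \<in> borel_measurable lebesgue"
    using borel_measurable_continuous_onI[OF \<eta>(1)] by (intro measurable_completion) simp
  have "integrable lebesgue (\<lambda>x. P * norm (indicator K x *\<^sub>R f x))"
    by (intro integrable_mult_right integrable_norm int)
  then have "integrable lebesgue (\<lambda>x. \<eta> x * (indicator K x *\<^sub>R f x))"
  proof (rule Bochner_Integration.integrable_bound)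
    show "(\<lambda>x. \<eta> x * (indicator K x *\<^sub>R f x)) \<in> borel_measurable lebesgue"
      by (intro borel_measurable_times borel_measurable_integrable[OF int]) measurable
    show "AE x in lebesgue. norm (\<eta> x * (indicator K x *\<^sub>R f x)) \<le> norm (P * norm (indicator K x *\<^sub>R f x))"
    proof (rule AE_I2)
      fix x
      have "\<bar>\<eta> x\<bar> \<le> \<bar>P\<bar>" using \<eta>(3)[of x] by linarith
      then show "norm (\<eta> x * (indicator K x *\<^sub>R f x)) \<le> norm (P * norm (indicator K x *\<^sub>R f x))"
        by (simp add: abs_mult mult_right_mono)
    qed
  qed
  moreover have "(\<lambda>x. \<eta> x * (indicator K x *\<^sub>R f x)) = (\<lambda>x. indicator \<Omega> x *\<^sub>R (f x * \<eta> x))"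
    using \<eta>(2) K(2) by (fastforce simp: indicator_def fun_eq_iff)
  ultimately show ?thesis unfolding set_integrable_def by simp
qed

lemma locally_integrable_component:
  fixes G :: "real^'d \<Rightarrow> real^'d"
  assumes "locally_integrable \<Omega> G"
  shows "locally_integrable \<Omega> (\<lambda>x. G x $ i)"
  unfolding locally_integrable_def
proof (intro allI impI)
  fix K assume "compact K \<and> K \<subseteq> \<Omega>"
  then have "integrable lebesgue (\<lambda>x. indicator K x *\<^sub>R G x)"
    using assms unfolding locally_integrable_def set_integrable_def by blast
  from integrable_bounded_linear[OF bounded_linear_vec_nth this, of i]
  show "set_integrable lebesgue K (\<lambda>x. G x $ i)" by (simp add: set_integrable_def)
qed

lemma test_function_set_integrable:
  fixes f :: "real^'d \<Rightarrow> real"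
  assumes "\<Omega> \<in> sets borel" "locally_integrable \<Omega> f" "\<psi> \<in> test_functions \<Omega>"
  shows "set_integrable lebesgue \<Omega> (\<lambda>x. f x * \<psi> x)"
    and "set_integrable lebesgue \<Omega> (\<lambda>x. f x * partial_deriv i \<psi> x)"
proof -
  from assms(3) obtain K P where K: "compact K" "K \<subseteq> \<Omega>"
    and \<psi>: "continuous_on UNIV \<psi>" "\<And>x. x \<notin> K \<Longrightarrow> \<psi> x = 0" "\<And>x. \<bar>\<psi> x\<bar> \<le> P"
    and \<psi>': "\<And>i. continuous_on UNIV (partial_deriv i \<psi>)" "\<And>i x. x \<notin> K \<Longrightarrow> partial_deriv i \<psi> x = 0"
      "\<And>i x. \<bar>partial_deriv i \<psi> x\<bar> \<le> P"
    by (rule test_functionE) blast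
  show "set_integrable lebesgue \<Omega> (\<lambda>x. f x * \<psi> x)"
    by (rule set_integrable_times_test_function[OF assms(1,2) K \<psi>])
  show "set_integrable lebesgue \<Omega> (\<lambda>x. f x * partial_deriv i \<psi> x)"
    by (rule set_integrable_times_test_function[OF assms(1,2) K \<psi>'(1)[of i] \<psi>'(2)[of _ i] \<psi>'(3)[of i]])
qed

lemma has_weak_gradient_integral:
  assumes "has_weak_gradient \<Omega> f G" "\<psi> \<in> test_functions \<Omega>"
  shows "(LINT x:\<Omega>|lebesgue. f x * partial_deriv i \<psi> x) = - (LINT x:\<Omega>|lebesgue. G x $ i * \<psi> x)"
  using assms by (simp add: has_weak_gradient_def)

lemma has_weak_gradient_locally_integrable:
  assumes "has_weak_gradient \<Omega> f G"
  shows "locally_integrable \<Omega> f" "locally_integrable \<Omega> G" "locally_integrable \<Omega> (\<lambda>x. G x $ i)"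
  using assms by (auto simp: has_weak_gradient_def intro: locally_integrable_component)

lemma has_weak_gradient_diff:
  fixes f f' :: "real^'d \<Rightarrow> real"
  assumes \<Omega>: "\<Omega> \<in> sets borel" and f: "has_weak_gradient \<Omega> f G" and f': "has_weak_gradient \<Omega> f' G'"
  shows "has_weak_gradient \<Omega> (\<lambda>x. f x - f' x) (\<lambda>x. G x - G' x)"
  unfolding has_weak_gradient_def
proof (intro conjI ballI allI)
  note li = has_weak_gradient_locally_integrable[OF f] has_weak_gradient_locally_integrable[OF f']
  show "locally_integrable \<Omega> (\<lambda>x. f x - f' x)" "locally_integrable \<Omega> (\<lambda>x. G x - G' x)"
    using li unfolding locally_integrable_def by (auto intro!: set_integral_diff(1))
  fix \<psi> :: "real^'d \<Rightarrow> real" and i :: 'd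
  assume \<psi>: "\<psi> \<in> test_functions \<Omega>"
  have "(LINT x:\<Omega>|lebesgue. (f x - f' x) * partial_deriv i \<psi> x) =
      (LINT x:\<Omega>|lebesgue. f x * partial_deriv i \<psi> x) - (LINT x:\<Omega>|lebesgue. f' x * partial_deriv i \<psi> x)"
    unfolding left_diff_distrib
    by (rule set_integral_diff(2)[OF test_function_set_integrable(2)[OF \<Omega> li(1) \<psi>]
          test_function_set_integrable(2)[OF \<Omega> li(4) \<psi>]])
  moreover have "(LINT x:\<Omega>|lebesgue. (G x - G' x) $ i * \<psi> x) =
      (LINT x:\<Omega>|lebesgue. G x $ i * \<psi> x) - (LINT x:\<Omega>|lebesgue. G' x $ i * \<psi> x)"
    unfolding left_diff_distrib vector_minus_component
    by (rule set_integral_diff(2)[OF test_function_set_integrable(1)[OF \<Omega> li(3) \<psi>]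
          test_function_set_integrable(1)[OF \<Omega> li(6) \<psi>]])
  moreover note has_weak_gradient_integral[OF f \<psi>, of i] has_weak_gradient_integral[OF f' \<psi>, of i]
  ultimately show "(LINT x:\<Omega>|lebesgue. (f x - f' x) * partial_deriv i \<psi> x) = - (LINT x:\<Omega>|lebesgue. (G x - G' x) $ i * \<psi> x)"
    by linarith
qed

text \<open>
  The difference of two weak gradients is a weak gradient of \<open>0\<close>.
\<close>

lemma has_weak_gradient_unique:
  fixes f :: "real^'d \<Rightarrow> real"
  assumes "open \<Omega>" "has_weak_gradient \<Omega> f G" "has_weak_gradient \<Omega> f G'"
  shows "AE x in lebesgue. x \<in> \<Omega> \<longrightarrow> G x = G' x"
proof -
  have "has_weak_gradient \<Omega> (\<lambda>x. f x - f x) (\<lambda>x. G x - G' x)"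
    using assms by (intro has_weak_gradient_diff) auto
  then have D: "has_weak_gradient \<Omega> (\<lambda>x. 0) (\<lambda>x. G x - G' x)" by simp
  have "AE x in lebesgue. x \<in> \<Omega> \<longrightarrow> (G x - G' x) $ i = 0" for i
  proof (rule AE_eq_0_of_test_function_integrals[OF \<open>open \<Omega>\<close> has_weak_gradient_locally_integrable(3)[OF D]])
    fix \<psi> assume "\<psi> \<in> test_functions \<Omega>"
    from has_weak_gradient_integral[OF D this, of i]
    show "(LINT x:\<Omega>|lebesgue. (G x - G' x) $ i * \<psi> x) = 0" by simp
  qed
  then have "AE x in lebesgue. \<forall>i. x \<in> \<Omega> \<longrightarrow> (G x - G' x) $ i = 0"
    by (rule AE_all_countable[THEN iffD2, rule_format])
  then show ?thesis by eventually_elim (simp add: vec_eq_iff)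
qed

text \<open>
  Both sides of the defining identity are continuous under uniform convergence.  This gives the weak
  gradient of a sine series from its partial sums.
\<close>

lemma has_weak_gradient_uniform_limit:
  fixes f :: "real^'d \<Rightarrow> real" and G :: "real^'d \<Rightarrow> real^'d"
  assumes \<Omega>: "\<Omega> \<in> sets borel" "measure lebesgue \<Omega> = 1"
    and f: "locally_integrable \<Omega> f" and G: "locally_integrable \<Omega> G"
    and approx: "\<And>\<epsilon>. \<epsilon> > 0 \<Longrightarrow> \<exists>f' G'. has_weak_gradient \<Omega> f' G' \<and>
                    (\<forall>x\<in>\<Omega>. \<bar>f x - f' x\<bar> \<le> \<epsilon> \<and> norm (G x - G' x) \<le> \<epsilon>)"
  shows "has_weak_gradient \<Omega> f G"
  unfolding has_weak_gradient_def
proof (intro conjI ballI allI f G)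
  fix \<psi> :: "real^'d \<Rightarrow> real" and i :: 'd
  assume \<psi>: "\<psi> \<in> test_functions \<Omega>"
  then obtain P where P: "0 \<le> P" "\<And>x. \<bar>\<psi> x\<bar> \<le> P" "\<And>i x. \<bar>partial_deriv i \<psi> x\<bar> \<le> P"
    by (rule test_functionE) blast
  have "emeasure lebesgue \<Omega> \<noteq> \<infinity>" using \<Omega>(2) by (auto simp: measure_def)
  then have fin: "set_integrable lebesgue \<Omega> (\<lambda>x. c)" "(LINT x:\<Omega>|lebesgue. c) = c" for c :: real
    using \<Omega> by (simp_all add: set_integrable_def top.not_eq_extremum set_integral_const)
  note int = test_function_set_integrable[OF \<Omega>(1) _ \<psi>]
  have small: "\<bar>(LINT x:\<Omega>|lebesgue. h x * \<eta> x) - (LINT x:\<Omega>|lebesgue. h' x * \<eta> x)\<bar> \<le> \<epsilon> * P"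
    if h: "set_integrable lebesgue \<Omega> (\<lambda>x. h x * \<eta> x)" "set_integrable lebesgue \<Omega> (\<lambda>x. h' x * \<eta> x)"
      and cl: "\<And>x. x \<in> \<Omega> \<Longrightarrow> \<bar>h x - h' x\<bar> \<le> \<epsilon>" "\<And>x. \<bar>\<eta> x\<bar> \<le> P" for h h' \<eta> :: "real^'d \<Rightarrow> real" and \<epsilon>
  proof -
    define D where "D x = h x * \<eta> x - h' x * \<eta> x" for x
    have D: "set_integrable lebesgue \<Omega> D" unfolding D_def by (rule set_integral_diff(1)[OF h])
    have "(LINT x:\<Omega>|lebesgue. h x * \<eta> x) - (LINT x:\<Omega>|lebesgue. h' x * \<eta> x) = (LINT x:\<Omega>|lebesgue. D x)"
      unfolding D_def by (rule set_integral_diff(2)[OF h, symmetric])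
    also have "\<bar>\<dots>\<bar> \<le> (LINT x:\<Omega>|lebesgue. \<bar>D x\<bar>)"
      using set_integral_norm_bound[OF D] by (simp only: real_norm_def)
    also have "\<dots> \<le> (LINT x:\<Omega>|lebesgue. \<epsilon> * P)"
    proof (rule set_integral_mono[OF set_integrable_abs[OF D] fin(1)])
      fix x assume "x \<in> \<Omega>"
      then show "\<bar>D x\<bar> \<le> \<epsilon> * P"
        unfolding D_def left_diff_distrib[symmetric] abs_mult using cl by (intro mult_mono') auto
    qed
    finally show ?thesis by (simp only: fin)
  qed
  let ?e = "(LINT x:\<Omega>|lebesgue. f x * partial_deriv i \<psi> x) + (LINT x:\<Omega>|lebesgue. G x $ i * \<psi> x)"
  have le: "\<bar>?e\<bar> \<le> \<epsilon> * (2 * P)" if eps: "\<epsilon> > 0" for \<epsilon>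
  proof -
    obtain f' G' where wk: "has_weak_gradient \<Omega> f' G'"
      and cl: "\<And>x. x \<in> \<Omega> \<Longrightarrow> \<bar>f x - f' x\<bar> \<le> \<epsilon>" "\<And>x. x \<in> \<Omega> \<Longrightarrow> norm (G x - G' x) \<le> \<epsilon>"
      using approx[OF eps] by blast
    note li = has_weak_gradient_locally_integrable[OF wk]
    have "\<bar>G x $ i - G' x $ i\<bar> \<le> \<epsilon>" if "x \<in> \<Omega>" for x
      using cl(2)[OF that] component_le_norm_cart[of "G x - G' x" i] by simp
    note small[OF int(2)[OF f] int(2)[OF li(1)] cl(1) P(3)[of i]]
      small[OF int(1)[OF locally_integrable_component[OF G]] int(1)[OF li(3)] this P(2)]
      has_weak_gradient_integral[OF wk \<psi>, of i]
    then show ?thesis by linarith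
  qed
  have "\<bar>?e\<bar> \<le> 0 + \<epsilon>" if "\<epsilon> > 0" for \<epsilon>
  proof -
    have "\<bar>?e\<bar> \<le> \<epsilon> / (2 * P + 1) * (2 * P)"
      by (rule le) (use P(1) that in simp)
    also have "\<dots> \<le> \<epsilon>" using P(1) that by (simp add: field_simps)
    finally show ?thesis by simp
  qed
  then have "\<bar>?e\<bar> \<le> 0" by (rule field_le_epsilon)
  then show "(LINT x:\<Omega>|lebesgue. f x * partial_deriv i \<psi> x) = - (LINT x:\<Omega>|lebesgue. G x $ i * \<psi> x)"
    by linarith
qed

lemma has_weak_gradient_cong_AE:
  fixes f f' :: "real^'d \<Rightarrow> real"
  assumes \<Omega>: "\<Omega> \<in> sets borel" and f: "has_weak_gradient \<Omega> f G" and f': "locally_integrable \<Omega> f'"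
    and eq: "AE x in lebesgue. x \<in> \<Omega> \<longrightarrow> f' x = f x"
  shows "has_weak_gradient \<Omega> f' G"
  unfolding has_weak_gradient_def
proof (intro conjI ballI allI f')
  show "locally_integrable \<Omega> G" by (rule has_weak_gradient_locally_integrable(2)[OF f])
  fix \<psi> :: "real^'d \<Rightarrow> real" and i :: 'd
  assume \<psi>: "\<psi> \<in> test_functions \<Omega>"
  have "(LINT x:\<Omega>|lebesgue. f' x * partial_deriv i \<psi> x) = (LINT x:\<Omega>|lebesgue. f x * partial_deriv i \<psi> x)"
    unfolding set_lebesgue_integral_def
  proof (rule integral_cong_AE)
    show "AE x in lebesgue. indicator \<Omega> x *\<^sub>R (f' x * partial_deriv i \<psi> x) = indicator \<Omega> x *\<^sub>R (f x * partial_deriv i \<psi> x)"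
      using eq by eventually_elim (auto simp: indicator_def)
  qed (use test_function_set_integrable(2)[OF \<Omega> f' \<psi>, of i]
         test_function_set_integrable(2)[OF \<Omega> has_weak_gradient_locally_integrable(1)[OF f] \<psi>, of i]
       in \<open>auto simp: set_integrable_def\<close>)
  then show "(LINT x:\<Omega>|lebesgue. f' x * partial_deriv i \<psi> x) = - (LINT x:\<Omega>|lebesgue. G x $ i * \<psi> x)"
    using has_weak_gradient_integral[OF f \<psi>] by simp
qed

text \<open>
  The norm is defined through an arbitrarily chosen weak gradient; by uniqueness any square integrable
  one may be used to compute it.
\<close>

lemma H1_norm_eq:
  fixes f :: "real^'d \<Rightarrow> real"
  assumes "open \<Omega>" and G: "has_weak_gradient \<Omega> f G" and sq: "square_integrable \<Omega> G"
  shows "H1_norm \<Omega> f = sqrt ((LINT x:\<Omega>|lebesgue. (f x)\<^sup>2) + (LINT x:\<Omega>|lebesgue. (norm (G x))\<^sup>2))"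
proof -
  have "has_weak_gradient \<Omega> f (weak_gradient \<Omega> f)"
    unfolding weak_gradient_def using G by (rule someI[of "has_weak_gradient \<Omega> f"])
  from has_weak_gradient_unique[OF assms(1) G this]
  have AE: "AE x in lebesgue. indicator \<Omega> x *\<^sub>R (norm (G x))\<^sup>2 = indicator \<Omega> x *\<^sub>R (norm (weak_gradient \<Omega> f x))\<^sup>2"
    by eventually_elim (auto simp: indicator_def)
  have meas: "(\<lambda>x. indicator \<Omega> x *\<^sub>R (norm (G x))\<^sup>2) \<in> borel_measurable lebesgue"
    using sq unfolding square_integrable_def set_integrable_def by auto
  have "(LINT x:\<Omega>|lebesgue. (norm (G x))\<^sup>2) = (LINT x:\<Omega>|lebesgue. (norm (weak_gradient \<Omega> f x))\<^sup>2)"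
    unfolding set_lebesgue_integral_def
    using meas borel_measurable_AE[OF meas AE] AE by (rule integral_cong_AE)
  then show ?thesis by (simp add: H1_norm_def)
qed

lemma lipschitz_on_unit_cubeI:
  fixes f :: "real^'d \<Rightarrow> real"
  assumes "\<And>x. x \<in> unit_cube \<Longrightarrow> (f has_derivative (\<lambda>v. G x \<bullet> v)) (at x)"
    and "\<And>x. x \<in> unit_cube \<Longrightarrow> norm (G x) \<le> L"
  shows "L-lipschitz_on unit_cube f"
proof -
  have "norm (G (\<chi> i. 1/2)) \<le> L" by (rule assms(2)) (simp add: unit_cube_def)
  then have L: "0 \<le> L" using norm_ge_zero order_trans by blast
  have "norm (f x - f y) \<le> L * norm (x - y)" if "x \<in> unit_cube" "y \<in> unit_cube" for x y
  proof (rule differentiable_bound[OF convex_unit_cube])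
    show "(f has_derivative (\<lambda>v. G z \<bullet> v)) (at z within unit_cube)" if "z \<in> unit_cube" for z
      using assms(1)[OF that] by (rule has_derivative_at_withinI)
    show "onorm (\<lambda>v. G z \<bullet> v) \<le> L" if "z \<in> unit_cube" for z
    proof (rule onorm_le)
      fix v
      have "norm (G z \<bullet> v) \<le> norm (G z) * norm v" using Cauchy_Schwarz_ineq2[of "G z" v] by simp
      also have "\<dots> \<le> L * norm v" using assms(2)[OF that] by (simp add: mult_right_mono)
      finally show "norm (G z \<bullet> v) \<le> L * norm v" .
    qed
  qed (use that in auto)
  then show ?thesis using L by (auto intro!: lipschitz_onI simp: dist_norm)
qed

section \<open>Sampling from a convex combination\<close>

text \<open>
  The mixed term with \<open>y - g j\<close> averages out because \<open>y\<close> is the mean of the \<open>g j\<close>.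
\<close>

lemma convex_combination_second_moment:
  fixes S y :: "'b::real_inner"
  assumes "(\<Sum>j\<in>J. l j) = 1" "y = (\<Sum>j\<in>J. l j *\<^sub>R g j)"
  shows "(\<Sum>j\<in>J. l j * (norm (S + (y - g j)))\<^sup>2) =
     (norm S)\<^sup>2 - (norm y)\<^sup>2 + (\<Sum>j\<in>J. l j * (norm (g j))\<^sup>2)"
proof -
  have "l j * (norm (S + (y - g j)))\<^sup>2 =
      l j * (norm S)\<^sup>2 + 2 * (l j * (S \<bullet> y)) + l j * (norm y)\<^sup>2 + l j * (norm (g j))\<^sup>2
        - 2 * ((S + y) \<bullet> (l j *\<^sub>R g j))" for j
    by (simp add: power2_norm_eq_inner inner_simps inner_commute algebra_simps)
  then have "(\<Sum>j\<in>J. l j * (norm (S + (y - g j)))\<^sup>2) =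
      (\<Sum>j\<in>J. l j) * (norm S)\<^sup>2 + 2 * ((\<Sum>j\<in>J. l j) * (S \<bullet> y)) + (\<Sum>j\<in>J. l j) * (norm y)\<^sup>2
      + (\<Sum>j\<in>J. l j * (norm (g j))\<^sup>2) - 2 * ((S + y) \<bullet> (\<Sum>j\<in>J. l j *\<^sub>R g j))"
    by (simp add: sum.distrib sum_subtractf sum_distrib_left sum_distrib_right inner_sum_right)
  also have "\<dots> = (norm S)\<^sup>2 - (norm y)\<^sup>2 + (\<Sum>j\<in>J. l j * (norm (g j))\<^sup>2)"
    unfolding assms(1) assms(2)[symmetric] by (simp add: power2_norm_eq_inner inner_simps)
  finally show ?thesis .
qed

lemma exists_le_convex_combination:
  fixes a :: "'j \<Rightarrow> real"
  assumes "finite J" "\<And>j. j \<in> J \<Longrightarrow> 0 \<le> l j" "(\<Sum>j\<in>J. l j) = 1" "(\<Sum>j\<in>J. l j * a j) \<le> c"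
  shows "\<exists>j\<in>J. a j \<le> c"
proof (rule ccontr)
  assume "\<not> ?thesis"
  then have gt: "\<And>j. j \<in> J \<Longrightarrow> c < a j" by auto
  have "(\<Sum>j\<in>J. l j * c) < (\<Sum>j\<in>J. l j * a j)"
  proof (rule sum_strict_mono_ex1)
    have "\<exists>j\<in>J. l j \<noteq> 0" using assms(3) by (metis sum.neutral zero_neq_one)
    then show "\<exists>j\<in>J. l j * c < l j * a j" using assms(2) gt by (metis mult_strict_left_mono order_le_less)
    show "\<forall>j\<in>J. l j * c \<le> l j * a j"
      using assms(2) gt by (simp add: less_imp_le mult_left_mono)
  qed (fact assms)
  then show False using assms by (simp add: sum_distrib_right[symmetric])
qed

text \<open>
  Maurey's argument in greedy form.  Averaged over the next atom \<open>j\<close>, adding \<open>f - g j\<close> to the current sum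
  increases its squared \<open>L\<^sup>2\<close>-norm by at most \<open>b\<^sup>2\<close>; some atom is at least as good as the average.  The
  resulting sum grows like \<open>\<surd>m\<close> instead of \<open>m\<close>.
\<close>

lemma maurey_sampling:
  fixes g :: "'j \<Rightarrow> 'a \<Rightarrow> 'b::euclidean_space" and l :: "'j \<Rightarrow> real"
  assumes M: "finite_measure M" "measure M (space M) \<le> 1"
    and J: "finite J" "\<And>j. j \<in> J \<Longrightarrow> 0 \<le> l j" "(\<Sum>j\<in>J. l j) = 1"
    and meas: "\<And>j. j \<in> J \<Longrightarrow> g j \<in> borel_measurable M"
    and bd: "\<And>j x. j \<in> J \<Longrightarrow> x \<in> space M \<Longrightarrow> norm (g j x) \<le> b"
    and f: "\<And>x. x \<in> space M \<Longrightarrow> f x = (\<Sum>j\<in>J. l j *\<^sub>R g j x)"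
  shows "\<exists>\<sigma>. (\<forall>i<m. \<sigma> i \<in> J) \<and> (LINT x|M. (norm (\<Sum>i<m. f x - g (\<sigma> i) x))\<^sup>2) \<le> real m * b\<^sup>2"
proof (induction m)
  case 0
  then show ?case by simp
next
  case (Suc m)
  interpret finite_measure M by fact
  from Suc obtain \<sigma> where \<sigma>: "\<And>i. i < m \<Longrightarrow> \<sigma> i \<in> J"
      "(LINT x|M. (norm (\<Sum>i<m. f x - g (\<sigma> i) x))\<^sup>2) \<le> real m * b\<^sup>2" by blast
  define S where "S x = (\<Sum>i<m. f x - g (\<sigma> i) x)" for x
  note \<sigma> = \<sigma>[folded S_def]
  have fmeas: "f \<in> borel_measurable M"
    using meas by (subst measurable_cong[OF f]) (auto intro!: borel_measurable_sum)
  have fbd: "norm (f x) \<le> b" if "x \<in> space M" for x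
  proof -
    have "norm (f x) \<le> (\<Sum>j\<in>J. l j * b)"
      unfolding f[OF that] using J bd[OF _ that] by (intro sum_norm_le) (auto intro!: mult_left_mono)
    then show ?thesis using J(3) by (simp add: sum_distrib_right[symmetric])
  qed
  have Sbd: "norm (S x) \<le> real m * (2 * b)" if "x \<in> space M" for x
  proof -
    have "norm (S x) \<le> (\<Sum>i<m. 2 * b)"
      unfolding S_def using fbd[OF that] bd[OF \<sigma>(1) that]
      by (intro sum_norm_le order_trans[OF norm_triangle_ineq4]) (fastforce)
    then show ?thesis by simp
  qed
  have Smeas: "S \<in> borel_measurable M" unfolding S_def[abs_def] using fmeas meas \<sigma>(1) by (auto intro!: borel_measurable_sum borel_measurable_diff)
  have int: "integrable M (\<lambda>x. (norm (S x + (f x - g j x)))\<^sup>2)" if "j \<in> J" for j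
  proof (rule integrable_const_bound)
    show "AE x in M. norm ((norm (S x + (f x - g j x)))\<^sup>2) \<le> (real m * (2 * b) + (b + b))\<^sup>2"
    proof (rule AE_I2)
      fix x assume x: "x \<in> space M"
      have "norm (S x + (f x - g j x)) \<le> real m * (2 * b) + (b + b)"
        using Sbd[OF x] fbd[OF x] bd[OF that x]
        by (intro order_trans[OF norm_triangle_ineq] add_mono order_trans[OF norm_triangle_ineq4]) auto
      then show "norm ((norm (S x + (f x - g j x)))\<^sup>2) \<le> (real m * (2 * b) + (b + b))\<^sup>2"
        by (simp add: power_mono)
    qed
    show "(\<lambda>x. (norm (S x + (f x - g j x)))\<^sup>2) \<in> borel_measurable M"
      using Smeas fmeas meas[OF that] by measurable
  qed
  have intS: "integrable M (\<lambda>x. (norm (S x))\<^sup>2)"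
  proof (rule integrable_const_bound)
    show "AE x in M. norm ((norm (S x))\<^sup>2) \<le> (real m * (2 * b))\<^sup>2"
      using Sbd by (intro AE_I2) (simp add: power_mono)
    show "(\<lambda>x. (norm (S x))\<^sup>2) \<in> borel_measurable M"
      using Smeas by measurable
  qed
  have "(\<Sum>j\<in>J. l j * (LINT x|M. (norm (S x + (f x - g j x)))\<^sup>2)) =
     (LINT x|M. (\<Sum>j\<in>J. l j * (norm (S x + (f x - g j x)))\<^sup>2))"
    using int by (simp add: Bochner_Integration.integral_sum integrable_mult_right)
  also have "\<dots> \<le> (LINT x|M. (norm (S x))\<^sup>2 + b\<^sup>2)"
  proof (rule integral_mono)
    show "integrable M (\<lambda>x. \<Sum>j\<in>J. l j * (norm (S x + (f x - g j x)))\<^sup>2)"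
      using int by (intro Bochner_Integration.integrable_sum integrable_mult_right)
    show "integrable M (\<lambda>x. (norm (S x))\<^sup>2 + b\<^sup>2)" using intS by simp
    fix x assume x: "x \<in> space M"
    have "(\<Sum>j\<in>J. l j * (norm (S x + (f x - g j x)))\<^sup>2) =
        (norm (S x))\<^sup>2 - (norm (f x))\<^sup>2 + (\<Sum>j\<in>J. l j * (norm (g j x))\<^sup>2)"
      by (rule convex_combination_second_moment[OF J(3) f[OF x]])
    also have "(\<Sum>j\<in>J. l j * (norm (g j x))\<^sup>2) \<le> (\<Sum>j\<in>J. l j * b\<^sup>2)"
      using bd[OF _ x] J(2) by (intro sum_mono mult_left_mono power_mono) auto
    also have "\<dots> = b\<^sup>2" using J(3) by (simp add: sum_distrib_right[symmetric])
    finally show "(\<Sum>j\<in>J. l j * (norm (S x + (f x - g j x)))\<^sup>2) \<le> (norm (S x))\<^sup>2 + b\<^sup>2"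
      by (smt (verit) zero_le_power2)
  qed
  also have "\<dots> = (LINT x|M. (norm (S x))\<^sup>2) + measure M (space M) * b\<^sup>2"
    using intS by simp
  also have "\<dots> \<le> real m * b\<^sup>2 + 1 * b\<^sup>2"
    using \<sigma>(2) M(2) by (intro add_mono mult_right_mono) auto
  finally have "(\<Sum>j\<in>J. l j * (LINT x|M. (norm (S x + (f x - g j x)))\<^sup>2)) \<le> real (Suc m) * b\<^sup>2"
    by (simp add: algebra_simps)
  from exists_le_convex_combination[OF J this]
  obtain j where j: "j \<in> J" "(LINT x|M. (norm (S x + (f x - g j x)))\<^sup>2) \<le> real (Suc m) * b\<^sup>2" by blast
  define \<tau> where "\<tau> = \<sigma>(m := j)"
  have "(\<Sum>i<Suc m. f x - g (\<tau> i) x) = S x + (f x - g j x)" for x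
    by (simp add: \<tau>_def S_def)
  then show ?case using j \<sigma>(1) by (intro exI[of _ \<tau>]) (auto simp: \<tau>_def less_Suc_eq)
qed

lemma set_integral_unit_cube_eq:
  fixes f :: "real^'d \<Rightarrow> real"
  shows "(LINT x:unit_cube|lebesgue. f x) = (LINT x|lebesgue_on unit_cube. f x)"
  unfolding set_lebesgue_integral_def by (rule integral_restrict_space[symmetric]) simp

lemma lebesgue_on_unit_cube:
  "finite_measure (lebesgue_on (unit_cube :: (real^'d) set))"
  "measure (lebesgue_on (unit_cube :: (real^'d) set)) (space (lebesgue_on unit_cube)) = 1"
proof -
  have "emeasure (lebesgue_on (unit_cube :: (real^'d) set)) unit_cube = 1"
    using emeasure_unit_cube[where 'd = 'd] by (subst emeasure_restrict_space) auto
  then show "finite_measure (lebesgue_on (unit_cube :: (real^'d) set))"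
    "measure (lebesgue_on (unit_cube :: (real^'d) set)) (space (lebesgue_on unit_cube)) = 1"
    by (auto intro!: finite_measureI simp: measure_def)
qed

section \<open>Piecewise linear approximation in one variable\<close>

text \<open>
  The value \<open>1\<close> at \<open>0\<close> makes the step functions below right-continuous, so that the unit with threshold
  \<open>-1\<close> is active on all of \<open>[-1,1)\<close>.
\<close>

definition heaviside :: "real \<Rightarrow> real" where
  "heaviside z = (if z \<ge> 0 then 1 else 0)"

lemma relu_has_derivative: "z \<noteq> 0 \<Longrightarrow> (relu has_real_derivative heaviside z) (at z)"
proof -
  assume "z \<noteq> 0"
  then consider "z > 0" | "z < 0" by linarith
  then show ?thesis
  proof cases
    case 1
    have "((\<lambda>z. z) has_real_derivative heaviside z) (at z)"
      using 1 by (auto simp: heaviside_def)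
    then show ?thesis
      by (rule has_field_derivative_transform_within_open[where S = "{0<..}"]) (use 1 in \<open>auto simp: relu_def\<close>)
  next
    case 2
    have "((\<lambda>z. 0) has_real_derivative heaviside z) (at z)"
      using 2 by (auto simp: heaviside_def)
    then show ?thesis
      by (rule has_field_derivative_transform_within_open[where S = "{..<0}"]) (use 2 in \<open>auto simp: relu_def\<close>)
  qed
qed

lemma continuous_on_relu: "continuous_on A relu"
  unfolding relu_def[abs_def] by (intro continuous_intros)

lemma heaviside_sum_telescopes:
  fixes g :: "nat \<Rightarrow> real"
  assumes "J < N" "\<And>j. j < N \<Longrightarrow> heaviside (z - t j) = (if j \<le> J then 1 else 0)"
  shows "(\<Sum>j<N. (if j = 0 then g 0 else g j - g (j - 1)) * heaviside (z - t j)) = g J"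
proof -
  let ?c = "\<lambda>j. if j = 0 then g 0 else g j - g (j - 1)"
  have "(\<Sum>j<N. ?c j * heaviside (z - t j)) = (\<Sum>j\<in>{..<N}. if j \<le> J then ?c j else 0)"
    using assms(2) by (intro sum.cong) auto
  also have "\<dots> = (\<Sum>j\<in>{..<N} \<inter> {j. j \<le> J}. ?c j)"
    by (subst sum.inter_restrict) auto
  also have "{..<N} \<inter> {j. j \<le> J} = {..J}" using assms(1) by auto
  also have "(\<Sum>j\<le>J. ?c j) = g J" by (induction J) auto
  finally show ?thesis .
qed

text \<open>
  The weights \<open>c j\<close> are the increments of \<open>F'\<close> along the grid \<open>t j\<close>.  By telescoping, the derivative of
  the network at \<open>z\<close> is the value of \<open>F'\<close> at the last grid point at or before \<open>z\<close>, at distance at most \<open>1/n\<close>;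
  integrating from \<open>-1\<close> gives the bound on the values, and the sum of the increments is
  controlled by the Lipschitz constant whatever \<open>n\<close> is.
\<close>

lemma relu_approximation_of_C1_function:
  fixes F F' :: "real \<Rightarrow> real"
  assumes deriv: "\<And>z. (F has_real_derivative F' z) (at z)"
    and lip: "\<And>y z. \<bar>F' y - F' z\<bar> \<le> L * \<bar>y - z\<bar>" and n: "n > 0"
  defines "t \<equiv> \<lambda>j. real j / real n - 1"
  defines "c \<equiv> \<lambda>j. if j = 0 then F' (t 0) else F' (t j) - F' (t (j - 1))"
  shows "\<And>z. -1 \<le> z \<Longrightarrow> z < 1 \<Longrightarrow> \<bar>F' z - (\<Sum>j<2*n. c j * heaviside (z - t j))\<bar> \<le> L / n"
    and "\<And>z. -1 \<le> z \<Longrightarrow> z < 1 \<Longrightarrow> \<bar>F z - (F (-1) + (\<Sum>j<2*n. c j * relu (z - t j)))\<bar> \<le> 2 * L / n"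
    and "(\<Sum>j<2*n. \<bar>c j\<bar>) \<le> \<bar>F' (-1)\<bar> + 2 * L"
proof -
  have L: "0 \<le> L" using order_trans[OF abs_ge_zero lip[of 1 0]] by simp
  show D: "\<bar>F' z - (\<Sum>j<2*n. c j * heaviside (z - t j))\<bar> \<le> L / n" if z: "-1 \<le> z" "z < 1" for z
  proof -
    \<comment> \<open>The index of the last grid point that is at most \<open>z\<close>.\<close>
    define J where "J = nat \<lfloor>(z + 1) * n\<rfloor>"
    have nn: "0 \<le> (z + 1) * n" using z n by simp
    have J: "real J \<le> (z + 1) * n" "(z + 1) * n < real J + 1"
      using nn by (simp_all add: J_def)
    have "(z + 1) * n < 2 * n" using z n by simp
    with J have "real J < real (2 * n)" by linarith
    then have "J < 2 * n" by linarith
    moreover have "heaviside (z - t j) = (if j \<le> J then 1 else 0)" for j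
    proof -
      have "z - t j \<ge> 0 \<longleftrightarrow> real j \<le> (z + 1) * n" using n by (simp add: t_def field_simps)
      also have "\<dots> \<longleftrightarrow> j \<le> J" using J by linarith
      finally show ?thesis by (simp add: heaviside_def)
    qed
    ultimately have "(\<Sum>j<2*n. c j * heaviside (z - t j)) = F' (t J)"
      using heaviside_sum_telescopes[of J "2 * n" z t "\<lambda>j. F' (t j)"] unfolding c_def by simp
    moreover have "z - t J = ((z + 1) * n - J) / n"
      using n by (simp add: t_def field_simps)
    then have "\<bar>z - t J\<bar> \<le> 1 / n"
      using J by (simp add: divide_right_mono)
    then have "L * \<bar>z - t J\<bar> \<le> L * (1 / n)" using L by (rule mult_left_mono)
    ultimately show ?thesis using lip[of z "t J"] by simp
  qed
  show "\<bar>F z - (F (-1) + (\<Sum>j<2*n. c j * relu (z - t j)))\<bar> \<le> 2 * L / n" if z: "-1 \<le> z" "z < 1" for z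
  proof -
    define q where "q y = F y - (\<Sum>j<2*n. c j * relu (y - t j))" for y
    define q' where "q' y = F' y - (\<Sum>j<2*n. c j * heaviside (y - t j))" for y
    have "(q' has_integral q z - q (-1)) {-1..z}"
    proof (rule fundamental_theorem_of_calculus_interior_strong)
      show "finite (t ` {..<2*n})" by simp
      show "continuous_on {-1..z} q"
        unfolding q_def[abs_def] using DERIV_isCont[OF deriv]
        by (intro continuous_intros continuous_on_compose2[OF continuous_on_relu[of UNIV]] continuous_at_imp_continuous_on) auto
      fix y assume y: "y \<in> {-1<..<z} - t ` {..<2*n}"
      have "(q has_real_derivative q' y) (at y)"
        unfolding q_def[abs_def] q'_def
      proof (intro DERIV_diff deriv DERIV_sum DERIV_cmult)
        fix j assume "j \<in> {..<2*n}"
        then have "y - t j \<noteq> 0" using y by auto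
        have "((\<lambda>y. relu (y - t j)) has_real_derivative heaviside (y - t j) * 1) (at y)"
          by (rule DERIV_chain2[where f = relu and g = "\<lambda>y. y - t j"])
             (use relu_has_derivative[OF \<open>y - t j \<noteq> 0\<close>] in \<open>auto intro!: derivative_eq_intros\<close>)
        then show "((\<lambda>y. relu (y - t j)) has_real_derivative heaviside (y - t j)) (at y)" by simp
      qed
      then show "(q has_vector_derivative q' y) (at y)"
        by (simp add: has_real_derivative_iff_has_vector_derivative)
    qed (use z in auto)
    then have "(q' has_integral q z - q (-1)) (cbox (-1) z)" by simp
    moreover have "norm (q' y) \<le> L / n" if "y \<in> cbox (-1) z" for y
      using D[of y] that z by (simp add: q'_def)
    moreover have "0 \<le> L / n" using L by simp
    ultimately have "norm (q z - q (-1)) \<le> L / n * measure lborel (cbox (-1) z)"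
      by (intro has_integral_bound) auto
    also have "\<dots> \<le> L / n * 2" using z L by (intro mult_left_mono) auto
    also have "q (-1) = F (-1)"
      by (simp add: q_def relu_def t_def max_def)
    finally show ?thesis by (simp add: q_def algebra_simps)
  qed
  have step: "\<bar>c j\<bar> \<le> L / n" if "j \<noteq> 0" for j
  proof -
    have "\<bar>t j - t (j - 1)\<bar> = 1 / n" using that n by (simp add: t_def of_nat_diff field_simps)
    then show ?thesis using lip[of "t j" "t (j - 1)"] that by (simp add: c_def)
  qed
  have "(\<Sum>j<2*n. \<bar>c j\<bar>) \<le> (\<Sum>j<2*n. (if j = 0 then \<bar>F' (-1)\<bar> else 0) + L / n)"
    using step L n by (intro sum_mono) (auto simp: c_def t_def)
  also have "\<dots> = \<bar>F' (-1)\<bar> + 2 * L"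
    using n by (simp add: sum.distrib)
  finally show "(\<Sum>j<2*n. \<bar>c j\<bar>) \<le> \<bar>F' (-1)\<bar> + 2 * L" .
qed

lemma relu_borel[measurable]: "relu \<in> borel_measurable borel"
  by (rule borel_measurable_continuous_onI[OF continuous_on_relu])

lemma heaviside_borel[measurable]: "heaviside \<in> borel_measurable borel"
  unfolding heaviside_def[abs_def] by measurable

section \<open>Approximation of ridge functions by networks\<close>

lemma l1_norm_pos: "w \<noteq> 0 \<Longrightarrow> 0 < l1_norm w"
  unfolding l1_norm_def vec_eq_iff by (auto intro!: sum_pos2)

lemma l1_norm_nonneg: "0 \<le> l1_norm w"
  unfolding l1_norm_def by (simp add: sum_nonneg)

lemma norm_le_l1_norm: "norm w \<le> l1_norm w"
  unfolding l1_norm_def by (rule norm_le_l1_cart)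

lemma l1_norm_scaleR: "l1_norm (r *\<^sub>R w) = \<bar>r\<bar> * l1_norm w"
  by (simp add: l1_norm_def abs_mult sum_distrib_left)

lemma l1_norm_add: "l1_norm (v + w) \<le> l1_norm v + l1_norm w"
  unfolding l1_norm_def sum.distrib[symmetric] by (intro sum_mono) auto

lemma l1_norm_axis: "l1_norm (axis i r) = \<bar>r\<bar>"
proof -
  have "l1_norm (axis i r) = (\<Sum>j\<in>UNIV. if j = i then \<bar>r\<bar> else 0)"
    unfolding l1_norm_def by (intro sum.cong) (auto simp: axis_def)
  then show ?thesis by simp
qed

text \<open>
  The upper bound is strict because the cube is open; this keeps the ridge variable in the half-open
  interval on which the one-dimensional approximation holds.
\<close>

lemma inner_unit_cube_bounds:
  assumes "l1_norm w = 1" "x \<in> unit_cube"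
  shows "-1 \<le> w \<bullet> x" "w \<bullet> x < 1"
proof -
  have x: "0 < x $ i" "x $ i < 1" for i using assms(2) by (auto simp: unit_cube_def)
  have le: "\<bar>w $ i * x $ i\<bar> \<le> \<bar>w $ i\<bar>" for i
    using x[of i] by (simp add: abs_mult mult_left_le)
  obtain i where i: "w $ i \<noteq> 0"
    using assms(1) by (metis l1_norm_def abs_zero sum.neutral zero_neq_one)
  have "\<bar>w \<bullet> x\<bar> \<le> (\<Sum>i\<in>UNIV. \<bar>w $ i * x $ i\<bar>)"
    unfolding inner_vec_def inner_real_def by (rule sum_abs)
  also have "\<dots> < (\<Sum>i\<in>UNIV. \<bar>w $ i\<bar>)"
  proof (rule sum_strict_mono_ex1)
    show "\<exists>i\<in>UNIV. \<bar>w $ i * x $ i\<bar> < \<bar>w $ i\<bar>"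
      using i x[of i] by (intro bexI[of _ i]) (auto simp: abs_mult)
  qed (use le in auto)
  finally show "-1 \<le> w \<bullet> x" "w \<bullet> x < 1" using assms(1) by (auto simp: l1_norm_def)
qed

text \<open>
  The non-constant part of a network of arbitrary width, given by the list of its outer weights,
  directions and thresholds.  With lists, the sum of two networks is concatenation.
\<close>

definition net :: "(real \<times> (real^'d) \<times> real) list \<Rightarrow> real^'d \<Rightarrow> real" where
  "net N x = (\<Sum>(\<gamma>, w, t)\<leftarrow>N. \<gamma> * relu (w \<bullet> x - t))"

definition net_grad :: "(real \<times> (real^'d) \<times> real) list \<Rightarrow> real^'d \<Rightarrow> real^'d" where
  "net_grad N x = (\<Sum>(\<gamma>, w, t)\<leftarrow>N. (\<gamma> * heaviside (w \<bullet> x - t)) *\<^sub>R w)"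

definition mass :: "(real \<times> (real^'d) \<times> real) list \<Rightarrow> real" where
  "mass N = (\<Sum>(\<gamma>, w, t)\<leftarrow>N. \<bar>\<gamma>\<bar>)"

definition admissible :: "(real \<times> (real^'d) \<times> real) list \<Rightarrow> bool" where
  "admissible N \<longleftrightarrow> (\<forall>(\<gamma>, w, t)\<in>set N. l1_norm w = 1 \<and> \<bar>t\<bar> \<le> 1)"

text \<open>
  The network has kinks, so its gradient is replaced by \<open>net_grad\<close>, which is defined everywhere and agrees
  with it off the kinks.
\<close>

definition C1_close :: "real \<Rightarrow> real \<Rightarrow> (real \<times> (real^'d) \<times> real) list \<Rightarrow> (real^'d \<Rightarrow> real) \<Rightarrow> bool" where
  "C1_close \<epsilon> c N h \<longleftrightarrow> (\<forall>x\<in>unit_cube. \<bar>h x - (c + net N x)\<bar> \<le> \<epsilon> \<and>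
     (\<exists>g. (h has_derivative (\<lambda>v. g \<bullet> v)) (at x) \<and> norm (g - net_grad N x) \<le> \<epsilon>))"

text \<open>
  The bounds \<open>M\<close> and \<open>C\<close> do not depend on the accuracy; they measure membership of \<open>h\<close> in a
  \<open>C\<^sup>1\<close>-closed convex hull of rectified linear units.
\<close>

definition approximable :: "real \<Rightarrow> real \<Rightarrow> (real^'d \<Rightarrow> real) \<Rightarrow> bool" where
  "approximable M C h \<longleftrightarrow>
     (\<forall>\<epsilon>>0. \<exists>c N. \<bar>c\<bar> \<le> C \<and> admissible N \<and> mass N \<le> M \<and> C1_close \<epsilon> c N h)"

lemma approximableE:
  assumes "approximable M C h" "\<epsilon> > 0"
  obtains c N where "\<bar>c\<bar> \<le> C" "admissible N" "mass N \<le> M" "C1_close \<epsilon> c N h"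
  using assms unfolding approximable_def by blast

lemma approximable_mono: "approximable M C h \<Longrightarrow> M \<le> M' \<Longrightarrow> C \<le> C' \<Longrightarrow> approximable M' C' h"
  unfolding approximable_def by (meson order_trans)

lemma approximable_const: "approximable 0 \<bar>c\<bar> (\<lambda>x. c)"
  unfolding approximable_def C1_close_def
  by (intro allI impI exI[of _ c] exI[of _ "[]"] conjI ballI exI[of _ 0])
     (auto simp: admissible_def mass_def net_def net_grad_def intro!: has_derivative_eq_rhs[OF has_derivative_const])

lemma C1_close_add:
  fixes h h' :: "real^'d \<Rightarrow> real"
  assumes "C1_close \<epsilon> c N h" "C1_close \<epsilon>' c' N' h'"
  shows "C1_close (\<epsilon> + \<epsilon>') (c + c') (N @ N') (\<lambda>x. h x + h' x)"
  unfolding C1_close_def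
proof
  fix x :: "real^'d" assume x: "x \<in> unit_cube"
  obtain g g' where h: "\<bar>h x - (c + net N x)\<bar> \<le> \<epsilon>" "\<bar>h' x - (c' + net N' x)\<bar> \<le> \<epsilon>'"
    and g: "(h has_derivative (\<lambda>v. g \<bullet> v)) (at x)" "norm (g - net_grad N x) \<le> \<epsilon>"
      "(h' has_derivative (\<lambda>v. g' \<bullet> v)) (at x)" "norm (g' - net_grad N' x) \<le> \<epsilon>'"
    using assms x unfolding C1_close_def by blast
  have "net (N @ N') x = net N x + net N' x" by (simp add: net_def)
  then have "\<bar>h x + h' x - (c + c' + net (N @ N') x)\<bar> \<le> \<epsilon> + \<epsilon>'" using h by linarith
  moreover have "((\<lambda>x. h x + h' x) has_derivative (\<lambda>v. (g + g') \<bullet> v)) (at x)"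
    using has_derivative_add[OF g(1,3)] by (simp add: inner_add_left)
  moreover have "norm ((g + g') - net_grad (N @ N') x) \<le> \<epsilon> + \<epsilon>'"
    using norm_triangle_mono[OF g(2,4)] by (simp add: net_grad_def algebra_simps)
  ultimately show "\<bar>h x + h' x - (c + c' + net (N @ N') x)\<bar> \<le> \<epsilon> + \<epsilon>' \<and>
      (\<exists>g. ((\<lambda>x. h x + h' x) has_derivative (\<lambda>v. g \<bullet> v)) (at x) \<and> norm (g - net_grad (N @ N') x) \<le> \<epsilon> + \<epsilon>')"
    by blast
qed

lemma approximable_add:
  assumes "approximable M C h" "approximable M' C' h'"
  shows "approximable (M + M') (C + C') (\<lambda>x. h x + h' x)"
  unfolding approximable_def
proof (intro allI impI)
  fix \<epsilon> :: real assume "\<epsilon> > 0"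
  then have e2: "\<epsilon> / 2 > 0" by simp
  obtain c N where 1: "\<bar>c\<bar> \<le> C" "admissible N" "mass N \<le> M" "C1_close (\<epsilon> / 2) c N h"
    by (rule approximableE[OF assms(1) e2])
  obtain c' N' where 2: "\<bar>c'\<bar> \<le> C'" "admissible N'" "mass N' \<le> M'" "C1_close (\<epsilon> / 2) c' N' h'"
    by (rule approximableE[OF assms(2) e2])
  have "C1_close \<epsilon> (c + c') (N @ N') (\<lambda>x. h x + h' x)"
    using C1_close_add[OF 1(4) 2(4)] by simp
  moreover have "\<bar>c + c'\<bar> \<le> C + C'" "admissible (N @ N')" "mass (N @ N') \<le> M + M'"
    using 1 2 by (auto simp: admissible_def mass_def)
  ultimately show "\<exists>c N. \<bar>c\<bar> \<le> C + C' \<and> admissible N \<and> mass N \<le> M + M' \<and> C1_close \<epsilon> c N (\<lambda>x. h x + h' x)"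
    by blast
qed

lemma C1_close_cmult:
  fixes h :: "real^'d \<Rightarrow> real" and r :: real
  assumes "C1_close \<delta> c N h"
  shows "C1_close (\<bar>r\<bar> * \<delta>) (r * c) (map (\<lambda>(\<gamma>, w, t). (r * \<gamma>, w, t)) N) (\<lambda>x. r * h x)"
  unfolding C1_close_def
proof
  fix x :: "real^'d" assume x: "x \<in> unit_cube"
  let ?N = "map (\<lambda>(\<gamma>, w, t). (r * \<gamma>, w, t)) N"
  obtain g where h: "\<bar>h x - (c + net N x)\<bar> \<le> \<delta>"
    and g: "(h has_derivative (\<lambda>v. g \<bullet> v)) (at x)" "norm (g - net_grad N x) \<le> \<delta>"
    using assms x unfolding C1_close_def by blast
  have net: "net ?N x = r * net N x"
    by (auto simp: net_def sum_list_const_mult[symmetric] o_def case_prod_unfold mult.assoc)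
  have net_grad: "net_grad ?N x = r *\<^sub>R net_grad N x"
    by (induction N) (auto simp: net_grad_def scaleR_add_right)
  have "r * h x - (r * c + net ?N x) = r * (h x - (c + net N x))"
    unfolding net by (simp add: algebra_simps)
  then have "\<bar>r * h x - (r * c + net ?N x)\<bar> \<le> \<bar>r\<bar> * \<delta>"
    using mult_left_mono[OF h, of "\<bar>r\<bar>"] by (simp only: abs_mult abs_ge_zero)
  moreover have "((\<lambda>x. r * h x) has_derivative (\<lambda>v. (r *\<^sub>R g) \<bullet> v)) (at x)"
    using has_derivative_mult_right[OF g(1), of r] by simp
  moreover have "norm (r *\<^sub>R g - net_grad ?N x) \<le> \<bar>r\<bar> * \<delta>"
    unfolding net_grad scaleR_diff_right[symmetric] using mult_left_mono[OF g(2), of "\<bar>r\<bar>"] by simp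
  ultimately show "\<bar>r * h x - (r * c + net ?N x)\<bar> \<le> \<bar>r\<bar> * \<delta> \<and>
      (\<exists>g. ((\<lambda>x. r * h x) has_derivative (\<lambda>v. g \<bullet> v)) (at x) \<and> norm (g - net_grad ?N x) \<le> \<bar>r\<bar> * \<delta>)"
    by blast
qed

lemma C1_close_mono: "C1_close \<epsilon> c N h \<Longrightarrow> \<epsilon> \<le> \<epsilon>' \<Longrightarrow> C1_close \<epsilon>' c N h"
  unfolding C1_close_def by (meson order_trans)

lemma approximable_cmult:
  assumes "approximable M C h"
  shows "approximable (\<bar>r\<bar> * M) (\<bar>r\<bar> * C) (\<lambda>x. r * h x)"
  unfolding approximable_def
proof (intro allI impI)
  fix \<epsilon> :: real assume \<epsilon>: "\<epsilon> > 0"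
  define \<delta> where "\<delta> = \<epsilon> / (\<bar>r\<bar> + 1)"
  have \<delta>: "\<delta> > 0" "\<bar>r\<bar> * \<delta> \<le> \<epsilon>" using \<epsilon> by (auto simp: \<delta>_def field_simps)
  obtain c N where 1: "\<bar>c\<bar> \<le> C" "admissible N" "mass N \<le> M" "C1_close \<delta> c N h"
    by (rule approximableE[OF assms \<delta>(1)])
  let ?N = "map (\<lambda>(\<gamma>, w, t). (r * \<gamma>, w, t)) N"
  have mass: "mass ?N = \<bar>r\<bar> * mass N"
    by (auto simp: mass_def sum_list_const_mult[symmetric] o_def case_prod_unfold abs_mult)
  have "\<bar>r * c\<bar> \<le> \<bar>r\<bar> * C" "mass ?N \<le> \<bar>r\<bar> * M"
    unfolding mass using 1(1,3) by (simp_all add: abs_mult mult_left_mono)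
  moreover have "admissible ?N" using 1(2) by (auto simp: admissible_def)
  ultimately show "\<exists>c N. \<bar>c\<bar> \<le> \<bar>r\<bar> * C \<and> admissible N \<and> mass N \<le> \<bar>r\<bar> * M \<and> C1_close \<epsilon> c N (\<lambda>x. r * h x)"
    using C1_close_mono[OF C1_close_cmult[OF 1(4)] \<delta>(2)] by blast
qed

lemma approximable_sum:
  assumes "finite I" "\<And>i. i \<in> I \<Longrightarrow> approximable (M i) (C i) (h i)"
  shows "approximable (\<Sum>i\<in>I. M i) (\<Sum>i\<in>I. C i) (\<lambda>x. \<Sum>i\<in>I. h i x)"
  using assms
proof (induction I)
  case empty
  then show ?case using approximable_const[of 0] by simp
qed (auto intro: approximable_add)

lemma net_borel[measurable]: "net N \<in> borel_measurable borel"
proof (induction N)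
  case (Cons p N)
  have "net (p # N) = (\<lambda>x. fst p * relu (fst (snd p) \<bullet> x - snd (snd p)) + net N x)"
    by (auto simp: net_def fun_eq_iff case_prod_unfold)
  then show ?case using Cons by simp
qed (simp add: net_def[abs_def])

lemma net_grad_borel[measurable]: "net_grad N \<in> borel_measurable borel"
proof (induction N)
  case (Cons p N)
  have "net_grad (p # N) = (\<lambda>x. (fst p * heaviside (fst (snd p) \<bullet> x - snd (snd p))) *\<^sub>R fst (snd p) + net_grad N x)"
    by (auto simp: net_grad_def fun_eq_iff case_prod_unfold)
  then show ?case using Cons by simp
qed (simp add: net_grad_def[abs_def])

lemma abs_sin_diff_le: "\<bar>sin x - sin y\<bar> \<le> \<bar>x - y\<bar>" for x y :: real
proof -
  have "\<bar>sin x - sin y\<bar> = 2 * \<bar>sin ((x - y) / 2)\<bar> * \<bar>cos ((x + y) / 2)\<bar>"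
    by (simp add: sin_diff_sin abs_mult)
  also have "\<dots> \<le> 2 * \<bar>(x - y) / 2\<bar> * 1"
    by (intro mult_mono abs_sin_x_le_abs_x) auto
  finally show ?thesis by simp
qed

text \<open>
  With \<open>a\<close> the \<open>l1\<close>-norm of \<open>w\<close> the function is \<open>F(z) = cos(az + b)\<close> at \<open>z = w\<bullet>x/a\<close>, and \<open>F'\<close> is bounded by
  \<open>a\<close> and Lipschitz with constant \<open>a\<^sup>2\<close>.
\<close>

lemma approximable_cos_ridge:
  fixes w :: "real^'d"
  assumes "w \<noteq> 0"
  shows "approximable (l1_norm w + 2 * (l1_norm w)\<^sup>2) 1 (\<lambda>x. cos (w \<bullet> x + b))"
  unfolding approximable_def
proof (intro allI impI)
  fix \<epsilon> :: real assume \<epsilon>: "\<epsilon> > 0"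
  define a where "a = l1_norm w"
  have a: "a > 0" using l1_norm_pos[OF assms] by (simp add: a_def)
  define \<omega> where "\<omega> = (1 / a) *\<^sub>R w"
  have \<omega>: "l1_norm \<omega> = 1" "w = a *\<^sub>R \<omega>" using a by (simp_all add: \<omega>_def l1_norm_scaleR a_def)
  have "norm \<omega> \<le> 1" using norm_le_l1_norm[of \<omega>] \<omega> by simp
  define F where "F z = cos (a * z + b)" for z
  define F' where "F' z = - a * sin (a * z + b)" for z
  have deriv: "(F has_real_derivative F' z) (at z)" for z
    unfolding F_def[abs_def] F'_def by (auto intro!: derivative_eq_intros)
  have lip: "\<bar>F' y - F' z\<bar> \<le> a\<^sup>2 * \<bar>y - z\<bar>" for y z
  proof -
    have "F' y - F' z = a * (sin (a * z + b) - sin (a * y + b))"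
      by (simp add: F'_def right_diff_distrib)
    then have "\<bar>F' y - F' z\<bar> = a * \<bar>sin (a * z + b) - sin (a * y + b)\<bar>"
      using a by (simp add: abs_mult)
    also have "\<dots> \<le> a * \<bar>(a * z + b) - (a * y + b)\<bar>"
      using a by (intro mult_left_mono abs_sin_diff_le) auto
    also have "\<dots> = a\<^sup>2 * \<bar>y - z\<bar>"
      using a by (simp add: right_diff_distrib[symmetric] abs_mult power2_eq_square abs_minus_commute)
    finally show ?thesis .
  qed
  define n where "n = Suc (nat \<lceil>2 * a\<^sup>2 / \<epsilon>\<rceil>)"
  have n: "n > 0" "2 * a\<^sup>2 / \<epsilon> \<le> n" unfolding n_def by (simp, linarith)
  define t where "t j = real j / real n - 1" for j
  define c where "c j = (if j = 0 then F' (t 0) else F' (t j) - F' (t (j - 1)))" for j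
  note approx = relu_approximation_of_C1_function[OF deriv lip n(1), folded t_def, folded c_def]
  have en: "2 * a\<^sup>2 / n \<le> \<epsilon>" using n \<epsilon> by (simp add: field_simps)
  define N where "N = map (\<lambda>j. (c j, \<omega>, t j)) [0..<2 * n]"
  have net: "net N x = (\<Sum>j<2*n. c j * relu (\<omega> \<bullet> x - t j))" for x
    by (simp add: net_def N_def o_def interv_sum_list_conv_sum_set_nat atLeast0LessThan)
  have net_grad: "net_grad N x = (\<Sum>j<2*n. c j * heaviside (\<omega> \<bullet> x - t j)) *\<^sub>R \<omega>" for x
    by (simp add: net_grad_def N_def o_def interv_sum_list_conv_sum_set_nat atLeast0LessThan scaleR_left.sum)
  have mass: "mass N \<le> a + 2 * a\<^sup>2"
  proof -
    have "mass N = (\<Sum>j<2*n. \<bar>c j\<bar>)"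
      by (simp add: mass_def N_def o_def interv_sum_list_conv_sum_set_nat atLeast0LessThan)
    also have "\<dots> \<le> \<bar>F' (-1)\<bar> + 2 * a\<^sup>2" by (rule approx(3))
    also have "\<bar>F' (-1)\<bar> \<le> a" using a by (simp add: F'_def abs_mult mult_left_le)
    finally show ?thesis by simp
  qed
  have adm: "admissible N"
    using \<omega>(1) n(1) by (auto simp: admissible_def N_def t_def abs_le_iff field_simps)
  have "\<bar>cos (w \<bullet> x + b) - (F (-1) + net N x)\<bar> \<le> \<epsilon>" if x: "x \<in> unit_cube" for x
    using approx(2)[OF inner_unit_cube_bounds[OF \<omega>(1) x]] en by (simp add: net F_def \<omega>(2))
  moreover have "\<exists>g. ((\<lambda>x. cos (w \<bullet> x + b)) has_derivative (\<lambda>v. g \<bullet> v)) (at x) \<and> norm (g - net_grad N x) \<le> \<epsilon>"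
    if x: "x \<in> unit_cube" for x
  proof (intro exI conjI)
    show "((\<lambda>x. cos (w \<bullet> x + b)) has_derivative (\<lambda>v. (F' (\<omega> \<bullet> x) *\<^sub>R \<omega>) \<bullet> v)) (at x)"
      by (auto intro!: derivative_eq_intros simp: F'_def \<omega>(2) fun_eq_iff)
    have "norm (F' (\<omega> \<bullet> x) *\<^sub>R \<omega> - net_grad N x) =
        \<bar>F' (\<omega> \<bullet> x) - (\<Sum>j<2*n. c j * heaviside (\<omega> \<bullet> x - t j))\<bar> * norm \<omega>"
      unfolding net_grad scaleR_left_diff_distrib[symmetric] by simp
    also have "\<dots> \<le> a\<^sup>2 / n * 1"
      using approx(1)[OF inner_unit_cube_bounds[OF \<omega>(1) x]] \<open>norm \<omega> \<le> 1\<close> by (intro mult_mono) auto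
    also have "\<dots> \<le> 2 * a\<^sup>2 / n" by (simp add: divide_right_mono)
    finally show "norm (F' (\<omega> \<bullet> x) *\<^sub>R \<omega> - net_grad N x) \<le> \<epsilon>" using en by simp
  qed
  ultimately have "C1_close \<epsilon> (F (-1)) N (\<lambda>x. cos (w \<bullet> x + b))" unfolding C1_close_def by blast
  moreover have "\<bar>F (-1)\<bar> \<le> 1" by (simp add: F_def)
  ultimately show "\<exists>c N. \<bar>c\<bar> \<le> 1 \<and> admissible N \<and> mass N \<le> l1_norm w + 2 * (l1_norm w)\<^sup>2 \<and>
      C1_close \<epsilon> c N (\<lambda>x. cos (w \<bullet> x + b))"
    using adm mass unfolding a_def by blast
qed

text \<open>
  A product of a cosine with a sine is the mean of two shifted cosines whose frequencies are
  \<open>w \<plusminus> \<kappa>\<^sub>ie\<^sub>i\<close>.  Absorbing the sines one by one therefore keeps both bounds, as long as \<open>A\<close> dominates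
  the total frequency.
\<close>

lemma approximable_cos_times_sines:
  fixes w :: "real^'d" and \<kappa> :: "'d \<Rightarrow> real"
  assumes "finite S" "l1_norm w + (\<Sum>j\<in>S. \<bar>\<kappa> j\<bar>) \<le> A"
  shows "approximable (A + 2 * A\<^sup>2) 1 (\<lambda>x. cos (w \<bullet> x + b) * (\<Prod>j\<in>S. sin (\<kappa> j * x $ j)))"
  using assms
proof (induction S arbitrary: w b)
  case empty
  then have A: "l1_norm w \<le> A" "0 \<le> A" using l1_norm_nonneg[of w] by auto
  show ?case
  proof (cases "w = 0")
    case True
    then show ?thesis
      using approximable_mono[OF approximable_const[of "cos b"], of "A + 2 * A\<^sup>2" 1] A(2) by simp
  next
    case False
    have "l1_norm w + 2 * (l1_norm w)\<^sup>2 \<le> A + 2 * A\<^sup>2"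
      using A l1_norm_nonneg[of w] by (intro add_mono mult_left_mono power_mono) auto
    then show ?thesis using approximable_mono[OF approximable_cos_ridge[OF False]] by simp
  qed
next
  case (insert i S)
  have l1: "l1_norm (w + axis i (r * \<kappa> i)) + (\<Sum>j\<in>S. \<bar>\<kappa> j\<bar>) \<le> A" if "\<bar>r\<bar> = 1" for r
    using l1_norm_add[of w "axis i (r * \<kappa> i)"] insert.prems insert.hyps that
    by (simp add: l1_norm_axis abs_mult)
  define P where "P x = (\<Prod>j\<in>S. sin (\<kappa> j * x $ j))" for x :: "real^'d"
  have "approximable (\<bar>1/2\<bar> * (A + 2 * A\<^sup>2) + \<bar>1/2\<bar> * (A + 2 * A\<^sup>2)) (\<bar>1/2\<bar> * 1 + \<bar>1/2\<bar> * 1)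
     (\<lambda>x. 1/2 * (cos ((w + axis i (1 * \<kappa> i)) \<bullet> x + (b - pi/2)) * P x) +
          1/2 * (cos ((w + axis i (-1 * \<kappa> i)) \<bullet> x + (b + pi/2)) * P x))"
    unfolding P_def by (intro approximable_add approximable_cmult insert.IH l1) auto
  moreover have "1/2 * (cos ((w + axis i (1 * \<kappa> i)) \<bullet> x + (b - pi/2)) * P x) +
          1/2 * (cos ((w + axis i (-1 * \<kappa> i)) \<bullet> x + (b + pi/2)) * P x) =
      cos (w \<bullet> x + b) * (\<Prod>j\<in>insert i S. sin (\<kappa> j * x $ j))" for x
  proof -
    define X where "X = w \<bullet> x + b"
    define Y where "Y = \<kappa> i * x $ i"
    have "(w + axis i (1 * \<kappa> i)) \<bullet> x + (b - pi/2) = - (pi/2 - (X + Y))"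
      by (simp add: inner_add_left inner_axis' X_def Y_def)
    then have 1: "cos ((w + axis i (1 * \<kappa> i)) \<bullet> x + (b - pi/2)) = sin (X + Y)"
      by (simp only: cos_minus sin_cos_eq of_real_eq_id id_apply)
    have "(w + axis i (-1 * \<kappa> i)) \<bullet> x + (b + pi/2) = X - Y + pi/2"
      by (simp add: inner_add_left inner_axis' X_def Y_def)
    then have 2: "cos ((w + axis i (-1 * \<kappa> i)) \<bullet> x + (b + pi/2)) = - sin (X - Y)"
      by (simp only: minus_sin_cos_eq of_real_eq_id id_apply)
    have "cos X * sin Y = 1/2 * (sin (X + Y) - sin (X - Y))"
      by (simp add: cos_times_sin)
    then have "cos X * (sin Y * P x) = 1/2 * (sin (X + Y) * P x) + 1/2 * (- sin (X - Y) * P x)"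
      by (simp add: mult.assoc[symmetric] left_diff_distrib diff_divide_distrib)
    then show ?thesis
      using insert.hyps unfolding 1 2 by (simp add: P_def X_def Y_def)
  qed
  ultimately have "approximable (\<bar>1/2\<bar> * (A + 2 * A\<^sup>2) + \<bar>1/2\<bar> * (A + 2 * A\<^sup>2)) (\<bar>1/2\<bar> * 1 + \<bar>1/2\<bar> * 1)
     (\<lambda>x. cos (w \<bullet> x + b) * (\<Prod>j\<in>insert i S. sin (\<kappa> j * x $ j)))"
    by (simp only:)
  then show ?case by (rule approximable_mono) auto
qed

section \<open>Sine products divided by the cut-off function\<close>

text \<open>
  Each summand times \<open>sin \<theta>\<close> is half a difference of two sines, and the sum telescopes.
\<close>

lemma sin_multiple_eq:
  "sin (real n * \<theta>) = sin \<theta> * (\<Sum>l<n. cos ((real n - 1 - 2 * real l) * \<theta>))"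
proof -
  let ?f = "\<lambda>l. sin ((real n - 2 * real l) * \<theta>)"
  have "sin \<theta> * cos ((real n - 1 - 2 * real l) * \<theta>) = 1/2 * (?f l - ?f (Suc l))" for l
  proof -
    define A where "A = (real n - 1 - 2 * real l) * \<theta>"
    have 1: "\<theta> + A = (real n - 2 * real l) * \<theta>" and 2: "\<theta> - A = - ((real n - 2 * real (Suc l)) * \<theta>)"
      by (simp_all add: A_def algebra_simps)
    have "sin \<theta> * cos A = (sin (\<theta> + A) + sin (\<theta> - A)) / 2" by (rule sin_times_cos)
    then show ?thesis unfolding 1 2 sin_minus unfolding A_def by argo
  qed
  then have "sin \<theta> * (\<Sum>l<n. cos ((real n - 1 - 2 * real l) * \<theta>)) = 1/2 * (\<Sum>l<n. ?f l - ?f (Suc l))"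
    unfolding sum_distrib_left by (intro sum.cong refl)
  also have "(\<Sum>l<n. ?f l - ?f (Suc l)) = ?f 0 - ?f n" by (rule sum_lessThan_telescope')
  also have "(real n - 2 * real n) * \<theta> = - (real n * \<theta>)" by (simp add: algebra_simps)
  finally show ?thesis unfolding sin_minus by simp
qed

definition freq :: "nat^'d \<Rightarrow> real" where
  "freq k = real (\<Sum>i\<in>UNIV. k $ i)"

text \<open>
  The quotient of a sine product by the cut-off function, expanded by \<open>sin_multiple_eq\<close>.  Each cosine is
  written as a ridge function with phase \<open>0\<close>, the form in which it gets approximated.
\<close>

definition sine_quotient :: "nat^'d \<Rightarrow> real^'d \<Rightarrow> real" where
  "sine_quotient k x = (\<Sum>i\<in>UNIV. \<Sum>l<k $ i.
     cos (axis i ((real (k $ i) - 1 - 2 * real l) * pi) \<bullet> x + 0) * (\<Prod>j\<in>UNIV - {i}. sin (pi * real (k $ j) * x $ j)))"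

lemma sin_pi_pos: "x \<in> unit_cube \<Longrightarrow> 0 < sin (pi * x $ i)"
  by (rule sin_gt_zero) (auto simp: unit_cube_def)

lemma sine_basis_eq_cutoff_times_quotient:
  assumes x: "x \<in> unit_cube"
  shows "sine_basis k x = cutoff x * sine_quotient k x"
proof -
  let ?P = "\<lambda>i. \<Prod>j\<in>UNIV - {i}. sin (pi * real (k $ j) * x $ j)"
  have "(\<Sum>l<k $ i. cos (axis i ((real (k $ i) - 1 - 2 * real l) * pi) \<bullet> x + 0) * ?P i) =
      sine_basis k x * (1 / sin (pi * x $ i))" for i
  proof -
    have "sine_basis k x = sin (pi * real (k $ i) * x $ i) * ?P i"
      unfolding sine_basis_def by (rule prod.remove) auto
    also have "sin (pi * real (k $ i) * x $ i) =
        sin (pi * x $ i) * (\<Sum>l<k $ i. cos ((real (k $ i) - 1 - 2 * real l) * (pi * x $ i)))"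
      using sin_multiple_eq[of "k $ i" "pi * x $ i"] by (simp add: mult_ac)
    finally have "sine_basis k x * (1 / sin (pi * x $ i)) =
        (\<Sum>l<k $ i. cos ((real (k $ i) - 1 - 2 * real l) * (pi * x $ i))) * ?P i"
      using sin_pi_pos[OF x, of i] by simp
    then show ?thesis by (simp add: sum_distrib_right inner_axis' mult.assoc)
  qed
  then have "sine_quotient k x = sine_basis k x * (\<Sum>i\<in>UNIV. 1 / sin (pi * x $ i))"
    unfolding sine_quotient_def by (simp add: sum_distrib_left)
  moreover have "0 < (\<Sum>i\<in>UNIV. 1 / sin (pi * x $ i))"
    using sin_pi_pos[OF x] by (intro sum_pos) auto
  ultimately show ?thesis using x by (simp add: cutoff_def)
qed

text \<open>
  There are \<open>freq k\<close> summands, each a cosine times sines with total frequency at most \<open>\<pi> freq k\<close>.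
\<close>

lemma approximable_sine_quotient:
  "approximable (freq k * (pi * freq k + 2 * (pi * freq k)\<^sup>2)) (freq k) (sine_quotient k)"
proof -
  have f: "(\<Sum>i\<in>UNIV. real (k $ i)) = freq k" by (simp add: freq_def)
  have "approximable (pi * freq k + 2 * (pi * freq k)\<^sup>2) 1
     (\<lambda>x. cos (axis i ((real (k $ i) - 1 - 2 * real l) * pi) \<bullet> x + 0) * (\<Prod>j\<in>UNIV - {i}. sin (pi * real (k $ j) * x $ j)))"
    if "l < k $ i" for i l
  proof (rule approximable_cos_times_sines)
    have "l1_norm (axis i ((real (k $ i) - 1 - 2 * real l) * pi)) \<le> pi * real (k $ i)"
      using that by (auto simp: l1_norm_axis abs_mult mult.commute[of _ pi] abs_le_iff)
    moreover have "(\<Sum>j\<in>UNIV - {i}. \<bar>pi * real (k $ j)\<bar>) = pi * (\<Sum>j\<in>UNIV - {i}. real (k $ j))"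
      by (simp add: sum_distrib_left abs_mult)
    moreover have "freq k = real (k $ i) + (\<Sum>j\<in>UNIV - {i}. real (k $ j))"
      unfolding f[symmetric] by (rule sum.remove) auto
    ultimately show "l1_norm (axis i ((real (k $ i) - 1 - 2 * real l) * pi)) + (\<Sum>j\<in>UNIV - {i}. \<bar>pi * real (k $ j)\<bar>) \<le> pi * freq k"
      by (simp add: distrib_left)
  qed simp
  then have "approximable (\<Sum>i\<in>UNIV. \<Sum>l<k $ i. pi * freq k + 2 * (pi * freq k)\<^sup>2) (\<Sum>i\<in>UNIV. \<Sum>l<k $ i. 1)
     (\<lambda>x. sine_quotient k x)"
    unfolding sine_quotient_def by (intro approximable_sum) auto
  then show ?thesis
    by (simp add: sum_distrib_right[symmetric] f)
qed

definition cutoff_grad :: "real^'d \<Rightarrow> real^'d" where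
  "cutoff_grad x = (\<chi> i. (cutoff x)\<^sup>2 * (pi * cos (pi * x $ i) / (sin (pi * x $ i))\<^sup>2))"

lemma cutoff_has_derivative:
  assumes x: "x \<in> unit_cube"
  shows "(cutoff has_derivative (\<lambda>v. cutoff_grad x \<bullet> v)) (at x)"
proof -
  let ?s = "\<lambda>x. \<Sum>i\<in>UNIV. 1 / sin (pi * x $ i)"
  have pos: "0 < ?s x" using sin_pi_pos[OF x] by (intro sum_pos) auto
  have "((\<lambda>x. 1 / sin (pi * x $ i)) has_derivative (\<lambda>v. - (pi * cos (pi * x $ i) / (sin (pi * x $ i))\<^sup>2) * v $ i)) (at x)" for i
  proof -
    have "((\<lambda>y. 1 / sin (pi * y)) has_real_derivative - (pi * cos (pi * x $ i) / (sin (pi * x $ i))\<^sup>2)) (at (x $ i))"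
      using sin_pi_pos[OF x, of i] by (auto intro!: derivative_eq_intros simp: power2_eq_square)
    from has_derivative_compose[OF bounded_linear.has_derivative[OF bounded_linear_vec_nth has_derivative_ident] this[THEN has_field_derivative_imp_has_derivative]]
    show ?thesis .
  qed
  then have "(?s has_derivative (\<lambda>v. \<Sum>i\<in>UNIV. - (pi * cos (pi * x $ i) / (sin (pi * x $ i))\<^sup>2) * v $ i)) (at x)"
    by (intro has_derivative_sum)
  from Deriv.has_derivative_inverse[OF _ this] pos
  have "((\<lambda>x. inverse (?s x)) has_derivative
      (\<lambda>v. - (inverse (?s x) * (\<Sum>i\<in>UNIV. - (pi * cos (pi * x $ i) / (sin (pi * x $ i))\<^sup>2) * v $ i) * inverse (?s x)))) (at x)"
    by simp
  moreover have "- (inverse (?s x) * (\<Sum>i\<in>UNIV. - (pi * cos (pi * x $ i) / (sin (pi * x $ i))\<^sup>2) * v $ i) * inverse (?s x))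
       = cutoff_grad x \<bullet> v" for v
    using x by (simp add: cutoff_grad_def cutoff_def inner_vec_def sum_negf sum_distrib_left sum_distrib_right power2_eq_square mult_ac)
  ultimately have "((\<lambda>x. inverse (?s x)) has_derivative (\<lambda>v. cutoff_grad x \<bullet> v)) (at x)" by simp
  then show ?thesis
    by (rule has_derivative_transform_within_open[OF _ open_unit_cube x]) (simp add: cutoff_def)
qed

text \<open>
  The numbers \<open>p\<^sub>i = \<phi>/sin(\<pi>x\<^sub>i)\<close> are nonnegative with sum \<open>1\<close>, and
  \<open>|\<partial>\<^sub>i\<phi>| = \<pi> p\<^sub>i\<^sup>2 |cos(\<pi>x\<^sub>i)| \<le> \<pi> p\<^sub>i\<close>: the boundary singularity of \<open>1/sin\<close> cancels.
\<close>

lemma cutoff_bounds: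
  assumes x: "x \<in> unit_cube"
  shows "0 < cutoff x" "cutoff x \<le> 1" "norm (cutoff_grad x) \<le> pi"
proof -
  let ?s = "\<Sum>i\<in>UNIV. 1 / sin (pi * x $ i)"
  note pos = sin_pi_pos[OF x]
  have ge1: "1 \<le> 1 / sin (pi * x $ i)" for i using pos[of i] by (simp add: field_simps)
  have "1 \<le> 1 / sin (pi * x $ undefined)" by (rule ge1)
  also have "\<dots> \<le> ?s" using pos by (intro member_le_sum) (auto intro: less_imp_le)
  finally have s: "1 \<le> ?s" .
  have c: "cutoff x = 1 / ?s" using x by (simp add: cutoff_def inverse_eq_divide)
  show "0 < cutoff x" "cutoff x \<le> 1" using s by (auto simp: c divide_le_eq)
  define p where "p i = cutoff x * (1 / sin (pi * x $ i))" for i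
  have sum_p: "(\<Sum>i\<in>UNIV. p i) = 1"
    unfolding p_def sum_distrib_left[symmetric] c using s by simp
  have p0: "0 \<le> p i" for i using pos[of i] \<open>0 < cutoff x\<close> by (simp add: p_def)
  have p1: "p i \<le> 1" for i using member_le_sum[of i UNIV p] p0 sum_p by simp
  have "norm (cutoff_grad x) \<le> (\<Sum>i\<in>UNIV. \<bar>cutoff_grad x $ i\<bar>)" by (rule norm_le_l1_cart)
  also have "\<dots> \<le> (\<Sum>i\<in>UNIV. pi * p i)"
  proof (rule sum_mono)
    fix i
    have "\<bar>cutoff_grad x $ i\<bar> = pi * (p i * p i) * \<bar>cos (pi * x $ i)\<bar>"
      by (simp add: cutoff_grad_def p_def abs_mult power2_eq_square)
    also have "\<dots> \<le> pi * (p i * p i) * 1" using p0 by (intro mult_left_mono) auto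
    also have "\<dots> \<le> pi * p i" using p0[of i] p1[of i] by (simp add: mult_left_le)
    finally show "\<bar>cutoff_grad x $ i\<bar> \<le> pi * p i" .
  qed
  also have "\<dots> = pi" by (simp add: sum_distrib_left[symmetric] sum_p)
  finally show "norm (cutoff_grad x) \<le> pi" .
qed

lemma cutoff_borel[measurable]: "cutoff \<in> borel_measurable borel"
proof -
  have comp[measurable]: "(\<lambda>x::real^'d. x $ i) \<in> borel_measurable borel" for i
    by (intro borel_measurable_continuous_onI continuous_intros)
  show ?thesis unfolding cutoff_def[abs_def] inverse_eq_divide by measurable
qed

lemma cutoff_grad_borel[measurable]: "cutoff_grad \<in> borel_measurable borel"
proof (rule borel_measurable_vecI)
  have [measurable]: "(\<lambda>x::real^'a. x $ i) \<in> borel_measurable borel" for i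
    by (intro borel_measurable_continuous_onI continuous_intros)
  show "(\<lambda>x::real^'a. cutoff_grad x $ i) \<in> borel_measurable borel" for i
    unfolding cutoff_grad_def vec_lambda_beta by measurable
qed

section \<open>Completeness and orthogonality of the sine products\<close>

lemma lborel_integral_prod_cart:
  fixes f :: "'d::finite \<Rightarrow> real \<Rightarrow> real"
  assumes f: "\<And>i. integrable lborel (f i)"
  shows "(LINT x|(lborel :: (real^'d) measure). (\<Prod>i\<in>UNIV. f i (x $ i))) = (\<Prod>i\<in>UNIV. (LINT t|lborel. f i t))"
proof -
  interpret product_sigma_finite "\<lambda>_::real^'d. lborel :: real measure" ..
  have bij: "bij_betw (\<lambda>i. axis i 1 :: real^'d) UNIV Basis"
    by (auto simp: bij_betw_def inj_on_def axis_eq_axis Basis_vec_def)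
  define g where "g b = f (axis_index b)" for b :: "real^'d"
  have g: "integrable lborel (g b)" for b using f by (simp add: g_def)
  have [measurable]: "g b \<in> borel_measurable borel" for b using g[of b] by auto
  have prod_cart: "((\<Prod>i\<in>UNIV. f i (x $ i))) = (\<Prod>b\<in>Basis. g b (x \<bullet> b))" for x :: "real^'d"
    by (subst prod.reindex_bij_betw[OF bij, symmetric]) (simp add: g_def inner_axis axis_index_axis)
  have "(LINT x|(lborel :: (real^'d) measure). (\<Prod>i\<in>UNIV. f i (x $ i))) =
      (LINT x|lborel. (\<Prod>b\<in>Basis. g b ((x :: real^'d) \<bullet> b)))"
    unfolding prod_cart ..
  also have "\<dots> = (LINT y|(\<Pi>\<^sub>M b\<in>(Basis :: (real^'d) set). lborel). (\<Prod>b\<in>Basis. g b ((\<Sum>b\<in>Basis. y b *\<^sub>R b) \<bullet> b)))"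
    by (subst lborel_eq, subst integral_distr) auto
  also have "\<dots> = (LINT y|(\<Pi>\<^sub>M b\<in>(Basis :: (real^'d) set). lborel). (\<Prod>b\<in>Basis. g b (y b)))"
    by (intro Bochner_Integration.integral_cong prod.cong refl) simp
  also have "\<dots> = (\<Prod>b\<in>(Basis :: (real^'d) set). (LINT t|lborel. g b t))"
    using g by (intro product_integral_prod) auto
  also have "\<dots> = (\<Prod>i\<in>UNIV. (LINT t|lborel. f i t))"
    by (subst prod.reindex_bij_betw[OF bij, symmetric]) (simp add: g_def axis_index_axis)
  finally show ?thesis .
qed

lemma integral_cos_multiple_pi:
  fixes n :: int
  shows "(LINT t|lborel. cos (pi * of_int n * t) * indicator {0..1} t) = (if n = 0 then 1 else 0)"
proof (cases "n = 0")
  case False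
  have "(LINT t|lborel. cos (pi * of_int n * t) * indicator {0..1} t) =
      sin (pi * of_int n * 1) / (pi * of_int n) - sin (pi * of_int n * 0) / (pi * of_int n)"
    using False by (intro integral_FTC_Icc_real) (auto intro!: derivative_eq_intros continuous_intros)
  also have "\<dots> = 0" using sin_npi2[of "nat \<bar>n\<bar>"] sin_int_times_real[of n] by (simp add: mult.commute sin_integer_2pi)
  finally show ?thesis using False by simp
qed simp

lemma integral_sin_sin:
  fixes k l :: nat
  assumes "k > 0"
  shows "(LINT t|lborel. indicator {0<..<1} t * (sin (pi * k * t) * sin (pi * l * t))) = (if k = l then 1/2 else 0)"
proof -
  have int: "integrable lborel (\<lambda>t. cos (pi * of_int n * t) * indicator {0..1} t)" for n :: int
    using borel_integrable_atLeastAtMost[of 0 1 "\<lambda>t. cos (pi * of_int n * t)"]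
    by (simp add: set_integrable_def mult.commute)
  have "(LINT t|lborel. indicator {0<..<1} t * (sin (pi * k * t) * sin (pi * l * t))) =
     (LINT t|lborel. 1/2 * (cos (pi * of_int (int k - int l) * t) * indicator {0..1} t) -
         1/2 * (cos (pi * of_int (int k + int l) * t) * indicator {0..1} t))"
  proof (rule integral_cong_AE)
    have "indicator {0<..<1} t * (sin (pi * k * t) * sin (pi * l * t)) =
      1/2 * (cos (pi * of_int (int k - int l) * t) * indicator {0..1} t) -
         1/2 * (cos (pi * of_int (int k + int l) * t) * indicator {0..1} t)" if "t \<noteq> 0" "t \<noteq> 1" for t
    proof -
      have "pi * k * t - pi * l * t = pi * of_int (int k - int l) * t"
        "pi * k * t + pi * l * t = pi * of_int (int k + int l) * t"
        by (simp_all add: algebra_simps)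
      then have "sin (pi * k * t) * sin (pi * l * t) =
          (cos (pi * of_int (int k - int l) * t) - cos (pi * of_int (int k + int l) * t)) / 2"
        unfolding sin_times_sin by (simp only:)
      moreover have "(indicator {0..1} t :: real) = indicator {0<..<1} t" using that by (auto simp: indicator_def)
      ultimately show ?thesis by (simp add: indicator_def)
    qed
    moreover note AE_lborel_singleton[of "0::real"] AE_lborel_singleton[of "1::real"]
    ultimately show "AE t in lborel. indicator {0<..<1} t * (sin (pi * k * t) * sin (pi * l * t)) =
      1/2 * (cos (pi * of_int (int k - int l) * t) * indicator {0..1} t) -
         1/2 * (cos (pi * of_int (int k + int l) * t) * indicator {0..1} t)"
      by (auto elim: eventually_elim2)
  qed measurable
  also have "\<dots> = 1/2 * (if int k - int l = 0 then 1 else 0) - 1/2 * (if int k + int l = 0 then 1 else 0)"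
    using int by (simp only: integral_cos_multiple_pi[symmetric] integral_mult_right_zero
      Bochner_Integration.integral_diff[OF integrable_mult_right integrable_mult_right])
  also have "\<dots> = (if k = l then 1/2 else 0)" using assms by auto
  finally show ?thesis .
qed

lemma continuous_on_sine_basis: "continuous_on A (sine_basis k)"
  unfolding sine_basis_def[abs_def] by (intro continuous_intros)

lemma sine_basis_borel[measurable]: "sine_basis k \<in> borel_measurable borel"
  by (rule borel_measurable_continuous_onI[OF continuous_on_sine_basis])

lemma abs_sine_basis_le: "\<bar>sine_basis k x\<bar> \<le> 1"
  unfolding sine_basis_def abs_prod by (rule prod_le_1) auto

lemma sine_basis_orthogonal:
  fixes k l :: "nat^'d"
  assumes "k \<in> pos_multi_indices"
  shows "(LINT x:unit_cube|lebesgue. sine_basis k x * sine_basis l x) = (if k = l then (1/2) ^ CARD('d) else 0)"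
proof -
  let ?f = "\<lambda>i t. indicator {0<..<1} t * (sin (pi * (k $ i) * t) * sin (pi * (l $ i) * t))"
  have ind: "indicator unit_cube x = (\<Prod>i\<in>UNIV. indicator {0<..<1} (x $ i) :: real)" for x :: "real^'d"
    by (auto simp: indicator_def unit_cube_def)
  have int: "integrable lborel (?f i)" for i
  proof -
    have "set_integrable lebesgue {0<..<1} (\<lambda>t::real. sin (pi * (k $ i) * t) * sin (pi * (l $ i) * t))"
      by (rule set_integrable_bounded[where C = 1]) (auto simp: abs_mult mult_le_one)
    then show ?thesis by (simp add: set_integrable_def integrable_completion)
  qed
  have "(LINT x:unit_cube|lebesgue. sine_basis k x * sine_basis l x) =
      (LINT x|lborel. indicator unit_cube x *\<^sub>R (sine_basis k x * sine_basis l x))"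
    unfolding set_lebesgue_integral_def by (rule integral_completion) measurable
  also have "\<dots> = (LINT x|lborel. (\<Prod>i\<in>UNIV. ?f i (x $ i)))"
    by (simp add: ind sine_basis_def prod.distrib)
  also have "\<dots> = (\<Prod>i\<in>UNIV. (LINT t|lborel. ?f i t))"
    by (rule lborel_integral_prod_cart[OF int])
  also have "\<dots> = (\<Prod>i\<in>UNIV. if k $ i = l $ i then 1/2 else 0)"
    using assms by (intro prod.cong refl integral_sin_sin) (simp add: pos_multi_indices_def)
  also have "\<dots> = (if k = l then (1/2) ^ CARD('d) else 0)"
    by (auto simp: vec_eq_iff)
  finally show ?thesis .
qed

lemma set_integrable_times_continuous:
  fixes w g :: "real^'d \<Rightarrow> real"
  assumes w: "set_integrable lebesgue unit_cube w" and g: "continuous_on (cbox 0 1) g"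
  shows "set_integrable lebesgue unit_cube (\<lambda>x. w x * g x)"
proof -
  have "compact (g ` cbox 0 1)" using g by (rule compact_continuous_image) simp
  then obtain C where C: "\<And>x. x \<in> cbox 0 1 \<Longrightarrow> \<bar>g x\<bar> \<le> C"
    using compact_imp_bounded bounded_iff by (metis imageI real_norm_def)
  have sub: "unit_cube \<subseteq> (cbox 0 1 :: (real^'d) set)" unfolding unit_cube_eq_box by (rule box_subset_cbox)
  have [measurable]: "(\<lambda>x. indicator (cbox 0 1) x *\<^sub>R g x) \<in> borel_measurable lebesgue"
    using borel_measurable_continuous_on_indicator[OF _ g] by (intro measurable_completion) auto
  have w': "integrable lebesgue (\<lambda>x. indicator unit_cube x *\<^sub>R w x)"
    using w by (simp add: set_integrable_def)
  have "integrable lebesgue (\<lambda>x. (indicator unit_cube x *\<^sub>R w x) * (indicator (cbox 0 1) x *\<^sub>R g x))"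
  proof (rule Bochner_Integration.integrable_bound)
    show "integrable lebesgue (\<lambda>x. C * (indicator unit_cube x *\<^sub>R w x))"
      using w' by (rule integrable_mult_right)
    show "(\<lambda>x. (indicator unit_cube x *\<^sub>R w x) * (indicator (cbox 0 1) x *\<^sub>R g x)) \<in> borel_measurable lebesgue"
      by (rule borel_measurable_times[OF borel_measurable_integrable[OF w']]) measurable
    have "norm ((indicator unit_cube x *\<^sub>R w x) * (indicator (cbox 0 1) x *\<^sub>R g x)) \<le> norm (C * (indicator unit_cube x *\<^sub>R w x))" for x
    proof (cases "x \<in> unit_cube")
      case True
      then have "\<bar>g x\<bar> \<le> \<bar>C\<bar>" using C[of x] sub by force
      then show ?thesis using True by (auto simp: abs_mult indicator_def mult.commute mult_left_mono mult_right_mono)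
    qed simp
    then show "AE x in lebesgue. norm ((indicator unit_cube x *\<^sub>R w x) * (indicator (cbox 0 1) x *\<^sub>R g x)) \<le> norm (C * (indicator unit_cube x *\<^sub>R w x))"
      by (rule AE_I2)
  qed
  moreover have "(indicator unit_cube x *\<^sub>R w x) * (indicator (cbox 0 1) x *\<^sub>R g x) = indicator unit_cube x *\<^sub>R (w x * g x)" for x
    using sub by (auto simp: indicator_def)
  ultimately show ?thesis unfolding set_integrable_def by (simp only:)
qed

lemma sine_basis_eq_0: "k \<notin> pos_multi_indices \<Longrightarrow> sine_basis k x = 0"
proof -
  assume "k \<notin> pos_multi_indices"
  then obtain i where "k $ i = 0" by (auto simp: pos_multi_indices_def)
  then show ?thesis unfolding sine_basis_def by (intro prod_zero bexI[of _ i]) auto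
qed

text \<open>
  The two indices are the neighbours of \<open>k\<close> in direction \<open>j\<close>.  The lower one may have a zero entry, and
  then its sine product vanishes identically.
\<close>

lemma cos_times_sine_basis:
  fixes k :: "nat^'d"
  assumes "0 < k $ j"
  obtains k1 k2 :: "nat^'d"
  where "\<And>x. cos (pi * x $ j) * sine_basis k x = 1/2 * sine_basis k1 x + 1/2 * sine_basis k2 x"
proof -
  define K where "K n = (\<chi> i. if i = j then n else k $ i)" for n
  define P where "P x = (\<Prod>i\<in>UNIV - {j}. sin (pi * real (k $ i) * x $ i))" for x
  have K: "sine_basis (K n) x = sin (pi * real n * x $ j) * P x" for n x
    unfolding sine_basis_def P_def by (subst prod.remove[of _ j]) (auto simp: K_def intro!: prod.cong)
  have k: "sine_basis k x = sin (pi * real (k $ j) * x $ j) * P x" for x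
    unfolding sine_basis_def P_def by (subst prod.remove[of _ j]) auto
  have "cos (pi * x $ j) * sine_basis k x = 1/2 * sine_basis (K (k $ j + 1)) x + 1/2 * sine_basis (K (k $ j - 1)) x" for x
  proof -
    have e: "pi * real (k $ j) * x $ j + pi * x $ j = pi * real (k $ j + 1) * x $ j"
      "pi * real (k $ j) * x $ j - pi * x $ j = pi * real (k $ j - 1) * x $ j"
      using assms by (simp_all add: of_nat_diff algebra_simps)
    have "sin (pi * real (k $ j) * x $ j) * cos (pi * x $ j) =
        (sin (pi * real (k $ j + 1) * x $ j) + sin (pi * real (k $ j - 1) * x $ j)) / 2"
      unfolding e[symmetric] by (rule sin_times_cos)
    note main = this
    have "cos (pi * x $ j) * sine_basis k x = sin (pi * real (k $ j) * x $ j) * cos (pi * x $ j) * P x"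
      unfolding k by (simp only: mult_ac)
    also have "\<dots> = (sin (pi * real (k $ j + 1) * x $ j) + sin (pi * real (k $ j - 1) * x $ j)) / 2 * P x"
      by (simp only: main)
    also have "\<dots> = 1/2 * sine_basis (K (k $ j + 1)) x + 1/2 * sine_basis (K (k $ j - 1)) x"
      unfolding K by (simp add: distrib_right add_divide_distrib)
    finally show ?thesis .
  qed
  then show thesis by (rule that)
qed

text \<open>
  Multiplication by \<open>cos(\<pi>x\<^sub>j)\<close> maps sine products to combinations of sine products.  So the
  continuous functions that preserve the annihilator of \<open>w\<close> under multiplication form an algebra
  containing these cosines, which separate the points of the closed cube.  By Stone-Weierstrass \<open>w\<Phi>\<close>, with \<open>\<Phi>\<close>
  the product of all \<open>sin(\<pi>x\<^sub>i)\<close>, is orthogonal to every continuous function; hence it vanishes, and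
  \<open>\<Phi> > 0\<close> inside the cube.
\<close>

lemma sine_basis_complete:
  fixes w :: "real^'d \<Rightarrow> real"
  assumes w: "set_integrable lebesgue unit_cube w"
    and zero: "\<And>k. k \<in> pos_multi_indices \<Longrightarrow> (LINT x:unit_cube|lebesgue. w x * sine_basis k x) = 0"
  shows "AE x in lebesgue. x \<in> unit_cube \<longrightarrow> w x = 0"
proof -
  let ?C = "continuous_on (cbox 0 1 :: (real^'d) set)"
  define I where "I f = (LINT x:unit_cube|lebesgue. w x * f x)" for f
  \<comment> \<open>\<open>Z\<close> describes the annihilator of \<open>w\<close>, and \<open>R\<close> collects its multipliers.\<close>
  define Z where "Z h \<longleftrightarrow> (\<forall>k. I (\<lambda>x. h x * sine_basis k x) = 0)" for h :: "real^'d \<Rightarrow> real"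
  define R where "R = {f. ?C f \<and> (\<forall>h. ?C h \<longrightarrow> Z h \<longrightarrow> Z (\<lambda>x. f x * h x))}"
  have lin: "I (\<lambda>x. a * f x + b * g x) = a * I f + b * I g" if fg: "?C f" "?C g" for a b f g
  proof -
    have i: "set_integrable lebesgue unit_cube (\<lambda>x. a * (w x * f x))" "set_integrable lebesgue unit_cube (\<lambda>x. b * (w x * g x))"
      using fg by (auto intro: set_integrable_times_continuous[OF w])
    have "w x * (a * f x + b * g x) = a * (w x * f x) + b * (w x * g x)" for x by (simp add: algebra_simps)
    then show ?thesis
      unfolding I_def by (simp only: set_integral_add(2)[OF i] set_integral_mult_right)
  qed
  have cS: "?C (\<lambda>x. h x * sine_basis k x)" if "?C h" for h k
    using that by (intro continuous_intros continuous_on_sine_basis)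
  have cos_R: "(\<lambda>x. cos (pi * x $ j)) \<in> R" for j
  proof -
    have "Z (\<lambda>x. cos (pi * x $ j) * h x)" if h: "?C h" "Z h" for h
      unfolding Z_def
    proof
      fix k :: "nat^'d"
      show "I (\<lambda>x. cos (pi * x $ j) * h x * sine_basis k x) = 0"
      proof (cases "k $ j = 0")
        case True
        then have "k \<notin> pos_multi_indices" by (auto simp: pos_multi_indices_def)
        then show ?thesis by (simp add: sine_basis_eq_0 I_def)
      next
        case False
        then have "0 < k $ j" by simp
        then obtain k1 k2 :: "nat^'d" where
          kk: "\<And>x. cos (pi * x $ j) * sine_basis k x = 1/2 * sine_basis k1 x + 1/2 * sine_basis k2 x"
          by (rule cos_times_sine_basis) blast
        have "cos (pi * x $ j) * h x * sine_basis k x =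
            1/2 * (h x * sine_basis k1 x) + 1/2 * (h x * sine_basis k2 x)" for x
          using arg_cong[OF kk[of x], of "\<lambda>a. h x * a"] by (simp add: algebra_simps)
        then show ?thesis using lin[OF cS[OF h(1)] cS[OF h(1)], of "1/2" k1 "1/2" k2] h(2) by (simp add: Z_def)
      qed
    qed
    then show ?thesis by (auto simp: R_def intro!: continuous_intros)
  qed
  have Z1: "Z (\<lambda>x. 1)"
    unfolding Z_def
  proof
    fix k :: "nat^'d"
    show "I (\<lambda>x. 1 * sine_basis k x) = 0"
      using zero[of k] by (cases "k \<in> pos_multi_indices") (simp_all add: sine_basis_eq_0 I_def)
  qed
  interpret function_ring_on R "cbox 0 1 :: (real^'d) set"
  proof
    show "compact (cbox 0 1 :: (real^'d) set)" by simp
    show "?C f" if "f \<in> R" for f using that by (simp add: R_def)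
    show "(\<lambda>x. f x + g x) \<in> R" if fg: "f \<in> R" "g \<in> R" for f g
    proof -
      have "Z (\<lambda>x. (f x + g x) * h x)" if h: "?C h" "Z h" for h
        unfolding Z_def
      proof
        fix k
        have "?C (\<lambda>x. f x * h x)" "?C (\<lambda>x. g x * h x)"
          using fg h by (auto simp: R_def intro!: continuous_intros)
        from lin[OF this[THEN cS], of 1 k 1 k]
        show "I (\<lambda>x. (f x + g x) * h x * sine_basis k x) = 0"
          using fg h by (simp add: R_def Z_def distrib_right)
      qed
      then show ?thesis using fg by (auto simp: R_def intro!: continuous_intros)
    qed
    show "(\<lambda>x. f x * g x) \<in> R" if fg: "f \<in> R" "g \<in> R" for f g
    proof -
      have "Z (\<lambda>x. f x * (g x * h x))" if h: "?C h" "Z h" for h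
      proof -
        have "?C (\<lambda>x. g x * h x)" "Z (\<lambda>x. g x * h x)"
          using fg(2) h by (auto simp: R_def intro!: continuous_intros)
        then show ?thesis using fg(1) by (simp add: R_def)
      qed
      then show ?thesis using fg by (auto simp: R_def mult.assoc intro!: continuous_intros)
    qed
    show "(\<lambda>_. c) \<in> R" for c
    proof -
      have "Z (\<lambda>x. c * h x)" if "?C h" "Z h" for h
        unfolding Z_def
      proof
        fix k
        show "I (\<lambda>x. c * h x * sine_basis k x) = 0"
          using lin[OF cS[OF that(1)] cS[OF that(1)], of c k 0 k] that(2) by (simp add: Z_def mult.assoc)
      qed
      then show ?thesis by (simp add: R_def)
    qed
    show "\<exists>f\<in>R. f x \<noteq> f y" if xy: "x \<in> cbox 0 1" "y \<in> cbox 0 1" "x \<noteq> y" for x y :: "real^'d"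
    proof -
      obtain j where j: "x $ j \<noteq> y $ j" using xy(3) by (auto simp: vec_eq_iff)
      have "0 \<le> pi * x $ j" "pi * x $ j \<le> pi" "0 \<le> pi * y $ j" "pi * y $ j \<le> pi"
        using xy(1,2) by (auto simp: mem_box_cart mult_left_le)
      then have "cos (pi * x $ j) \<noteq> cos (pi * y $ j)"
        using j cos_inj_pi by (metis mult_cancel_left pi_neq_zero)
      then show ?thesis by (intro bexI[OF _ cos_R[of j]])
    qed
  qed
  let ?one = "\<chi> i. 1 :: nat^'d"
  have "AE x in lebesgue. x \<in> unit_cube \<longrightarrow> w x * sine_basis ?one x = 0"
  proof (rule AE_eq_0_of_test_function_integrals[OF open_unit_cube])
    have w1: "set_integrable lebesgue unit_cube (\<lambda>x. w x * sine_basis ?one x)"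
      by (rule set_integrable_times_continuous[OF w continuous_on_sine_basis])
    then show "locally_integrable unit_cube (\<lambda>x. w x * sine_basis ?one x)"
      by (rule set_integrable_imp_locally_integrable)
    fix \<psi> :: "real^'d \<Rightarrow> real" assume "\<psi> \<in> test_functions unit_cube"
    then have \<psi>: "continuous_on UNIV \<psi>" by (rule test_functionE)
    then have \<psi>': "continuous_on (cbox 0 1) \<psi>" by (rule continuous_on_subset) simp
    let ?J = "LINT x:unit_cube|lebesgue. \<bar>w x * sine_basis ?one x\<bar>"
    have le: "\<bar>I (\<lambda>x. \<psi> x * sine_basis ?one x)\<bar> \<le> \<epsilon> * ?J" if eps: "\<epsilon> > 0" for \<epsilon>
    proof -
      obtain f where f: "f \<in> R" "\<And>x. x \<in> cbox 0 1 \<Longrightarrow> \<bar>\<psi> x - f x\<bar> < \<epsilon>"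
        using Stone_Weierstrass_basic[OF \<psi>' eps] by blast
      have fc: "?C f" using f(1) by (simp add: R_def)
      have "\<And>h. ?C h \<Longrightarrow> Z h \<Longrightarrow> Z (\<lambda>x. f x * h x)"
        using f(1) unfolding R_def by blast
      from this[OF continuous_on_const Z1] have f0: "I (\<lambda>x. f x * sine_basis ?one x) = 0"
        by (simp add: Z_def)
      define D where "D x = w x * sine_basis ?one x * (\<psi> x - f x)" for x
      have D: "set_integrable lebesgue unit_cube D"
        unfolding D_def by (intro set_integrable_times_continuous[OF w1] continuous_on_diff \<psi>' fc)
      have "(LINT x:unit_cube|lebesgue. D x) = I (\<lambda>x. 1 * (\<psi> x * sine_basis ?one x) + (-1) * (f x * sine_basis ?one x))"
        by (simp add: D_def I_def algebra_simps)
      also have "\<dots> = I (\<lambda>x. \<psi> x * sine_basis ?one x)"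
        unfolding lin[OF cS[OF \<psi>'] cS[OF fc]] f0 by simp
      finally have "\<bar>I (\<lambda>x. \<psi> x * sine_basis ?one x)\<bar> \<le> (LINT x:unit_cube|lebesgue. \<bar>D x\<bar>)"
        using set_integral_norm_bound[OF D] by (simp only: real_norm_def)
      also have "\<dots> \<le> (LINT x:unit_cube|lebesgue. \<epsilon> * \<bar>w x * sine_basis ?one x\<bar>)"
      proof (rule set_integral_mono[OF set_integrable_abs[OF D]])
        show "set_integrable lebesgue unit_cube (\<lambda>x. \<epsilon> * \<bar>w x * sine_basis ?one x\<bar>)"
          by (rule set_integrable_mult_right) (rule set_integrable_abs[OF w1])
        fix x :: "real^'d" assume "x \<in> unit_cube"
        then have "\<bar>\<psi> x - f x\<bar> \<le> \<epsilon>" using f(2)[of x] box_subset_cbox unfolding unit_cube_eq_box by (force intro: less_imp_le)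
        then have "\<bar>w x * sine_basis ?one x\<bar> * \<bar>\<psi> x - f x\<bar> \<le> \<bar>w x * sine_basis ?one x\<bar> * \<epsilon>"
          by (rule mult_left_mono) simp
        then show "\<bar>D x\<bar> \<le> \<epsilon> * \<bar>w x * sine_basis ?one x\<bar>"
          unfolding D_def by (simp only: abs_mult mult.commute[of \<epsilon>])
      qed
      also have "\<dots> = \<epsilon> * ?J" by (rule set_integral_mult_right)
      finally show ?thesis .
    qed
    have J: "0 \<le> ?J" unfolding set_lebesgue_integral_def by (intro integral_nonneg_AE) auto
    have "\<bar>I (\<lambda>x. \<psi> x * sine_basis ?one x)\<bar> \<le> 0 + \<epsilon>" if "\<epsilon> > 0" for \<epsilon>
    proof -
      have "\<bar>I (\<lambda>x. \<psi> x * sine_basis ?one x)\<bar> \<le> \<epsilon> / (?J + 1) * ?J" by (rule le) (use J that in simp)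
      also have "\<dots> \<le> \<epsilon>" using J that by (simp add: field_simps)
      finally show ?thesis by simp
    qed
    then have "\<bar>I (\<lambda>x. \<psi> x * sine_basis ?one x)\<bar> \<le> 0" by (rule field_le_epsilon)
    then show "(LINT x:unit_cube|lebesgue. w x * sine_basis ?one x * \<psi> x) = 0" by (simp add: I_def mult_ac)
  qed
  moreover have "sine_basis ?one x \<noteq> 0" if "x \<in> unit_cube" for x
    using sin_pi_pos[OF that] unfolding sine_basis_def by (auto simp: less_imp_neq[symmetric])
  ultimately show ?thesis by (auto elim: eventually_mono)
qed

section \<open>Sine series\<close>

lemma infsum_minus_sum_le:
  fixes F :: "'i \<Rightarrow> 'b::banach" and a :: "'i \<Rightarrow> real"
  assumes a: "a summable_on A" and F: "\<And>k. k \<in> A \<Longrightarrow> norm (F k) \<le> a k" and K: "finite K" "K \<subseteq> A"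
  shows "norm (infsum F A - sum F K) \<le> infsum a A - sum a K"
proof -
  have "F abs_summable_on A"
    by (rule Infinite_Sum.abs_summable_on_comparison_test'[OF a F])
  then have "F summable_on A" by (rule abs_summable_summable)
  then have FK: "F summable_on (A - K)" "a summable_on (A - K)"
    using a by (auto intro: summable_on_subset_banach)
  have "norm (infsum F (A - K)) \<le> infsum a (A - K)"
    by (rule norm_infsum_le[OF has_sum_infsum[OF FK(1)] has_sum_infsum[OF FK(2)]]) (use F in auto)
  moreover have "infsum F (A - K) = infsum F A - sum F K" "infsum a (A - K) = infsum a A - sum a K"
    using infsum_Diff[OF \<open>F summable_on A\<close> summable_on_finite[OF K(1)] K(2)]
      infsum_Diff[OF a summable_on_finite[OF K(1)] K(2)] K(1) by simp_all
  ultimately show ?thesis by simp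
qed

lemma infsum_tail_small:
  fixes a :: "'i \<Rightarrow> real"
  assumes a: "a summable_on A" and \<epsilon>: "\<epsilon> > 0" and K0: "finite K0" "K0 \<subseteq> A"
  obtains K where "finite K" "K0 \<subseteq> K" "K \<subseteq> A" "infsum a A - sum a K \<le> \<epsilon>"
proof -
  have "(sum a \<longlongrightarrow> infsum a A) (finite_subsets_at_top A)"
    using has_sum_infsum[OF a] by (simp add: has_sum_def)
  then have "\<forall>\<^sub>F K in finite_subsets_at_top A. dist (sum a K) (infsum a A) < \<epsilon>"
    using \<epsilon> by (rule tendstoD)
  moreover have "\<forall>\<^sub>F K in finite_subsets_at_top A. finite K \<and> K0 \<subseteq> K \<and> K \<subseteq> A"
    using eventually_finite_subsets_at_top K0 by blast
  ultimately have "\<forall>\<^sub>F K in finite_subsets_at_top A. dist (sum a K) (infsum a A) < \<epsilon> \<and> finite K \<and> K0 \<subseteq> K \<and> K \<subseteq> A"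
    by eventually_elim auto
  then obtain K where K: "dist (sum a K) (infsum a A) < \<epsilon>" "finite K" "K0 \<subseteq> K" "K \<subseteq> A"
    using eventually_happens' finite_subsets_at_top_neq_bot by blast
  then show thesis by (intro that[of K]) (auto simp: dist_real_def)
qed

lemma freq_nonneg: "0 \<le> freq k" by (simp add: freq_def sum_nonneg)

lemma freq_ge_1:
  assumes "k \<in> pos_multi_indices"
  shows "1 \<le> freq k"
proof -
  have "1 \<le> k $ undefined" using assms by (auto simp: pos_multi_indices_def Suc_le_eq)
  also have "\<dots> \<le> (\<Sum>i\<in>UNIV. k $ i)" by (intro member_le_sum) auto
  finally have "real 1 \<le> real (\<Sum>i\<in>UNIV. k $ i)" by (rule of_nat_mono)
  then show ?thesis by (simp add: freq_def del: of_nat_sum)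
qed

definition sine_grad :: "nat^'d \<Rightarrow> real^'d \<Rightarrow> real^'d" where
  "sine_grad k x = (\<chi> i. pi * real (k $ i) * cos (pi * real (k $ i) * x $ i) *
     (\<Prod>j\<in>UNIV - {i}. sin (pi * real (k $ j) * x $ j)))"

lemma sine_basis_has_derivative: "(sine_basis k has_derivative (\<lambda>v. sine_grad k x \<bullet> v)) (at x)"
proof -
  have D: "((\<lambda>x. sin (pi * real (k $ i) * x $ i)) has_derivative
      (\<lambda>v. (pi * real (k $ i) * cos (pi * real (k $ i) * x $ i)) * v $ i)) (at x)" for i
  proof -
    have "((\<lambda>y. sin (pi * real (k $ i) * y)) has_real_derivative pi * real (k $ i) * cos (pi * real (k $ i) * x $ i)) (at (x $ i))"
      by (auto intro!: derivative_eq_intros)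
    from has_derivative_compose[OF bounded_linear.has_derivative[OF bounded_linear_vec_nth has_derivative_ident] this[THEN has_field_derivative_imp_has_derivative]]
    show ?thesis .
  qed
  have "(sine_basis k has_derivative (\<lambda>v. \<Sum>i\<in>UNIV. (pi * real (k $ i) * cos (pi * real (k $ i) * x $ i)) * v $ i *
      (\<Prod>j\<in>UNIV - {i}. sin (pi * real (k $ j) * x $ j)))) (at x)"
    unfolding sine_basis_def[abs_def] by (rule has_derivative_prod[OF D])
  then show ?thesis
    by (rule has_derivative_eq_rhs) (simp add: sine_grad_def inner_vec_def fun_eq_iff mult_ac)
qed

lemma norm_sine_grad_le: "norm (sine_grad k x) \<le> pi * freq k"
proof -
  have "norm (sine_grad k x) \<le> (\<Sum>i\<in>UNIV. \<bar>sine_grad k x $ i\<bar>)" by (rule norm_le_l1_cart)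
  also have "\<dots> \<le> (\<Sum>i\<in>UNIV. pi * real (k $ i))"
  proof (rule sum_mono)
    fix i
    have "\<bar>\<Prod>j\<in>UNIV - {i}. sin (pi * real (k $ j) * x $ j)\<bar> \<le> 1"
      unfolding abs_prod by (rule prod_le_1) auto
    then have "\<bar>sine_grad k x $ i\<bar> \<le> (pi * real (k $ i)) * 1 * 1"
      unfolding sine_grad_def vec_lambda_beta abs_mult by (intro mult_mono) auto
    then show "\<bar>sine_grad k x $ i\<bar> \<le> pi * real (k $ i)" by simp
  qed
  also have "\<dots> = pi * freq k" by (simp add: freq_def sum_distrib_left)
  finally show ?thesis .
qed

lemma sine_grad_borel[measurable]: "sine_grad k \<in> borel_measurable borel"
proof (rule borel_measurable_vecI)
  fix i
  show "(\<lambda>x. sine_grad k x $ i) \<in> borel_measurable borel"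
    unfolding sine_grad_def vec_lambda_beta
    by (intro borel_measurable_continuous_onI continuous_intros)
qed

definition sine_series :: "(nat^'d \<Rightarrow> real) \<Rightarrow> real^'d \<Rightarrow> real" where
  "sine_series c x = (\<Sum>\<^sub>\<infinity>k\<in>pos_multi_indices. c k * sine_basis k x)"

definition sine_series_grad :: "(nat^'d \<Rightarrow> real) \<Rightarrow> real^'d \<Rightarrow> real^'d" where
  "sine_series_grad c x = (\<Sum>\<^sub>\<infinity>k\<in>pos_multi_indices. c k *\<^sub>R sine_grad k x)"

text \<open>
  One summable bound for the terms of the series and of its gradient, so that the same finite partial
  sum approximates both.
\<close>

definition sine_majorant :: "(nat^'d \<Rightarrow> real) \<Rightarrow> nat^'d \<Rightarrow> real" where
  "sine_majorant c k = \<bar>c k\<bar> * (1 + pi * freq k)"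

lemma sine_terms_le_majorant:
  "norm (c k * sine_basis k x) \<le> sine_majorant c k" "norm (c k *\<^sub>R sine_grad k x) \<le> sine_majorant c k"
proof -
  have "\<bar>c k\<bar> * \<bar>sine_basis k x\<bar> \<le> \<bar>c k\<bar> * (1 + pi * freq k)"
    using abs_sine_basis_le[of k x] freq_nonneg[of k] by (intro mult_left_mono) (auto simp: add_increasing2)
  then show "norm (c k * sine_basis k x) \<le> sine_majorant c k" by (simp add: abs_mult sine_majorant_def)
  have "\<bar>c k\<bar> * norm (sine_grad k x) \<le> \<bar>c k\<bar> * (1 + pi * freq k)"
    using norm_sine_grad_le[of k x] by (intro mult_left_mono) auto
  then show "norm (c k *\<^sub>R sine_grad k x) \<le> sine_majorant c k" by (simp add: sine_majorant_def)
qed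

lemma sine_majorant_nonneg: "0 \<le> sine_majorant c k"
  by (simp add: sine_majorant_def freq_nonneg)

lemma sine_series_uniform_approx:
  assumes c: "sine_majorant c summable_on pos_multi_indices" and "\<epsilon> > 0"
    and K0: "finite K0" "K0 \<subseteq> pos_multi_indices"
  shows "\<exists>K. finite K \<and> K0 \<subseteq> K \<and> K \<subseteq> pos_multi_indices \<and>
    (\<forall>x. \<bar>sine_series c x - (\<Sum>k\<in>K. c k * sine_basis k x)\<bar> \<le> \<epsilon>) \<and>
    (\<forall>x. norm (sine_series_grad c x - (\<Sum>k\<in>K. c k *\<^sub>R sine_grad k x)) \<le> \<epsilon>)"
proof -
  obtain K where K: "finite K" "K0 \<subseteq> K" "K \<subseteq> pos_multi_indices"
      "infsum (sine_majorant c) pos_multi_indices - sum (sine_majorant c) K \<le> \<epsilon>"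
    using infsum_tail_small[OF c \<open>\<epsilon> > 0\<close> K0] .
  show ?thesis
  proof (intro exI[of _ K] conjI allI K(1-3))
    fix x
    show "\<bar>sine_series c x - (\<Sum>k\<in>K. c k * sine_basis k x)\<bar> \<le> \<epsilon>"
      using infsum_minus_sum_le[OF c sine_terms_le_majorant(1)[of c _ x] K(1,3)] K(4)
      by (simp add: sine_series_def)
    show "norm (sine_series_grad c x - (\<Sum>k\<in>K. c k *\<^sub>R sine_grad k x)) \<le> \<epsilon>"
      using infsum_minus_sum_le[OF c sine_terms_le_majorant(2)[of c _ x] K(1,3)] K(4)
      by (simp add: sine_series_grad_def)
  qed
qed

lemma sine_series_bounds:
  assumes c: "sine_majorant c summable_on pos_multi_indices"
  shows "\<bar>sine_series c x\<bar> \<le> infsum (sine_majorant c) pos_multi_indices"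
    "norm (sine_series_grad c x) \<le> infsum (sine_majorant c) pos_multi_indices"
  using infsum_minus_sum_le[OF c sine_terms_le_majorant(1)[of c _ x], of "{}"]
    infsum_minus_sum_le[OF c sine_terms_le_majorant(2)[of c _ x], of "{}"]
  by (auto simp: sine_series_def sine_series_grad_def)

lemma sine_series_borel:
  assumes c: "sine_majorant c summable_on pos_multi_indices"
  shows "sine_series c \<in> borel_measurable borel" "sine_series_grad c \<in> borel_measurable borel"
proof -
  show "sine_series c \<in> borel_measurable borel"
  proof (rule borel_measurable_uniform_approx)
    fix \<epsilon> :: real assume "\<epsilon> > 0"
    obtain K where K: "finite K" "K \<subseteq> pos_multi_indices"
      "\<And>x. \<bar>sine_series c x - (\<Sum>k\<in>K. c k * sine_basis k x)\<bar> \<le> \<epsilon>"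
      "\<And>x. norm (sine_series_grad c x - (\<Sum>k\<in>K. c k *\<^sub>R sine_grad k x)) \<le> \<epsilon>"
      using sine_series_uniform_approx[OF c \<open>\<epsilon> > 0\<close> finite.emptyI empty_subsetI] by auto
    with K(3) show "\<exists>g\<in>borel_measurable borel. \<forall>x. dist (g x) (sine_series c x) \<le> \<epsilon>"
      by (intro bexI[of _ "\<lambda>x. \<Sum>k\<in>K. c k * sine_basis k x"]) (auto simp: dist_real_def abs_minus_commute)
  qed
  show "sine_series_grad c \<in> borel_measurable borel"
  proof (rule borel_measurable_uniform_approx)
    fix \<epsilon> :: real assume "\<epsilon> > 0"
    obtain K where K: "finite K" "K \<subseteq> pos_multi_indices"
      "\<And>x. \<bar>sine_series c x - (\<Sum>k\<in>K. c k * sine_basis k x)\<bar> \<le> \<epsilon>"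
      "\<And>x. norm (sine_series_grad c x - (\<Sum>k\<in>K. c k *\<^sub>R sine_grad k x)) \<le> \<epsilon>"
      using sine_series_uniform_approx[OF c \<open>\<epsilon> > 0\<close> finite.emptyI empty_subsetI] by auto
    with K(4) show "\<exists>g\<in>borel_measurable borel. \<forall>x. dist (g x) (sine_series_grad c x) \<le> \<epsilon>"
      by (intro bexI[of _ "\<lambda>x. \<Sum>k\<in>K. c k *\<^sub>R sine_grad k x"]) (auto simp: dist_norm norm_minus_commute)
  qed
qed

lemma sine_polynomial_has_derivative:
  "((\<lambda>x. \<Sum>k\<in>K. c k * sine_basis k x) has_derivative (\<lambda>v. (\<Sum>k\<in>K. c k *\<^sub>R sine_grad k x) \<bullet> v)) (at x)"
proof -
  have "((\<lambda>x. \<Sum>k\<in>K. c k * sine_basis k x) has_derivative (\<lambda>v. \<Sum>k\<in>K. c k * (sine_grad k x \<bullet> v))) (at x)"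
    by (intro has_derivative_sum has_derivative_mult_right sine_basis_has_derivative)
  then show ?thesis by (simp add: inner_sum_left)
qed

text \<open>
  Partial sums are smooth and converge uniformly together with their gradients.
\<close>

lemma has_weak_gradient_sine_series:
  assumes c: "sine_majorant c summable_on pos_multi_indices"
  shows "has_weak_gradient unit_cube (sine_series c) (sine_series_grad c)"
proof (rule has_weak_gradient_uniform_limit[OF unit_cube_borel measure_unit_cube])
  have cpt: "bounded K" "K \<in> sets borel" if "compact K" for K :: "(real^'a) set"
    using that by (auto intro: compact_imp_bounded compact_imp_closed borel_closed)
  show "locally_integrable unit_cube (sine_series c)" "locally_integrable unit_cube (sine_series_grad c)"
    unfolding locally_integrable_def
    by (auto intro!: set_integrable_bounded[OF sine_series_borel(1)[OF c]] set_integrable_bounded[OF sine_series_borel(2)[OF c]] cpt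
        sine_series_bounds[OF c])
  fix \<epsilon> :: real assume "\<epsilon> > 0"
  obtain K where K: "finite K" "K \<subseteq> pos_multi_indices"
      "\<And>x. \<bar>sine_series c x - (\<Sum>k\<in>K. c k * sine_basis k x)\<bar> \<le> \<epsilon>"
      "\<And>x. norm (sine_series_grad c x - (\<Sum>k\<in>K. c k *\<^sub>R sine_grad k x)) \<le> \<epsilon>"
      using sine_series_uniform_approx[OF c \<open>\<epsilon> > 0\<close> finite.emptyI empty_subsetI] by auto
  have bd: "\<bar>\<Sum>k\<in>K. c k * sine_basis k x\<bar> \<le> (\<Sum>k\<in>K. sine_majorant c k)" for x
    by (rule sum_norm_le[where f = "\<lambda>k. c k * sine_basis k x", unfolded real_norm_def])
       (rule sine_terms_le_majorant(1)[unfolded real_norm_def])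
  have bd': "norm (\<Sum>k\<in>K. c k *\<^sub>R sine_grad k x) \<le> (\<Sum>k\<in>K. sine_majorant c k)" for x
    by (rule sum_norm_le) (rule sine_terms_le_majorant(2))
  have "has_weak_gradient unit_cube (\<lambda>x. \<Sum>k\<in>K. c k * sine_basis k x) (\<lambda>x. \<Sum>k\<in>K. c k *\<^sub>R sine_grad k x)"
    using sine_polynomial_has_derivative bd bd'
    by (intro has_weak_gradient_unit_cubeI lipschitz_on_unit_cubeI) auto
  then show "\<exists>f' G'. has_weak_gradient unit_cube f' G' \<and>
      (\<forall>x\<in>unit_cube. \<bar>sine_series c x - f' x\<bar> \<le> \<epsilon> \<and> norm (sine_series_grad c x - G' x) \<le> \<epsilon>)"
    using K(3,4) by blast
qed

text \<open>
  By uniform convergence it suffices to integrate partial sums, where orthogonality applies.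
\<close>

lemma sine_coeff_sine_series:
  fixes c :: "nat^'d \<Rightarrow> real"
  assumes c: "sine_majorant c summable_on pos_multi_indices" and l: "l \<in> pos_multi_indices"
  shows "(LINT x:unit_cube|lebesgue. sine_series c x * sine_basis l x) = c l * (1/2) ^ CARD('d)"
proof -
  let ?I = "LINT x:unit_cube|lebesgue. sine_series c x * sine_basis l x"
  have "\<bar>?I - c l * (1/2) ^ CARD('d)\<bar> \<le> 0 + \<epsilon>" if eps: "\<epsilon> > 0" for \<epsilon>
  proof -
    have "{l} \<subseteq> pos_multi_indices" using l by simp
    obtain K where K: "finite K" "{l} \<subseteq> K" "K \<subseteq> pos_multi_indices"
      "\<And>x. \<bar>sine_series c x - (\<Sum>k\<in>K. c k * sine_basis k x)\<bar> \<le> \<epsilon>"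
      "\<And>x. norm (sine_series_grad c x - (\<Sum>k\<in>K. c k *\<^sub>R sine_grad k x)) \<le> \<epsilon>"
      using sine_series_uniform_approx[OF c eps finite.insertI[OF finite.emptyI] \<open>{l} \<subseteq> pos_multi_indices\<close>] by auto
    note [measurable] = sine_series_borel(1)[OF c]
    have i1: "set_integrable lebesgue unit_cube (\<lambda>x. sine_series c x * sine_basis l x)"
    proof (rule set_integrable_bounded)
      show "norm (sine_series c x * sine_basis l x) \<le> infsum (sine_majorant c) pos_multi_indices * 1" for x
        unfolding real_norm_def abs_mult
        by (rule mult_mono'[OF sine_series_bounds(1)[OF c] abs_sine_basis_le]) auto
    qed (auto simp: bounded_unit_cube)
    have i2: "set_integrable lebesgue unit_cube (\<lambda>x. sine_basis k x * sine_basis l x)" for k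
    proof (rule set_integrable_bounded)
      show "norm (sine_basis k x * sine_basis l x) \<le> 1 * 1" for x
        unfolding real_norm_def abs_mult
        by (rule mult_mono'[OF abs_sine_basis_le abs_sine_basis_le]) auto
    qed (auto simp: bounded_unit_cube)
    have i3: "set_integrable lebesgue unit_cube (\<lambda>x. \<Sum>k\<in>K. c k * (sine_basis k x * sine_basis l x))"
      using i2 unfolding set_integrable_def scaleR_sum_right
      by (intro Bochner_Integration.integrable_sum) (simp add: mult.left_commute)
    have "(LINT x:unit_cube|lebesgue. \<Sum>k\<in>K. c k * (sine_basis k x * sine_basis l x)) =
        (\<Sum>k\<in>K. LINT x:unit_cube|lebesgue. c k * (sine_basis k x * sine_basis l x))"
      using i2 unfolding set_lebesgue_integral_def set_integrable_def scaleR_sum_right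
      by (intro Bochner_Integration.integral_sum) (simp add: mult.left_commute)
    also have "\<dots> = (\<Sum>k\<in>K. c k * (if k = l then (1/2) ^ CARD('d) else 0))"
      unfolding set_integral_mult_right
      by (intro sum.cong refl) (use K(3) in \<open>auto simp: sine_basis_orthogonal\<close>)
    also have "\<dots> = c l * (1/2) ^ CARD('d)"
      using K(1,2) by (simp add: if_distrib[of "(*) _"] cong: if_cong)
    finally have "?I - c l * (1/2) ^ CARD('d) =
      (LINT x:unit_cube|lebesgue. sine_series c x * sine_basis l x - (\<Sum>k\<in>K. c k * (sine_basis k x * sine_basis l x)))"
      using set_integral_diff(2)[OF i1 i3] by simp
    also have "\<bar>\<dots>\<bar> \<le> \<epsilon>"
    proof (rule set_integral_abs_le_unit_cube)
      fix x :: "real^'d"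
      have "sine_series c x * sine_basis l x - (\<Sum>k\<in>K. c k * (sine_basis k x * sine_basis l x)) =
          (sine_series c x - (\<Sum>k\<in>K. c k * sine_basis k x)) * sine_basis l x"
        by (simp add: left_diff_distrib sum_distrib_right mult.assoc)
      also have "\<bar>\<dots>\<bar> \<le> \<epsilon> * 1"
        unfolding abs_mult by (rule mult_mono'[OF K(4) abs_sine_basis_le]) auto
      finally show "\<bar>sine_series c x * sine_basis l x - (\<Sum>k\<in>K. c k * (sine_basis k x * sine_basis l x))\<bar> \<le> \<epsilon>"
        by simp
    qed measurable
    finally show ?thesis by simp
  qed
  then have "\<bar>?I - c l * (1/2) ^ CARD('d)\<bar> \<le> 0" by (rule field_le_epsilon)
  then show ?thesis by simp
qed

text \<open>
  All sine coefficients of the difference vanish.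
\<close>

lemma AE_eq_sine_series:
  fixes u :: "real^'d \<Rightarrow> real"
  assumes u: "set_integrable lebesgue unit_cube u"
    and c: "sine_majorant (sine_coeff u) summable_on pos_multi_indices"
  shows "AE x in lebesgue. x \<in> unit_cube \<longrightarrow> u x = sine_series (sine_coeff u) x"
proof -
  let ?U = "sine_series (sine_coeff u)"
  have U: "set_integrable lebesgue unit_cube ?U"
    by (rule set_integrable_bounded[OF sine_series_borel(1)[OF c] bounded_unit_cube unit_cube_borel])
       (use sine_series_bounds(1)[OF c] in auto)
  have "AE x in lebesgue. x \<in> unit_cube \<longrightarrow> u x - ?U x = 0"
  proof (rule sine_basis_complete)
    show "set_integrable lebesgue unit_cube (\<lambda>x. u x - ?U x)" by (rule set_integral_diff(1)[OF u U])
    fix k :: "nat^'d" assume k: "k \<in> pos_multi_indices"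
    have "(LINT x:unit_cube|lebesgue. (u x - ?U x) * sine_basis k x) =
       (LINT x:unit_cube|lebesgue. u x * sine_basis k x) - (LINT x:unit_cube|lebesgue. ?U x * sine_basis k x)"
      unfolding left_diff_distrib
      by (rule set_integral_diff(2)[OF set_integrable_times_continuous[OF u continuous_on_sine_basis]
            set_integrable_times_continuous[OF U continuous_on_sine_basis]])
    also have "(LINT x:unit_cube|lebesgue. ?U x * sine_basis k x) = sine_coeff u k * (1/2) ^ CARD('d)"
      by (rule sine_coeff_sine_series[OF c k])
    also have "\<dots> = (LINT x:unit_cube|lebesgue. u x * sine_basis k x)"
      by (simp add: sine_coeff_def power_divide)
    finally show "(LINT x:unit_cube|lebesgue. (u x - ?U x) * sine_basis k x) = 0" by simp
  qed
  then show ?thesis by (auto elim: eventually_mono)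
qed

text \<open>
  This is where \<open>s \<ge> 3\<close> enters.  With \<open>p = \<pi>n \<ge> 3n\<close>, the quantity \<open>n(p + 2p\<^sup>2)\<close> is at most \<open>p\<^sup>2/3 + 2p\<^sup>3/3 \<le> p\<^sup>3\<close>; it is the
  total outer weight that a sine product of frequency \<open>n\<close> needs after division by the cut-off function.
\<close>

lemma barron_weight_bounds:
  fixes n s :: real
  assumes "1 \<le> n" "3 \<le> s"
  shows "1 + pi * n \<le> 1 + pi powr s * n powr s" "n \<le> 1 + pi powr s * n powr s"
    "n * (pi * n + 2 * (pi * n)\<^sup>2) \<le> 1 + pi powr s * n powr s"
proof -
  define p where "p = pi * n"
  have "3 * n \<le> p" using assms(1) pi_gt3 by (simp add: p_def mult_right_mono)
  then have p: "3 * n \<le> p" "1 \<le> p" using assms(1) by linarith+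
  have "p ^ 3 = p powr 3" using p by (simp add: powr_numeral)
  also have "\<dots> \<le> p powr s" using p assms(2) by (rule_tac powr_mono) auto
  also have "\<dots> = pi powr s * n powr s" using assms(1) by (simp add: p_def powr_mult)
  finally have W: "p ^ 3 \<le> pi powr s * n powr s" .
  have p1: "p \<le> p ^ 3" "p\<^sup>2 \<le> p ^ 3" using p power_increasing[of 1 3 p] power_increasing[of 2 3 p] by auto
  show "1 + pi * n \<le> 1 + pi powr s * n powr s" using p1(1) W by (simp add: p_def)
  show "n \<le> 1 + pi powr s * n powr s" using p(1) p1(1) W assms(1) by linarith
  have "n * (p + 2 * p\<^sup>2) \<le> (p / 3) * (p + 2 * p\<^sup>2)" using p by (intro mult_right_mono) auto
  also have "\<dots> = p\<^sup>2 / 3 + 2 * p ^ 3 / 3" by (simp add: power2_eq_square power3_eq_cube algebra_simps)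
  also have "\<dots> \<le> p ^ 3" using p1(2) by simp
  finally show "n * (pi * n + 2 * (pi * n)\<^sup>2) \<le> 1 + pi powr s * n powr s" using W by (simp add: p_def)
qed

lemma sine_majorant_le:
  assumes "3 \<le> s" "k \<in> pos_multi_indices"
  shows "sine_majorant c k \<le> (1 + pi powr s * freq k powr s) * \<bar>c k\<bar>"
  using mult_right_mono[OF barron_weight_bounds(1)[OF freq_ge_1[OF assms(2)] assms(1)], of "\<bar>c k\<bar>"]
  by (simp add: sine_majorant_def mult.commute)

lemma sine_majorant_summable:
  assumes "3 \<le> s" "(\<lambda>k. (1 + pi powr s * freq k powr s) * \<bar>c k\<bar>) summable_on pos_multi_indices"
  shows "sine_majorant c summable_on pos_multi_indices"
  by (rule summable_on_comparison_test[OF assms(2)]) (use sine_majorant_le[OF assms(1)] sine_majorant_nonneg in auto)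

section \<open>Multiplication by the cut-off function\<close>

text \<open>
  If \<open>h\<close> has value \<open>a\<close> and gradient \<open>g\<close> at \<open>x\<close>, this is the value and the gradient of \<open>\<phi>h\<close> at \<open>x\<close>.  The
  squared \<open>H\<^sup>1\<close>-norm of \<open>\<phi>h\<close> is the squared \<open>L\<^sup>2\<close>-norm of this vector-valued function, and linearity in
  \<open>(a, g)\<close> lets the sampling argument act on it.
\<close>

definition lift_cutoff :: "real \<Rightarrow> real^'d \<Rightarrow> real^'d \<Rightarrow> real \<times> (real^'d)" where
  "lift_cutoff a g x = (cutoff x * a, cutoff x *\<^sub>R g + a *\<^sub>R cutoff_grad x)"

lemma lift_cutoff_add: "lift_cutoff (a + b) (g + h) x = lift_cutoff a g x + lift_cutoff b h x"
  and lift_cutoff_diff: "lift_cutoff (a - b) (g - h) x = lift_cutoff a g x - lift_cutoff b h x"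
  and lift_cutoff_scaleR: "lift_cutoff (r * a) (r *\<^sub>R g) x = r *\<^sub>R lift_cutoff a g x"
  and lift_cutoff_0: "lift_cutoff 0 0 x = 0"
  by (simp_all add: lift_cutoff_def algebra_simps zero_prod_def)

lemma lift_cutoff_sum:
  "lift_cutoff (\<Sum>i\<in>I. a i) (\<Sum>i\<in>I. g i) x = (\<Sum>i\<in>I. lift_cutoff (a i) (g i) x)"
  by (induction I rule: infinite_finite_induct) (simp_all add: lift_cutoff_0 lift_cutoff_add)

lemma norm_lift_cutoff_le:
  assumes "x \<in> unit_cube"
  shows "norm (lift_cutoff a g x) \<le> (1 + pi) * \<bar>a\<bar> + norm g"
proof -
  note c = cutoff_bounds[OF assms]
  have "norm (lift_cutoff a g x) \<le> norm (cutoff x * a) + norm (cutoff x *\<^sub>R g + a *\<^sub>R cutoff_grad x)"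
    unfolding lift_cutoff_def by (rule norm_Pair_le)
  also have "norm (cutoff x *\<^sub>R g + a *\<^sub>R cutoff_grad x) \<le> cutoff x * norm g + \<bar>a\<bar> * norm (cutoff_grad x)"
    using norm_triangle_ineq[of "cutoff x *\<^sub>R g" "a *\<^sub>R cutoff_grad x"] c by simp
  also have "\<dots> \<le> 1 * norm g + \<bar>a\<bar> * pi"
    using c by (intro add_mono mult_mono) auto
  also have "norm (cutoff x * a) \<le> 1 * \<bar>a\<bar>"
    using c unfolding norm_mult by (intro mult_mono) auto
  finally show ?thesis by (simp add: algebra_simps)
qed

lemma lift_cutoff_has_derivative:
  assumes x: "x \<in> unit_cube" and h: "(h has_derivative (\<lambda>v. g \<bullet> v)) (at x)"
  shows "((\<lambda>x. cutoff x * h x) has_derivative (\<lambda>v. snd (lift_cutoff (h x) g x) \<bullet> v)) (at x)"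
  using has_derivative_mult[OF cutoff_has_derivative[OF x] h]
  by (simp add: lift_cutoff_def inner_add_left mult.commute)

text \<open>
  On the open cube both sides are the value and the gradient of the same function, once as a sine
  polynomial and once as the cut-off function times the quotient.
\<close>

lemma sine_polynomial_eq_lift_cutoff:
  fixes K :: "(nat^'d) set"
  assumes x: "x \<in> unit_cube"
    and g: "((\<lambda>x. \<Sum>k\<in>K. c k * sine_quotient k x) has_derivative (\<lambda>v. g \<bullet> v)) (at x)"
  shows "(\<Sum>k\<in>K. c k * sine_basis k x, \<Sum>k\<in>K. c k *\<^sub>R sine_grad k x) =
    lift_cutoff (\<Sum>k\<in>K. c k * sine_quotient k x) g x"
proof -
  let ?h = "\<lambda>x. \<Sum>k\<in>K. c k * sine_quotient k x" and ?p = "\<lambda>x. \<Sum>k\<in>K. c k * sine_basis k x"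
  have eq: "cutoff y * ?h y = ?p y" if "y \<in> unit_cube" for y
    by (simp add: sine_basis_eq_cutoff_times_quotient[OF that] sum_distrib_left mult_ac)
  have "(?p has_derivative (\<lambda>v. snd (lift_cutoff (?h x) g x) \<bullet> v)) (at x)"
    by (rule has_derivative_transform_within_open[OF lift_cutoff_has_derivative[OF x g] open_unit_cube x eq])
  from has_derivative_unique[OF sine_polynomial_has_derivative this]
  have "(\<Sum>k\<in>K. c k *\<^sub>R sine_grad k x) \<bullet> v = snd (lift_cutoff (?h x) g x) \<bullet> v" for v by (rule fun_cong)
  then have "(\<Sum>k\<in>K. c k *\<^sub>R sine_grad k x) = snd (lift_cutoff (?h x) g x)"
    using vector_eq_rdot by blast
  then show ?thesis using eq[OF x] by (simp add: lift_cutoff_def)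
qed

definition shallow_net :: "nat \<Rightarrow> real \<Rightarrow> (nat \<Rightarrow> real) \<Rightarrow> (nat \<Rightarrow> real^'d) \<Rightarrow> (nat \<Rightarrow> real) \<Rightarrow> real^'d \<Rightarrow> real" where
  "shallow_net m c \<gamma> w t x = c + (\<Sum>i<m. \<gamma> i * relu (w i \<bullet> x - t i))"

definition shallow_net_grad :: "nat \<Rightarrow> (nat \<Rightarrow> real) \<Rightarrow> (nat \<Rightarrow> real^'d) \<Rightarrow> (nat \<Rightarrow> real) \<Rightarrow> real^'d \<Rightarrow> real^'d" where
  "shallow_net_grad m \<gamma> w t x = (\<Sum>i<m. (\<gamma> i * heaviside (w i \<bullet> x - t i)) *\<^sub>R w i)"

lemma heaviside_bounds: "0 \<le> heaviside z" "heaviside z \<le> 1"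
  by (auto simp: heaviside_def)

lemma shallow_net_borel[measurable]: "shallow_net m c \<gamma> w t \<in> borel_measurable borel"
  unfolding shallow_net_def[abs_def] by measurable

lemma shallow_net_grad_borel[measurable]: "shallow_net_grad m \<gamma> w t \<in> borel_measurable borel"
  unfolding shallow_net_grad_def[abs_def] by measurable

lemma relu_unit_bounds:
  assumes "l1_norm w = 1" "\<bar>t\<bar> \<le> 1" "x \<in> unit_cube"
  shows "0 \<le> relu (w \<bullet> x - t)" "relu (w \<bullet> x - t) \<le> 2"
  using inner_unit_cube_bounds[OF assms(1,3)] assms(2) by (auto simp: relu_def)

lemma abs_relu_diff_le: "\<bar>relu a - relu b\<bar> \<le> \<bar>a - b\<bar>"
  by (auto simp: relu_def)

text \<open>
  The kinks lie on finitely many hyperplanes, which are null sets.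
\<close>

lemma AE_shallow_net_has_derivative:
  assumes "\<And>i. i < m \<Longrightarrow> l1_norm (w i) = 1"
  shows "AE x in lborel. (shallow_net m c \<gamma> w t has_derivative (\<lambda>v. shallow_net_grad m \<gamma> w t x \<bullet> v)) (at x)"
proof -
  have "AE x in lborel. \<forall>i\<in>{..<m}. w i \<bullet> x - t i \<noteq> 0"
  proof (rule AE_finite_allI)
    fix i assume "i \<in> {..<m}"
    then have "w i \<noteq> 0" using assms[of i] by (auto simp: l1_norm_def)
    then have "{x. w i \<bullet> x = t i} \<in> null_sets lebesgue"
      using negligible_hyperplane[of "w i" "t i"] by (simp add: negligible_iff_null_sets)
    moreover have "{x. w i \<bullet> x = t i} \<in> sets borel" by (intro borel_closed closed_hyperplane)
    ultimately have "{x. w i \<bullet> x = t i} \<in> null_sets lborel"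
      by (simp add: null_sets_completion_iff)
    from AE_not_in[OF this] show "AE x in lborel. w i \<bullet> x - t i \<noteq> 0" by eventually_elim simp
  qed simp
  then show ?thesis
  proof eventually_elim
    case (elim x)
    have "((\<lambda>x. relu (w i \<bullet> x - t i)) has_derivative (\<lambda>v. heaviside (w i \<bullet> x - t i) * (w i \<bullet> v))) (at x)" if "i < m" for i
    proof -
      have "((\<lambda>x. w i \<bullet> x - t i) has_derivative (\<lambda>v. w i \<bullet> v)) (at x)"
        by (auto intro!: derivative_eq_intros)
      moreover have "(relu has_real_derivative heaviside (w i \<bullet> x - t i)) (at (w i \<bullet> x - t i))"
        using elim that by (intro relu_has_derivative) auto
      ultimately show ?thesis
        using has_derivative_compose has_field_derivative_imp_has_derivative by blast
    qed
    then have "(shallow_net m c \<gamma> w t has_derivative (\<lambda>v. 0 + (\<Sum>i<m. \<gamma> i * (heaviside (w i \<bullet> x - t i) * (w i \<bullet> v))))) (at x)"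
      unfolding shallow_net_def[abs_def]
      by (intro has_derivative_add has_derivative_const has_derivative_sum has_derivative_mult_right) auto
    then show ?case
      by (simp add: shallow_net_grad_def inner_sum_left mult.assoc)
  qed
qed

lemma has_weak_gradient_cutoff_net:
  fixes w :: "nat \<Rightarrow> real^'d" and \<gamma> t :: "nat \<Rightarrow> real" and c :: real
  assumes w: "\<And>i. i < m \<Longrightarrow> l1_norm (w i) = 1" and t: "\<And>i. i < m \<Longrightarrow> \<bar>t i\<bar> \<le> 1"
  defines "v \<equiv> shallow_net m c \<gamma> w t" and "g \<equiv> shallow_net_grad m \<gamma> w t"
  shows "has_weak_gradient unit_cube (\<lambda>x. cutoff x * v x) (\<lambda>x. snd (lift_cutoff (v x) (g x) x))"
    "\<exists>C. \<forall>x\<in>unit_cube. norm (lift_cutoff (v x) (g x) x) \<le> C"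
proof -
  define S where "S = (\<Sum>i<m. \<bar>\<gamma> i\<bar>)"
  have vbd: "\<bar>v x\<bar> \<le> \<bar>c\<bar> + 2 * S" if x: "x \<in> unit_cube" for x
  proof -
    have "\<bar>\<Sum>i<m. \<gamma> i * relu (w i \<bullet> x - t i)\<bar> \<le> (\<Sum>i<m. \<bar>\<gamma> i\<bar> * 2)"
      using relu_unit_bounds[OF w t x]
      by (intro order_trans[OF sum_abs] sum_mono) (auto simp: abs_mult intro!: mult_left_mono)
    then show ?thesis unfolding v_def shallow_net_def S_def by (simp add: sum_distrib_right[symmetric])
  qed
  have gbd: "norm (g x) \<le> S" for x
    unfolding g_def shallow_net_grad_def S_def
  proof (rule sum_norm_le)
    fix i assume i: "i \<in> {..<m}"
    have "\<bar>\<gamma> i\<bar> * \<bar>heaviside (w i \<bullet> x - t i)\<bar> * norm (w i) \<le> \<bar>\<gamma> i\<bar> * 1 * 1"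
      using heaviside_bounds[of "w i \<bullet> x - t i"] norm_le_l1_norm[of "w i"] w[of i] i
      by (intro mult_mono) auto
    then show "norm ((\<gamma> i * heaviside (w i \<bullet> x - t i)) *\<^sub>R w i) \<le> \<bar>\<gamma> i\<bar>" by (simp add: abs_mult)
  qed
  have bd: "norm (lift_cutoff (v x) (g x) x) \<le> (1 + pi) * (\<bar>c\<bar> + 2 * S) + S" if x: "x \<in> unit_cube" for x
    using norm_lift_cutoff_le[OF x, of "v x" "g x"] mult_left_mono[OF vbd[OF x], of "1 + pi"] gbd[of x] by simp
  then show "\<exists>C. \<forall>x\<in>unit_cube. norm (lift_cutoff (v x) (g x) x) \<le> C" by blast
  have vlip: "\<bar>v x - v y\<bar> \<le> S * norm (x - y)" for x y
  proof -
    have "v x - v y = (\<Sum>i<m. \<gamma> i * (relu (w i \<bullet> x - t i) - relu (w i \<bullet> y - t i)))"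
      by (simp add: v_def shallow_net_def sum_subtractf right_diff_distrib)
    also have "\<bar>\<dots>\<bar> \<le> (\<Sum>i<m. \<bar>\<gamma> i\<bar> * norm (x - y))"
    proof (intro order_trans[OF sum_abs] sum_mono)
      fix i assume i: "i \<in> {..<m}"
      have "\<bar>relu (w i \<bullet> x - t i) - relu (w i \<bullet> y - t i)\<bar> \<le> \<bar>w i \<bullet> (x - y)\<bar>"
        using abs_relu_diff_le[of "w i \<bullet> x - t i" "w i \<bullet> y - t i"] by (simp add: inner_diff_right)
      also have "\<dots> \<le> norm (w i) * norm (x - y)" by (rule Cauchy_Schwarz_ineq2)
      also have "\<dots> \<le> 1 * norm (x - y)"
        using norm_le_l1_norm[of "w i"] w[of i] i by (intro mult_right_mono) auto
      finally show "\<bar>\<gamma> i * (relu (w i \<bullet> x - t i) - relu (w i \<bullet> y - t i))\<bar> \<le> \<bar>\<gamma> i\<bar> * norm (x - y)"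
        by (simp add: abs_mult mult_left_mono)
    qed
    finally show ?thesis by (simp add: S_def sum_distrib_right)
  qed
  have S0: "0 \<le> S" by (simp add: S_def sum_nonneg)
  have clip: "\<bar>cutoff x - cutoff y\<bar> \<le> pi * norm (x - y)" if "x \<in> unit_cube" "y \<in> unit_cube" for x y :: "real^'d"
    using lipschitz_onD[OF lipschitz_on_unit_cubeI[OF cutoff_has_derivative cutoff_bounds(3)] that]
    by (simp add: dist_norm)
  have lip: "(S + (\<bar>c\<bar> + 2 * S) * pi)-lipschitz_on unit_cube (\<lambda>x. cutoff x * v x)"
  proof (rule lipschitz_onI)
    fix x y :: "real^'d" assume xy: "x \<in> unit_cube" "y \<in> unit_cube"
    have "cutoff x * v x - cutoff y * v y = cutoff x * (v x - v y) + v y * (cutoff x - cutoff y)"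
      by (simp add: algebra_simps)
    also have "\<bar>\<dots>\<bar> \<le> \<bar>cutoff x\<bar> * \<bar>v x - v y\<bar> + \<bar>v y\<bar> * \<bar>cutoff x - cutoff y\<bar>"
      using abs_triangle_ineq by (simp add: abs_mult[symmetric])
    also have "\<dots> \<le> 1 * (S * norm (x - y)) + (\<bar>c\<bar> + 2 * S) * (pi * norm (x - y))"
      using cutoff_bounds[OF xy(1)] vlip[of x y] vbd[OF xy(2)] clip[OF xy] S0
      by (intro add_mono mult_mono) auto
    finally show "dist (cutoff x * v x) (cutoff y * v y) \<le> (S + (\<bar>c\<bar> + 2 * S) * pi) * dist x y"
      by (simp add: dist_norm algebra_simps)
  qed (use S0 in simp)
  show "has_weak_gradient unit_cube (\<lambda>x. cutoff x * v x) (\<lambda>x. snd (lift_cutoff (v x) (g x) x))"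
  proof (rule has_weak_gradient_unit_cubeI[OF _ _ _ _ lip])
    show "(\<lambda>x. cutoff x * v x) \<in> borel_measurable borel" unfolding v_def by measurable
    show "(\<lambda>x. snd (lift_cutoff (v x) (g x) x)) \<in> borel_measurable borel"
      unfolding v_def g_def lift_cutoff_def snd_conv by measurable
    fix x :: "real^'d" assume x: "x \<in> unit_cube"
    show "\<bar>cutoff x * v x\<bar> \<le> (1 + pi) * (\<bar>c\<bar> + 2 * S) + S"
      using norm_fst_le[of "cutoff x * v x" "snd (lift_cutoff (v x) (g x) x)"] bd[OF x] by (simp add: lift_cutoff_def)
    show "norm (snd (lift_cutoff (v x) (g x) x)) \<le> (1 + pi) * (\<bar>c\<bar> + 2 * S) + S"
      using norm_snd_le[of "snd (lift_cutoff (v x) (g x) x)" "cutoff x * v x"] bd[OF x] by (simp add: lift_cutoff_def)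
  next
    have "AE x in lborel. (v has_derivative (\<lambda>h. g x \<bullet> h)) (at x)"
      unfolding v_def g_def by (rule AE_shallow_net_has_derivative[OF w])
    then show "AE x in lborel. x \<in> unit_cube \<longrightarrow> ((\<lambda>x. cutoff x * v x) has_derivative (\<lambda>h. snd (lift_cutoff (v x) (g x) x) \<bullet> h)) (at x)"
      by eventually_elim (auto intro: lift_cutoff_has_derivative)
  qed
qed

text \<open>
  The pair \<open>E\<close> consists of the error and its weak gradient, with \<open>u\<close> replaced by its sine series; the
  replacement changes the error on a null set only.
\<close>

lemma H1_error_eq:
  fixes u :: "real^'d \<Rightarrow> real" and w :: "nat \<Rightarrow> real^'d" and \<gamma> t :: "nat \<Rightarrow> real" and b :: real
  assumes u: "set_integrable lebesgue unit_cube u"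
    and c: "sine_majorant (sine_coeff u) summable_on pos_multi_indices"
    and w: "\<And>i. i < m \<Longrightarrow> l1_norm (w i) = 1" and t: "\<And>i. i < m \<Longrightarrow> \<bar>t i\<bar> \<le> 1"
  defines "v \<equiv> shallow_net m b \<gamma> w t" and "g \<equiv> shallow_net_grad m \<gamma> w t"
  defines "E \<equiv> \<lambda>x. (sine_series (sine_coeff u) x, sine_series_grad (sine_coeff u) x) - lift_cutoff (v x) (g x) x"
  shows "(\<lambda>x. u x - cutoff x * v x) \<in> H1_space unit_cube"
    "H1_norm unit_cube (\<lambda>x. u x - cutoff x * v x) = sqrt (LINT x:unit_cube|lebesgue. (norm (E x))\<^sup>2)"
    "E \<in> borel_measurable borel"
    "\<exists>C. \<forall>x\<in>unit_cube. norm (E x) \<le> C"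
proof -
  let ?U = "sine_series (sine_coeff u)" and ?f = "\<lambda>x. u x - cutoff x * v x"
  define F where "F x = fst (E x)" for x
  define G where "G x = snd (E x)" for x
  note wk = has_weak_gradient_cutoff_net[where m = m and w = w and t = t and c = b and \<gamma> = \<gamma>, OF w t, folded v_def g_def]
  show E_meas[measurable]: "E \<in> borel_measurable borel"
    using sine_series_borel[OF c] unfolding E_def v_def g_def lift_cutoff_def by measurable
  have [measurable]: "F \<in> borel_measurable borel" "G \<in> borel_measurable borel"
    unfolding F_def[abs_def] G_def[abs_def]
    by (rule measurable_compose[OF E_meas], intro borel_measurable_continuous_onI continuous_intros)+
  have FG: "F = (\<lambda>x. ?U x - cutoff x * v x)" "G = (\<lambda>x. sine_series_grad (sine_coeff u) x - snd (lift_cutoff (v x) (g x) x))"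
    by (auto simp: F_def G_def E_def lift_cutoff_def)
  obtain C where C: "\<And>x. x \<in> unit_cube \<Longrightarrow> norm (lift_cutoff (v x) (g x) x) \<le> C" using wk(2) by blast
  define C' where "C' = 2 * infsum (sine_majorant (sine_coeff u)) pos_multi_indices + C"
  have E_bd: "norm (E x) \<le> C'" if x: "x \<in> unit_cube" for x
  proof -
    have "norm (E x) \<le> (norm (?U x) + norm (sine_series_grad (sine_coeff u) x)) + C"
      unfolding E_def by (intro order_trans[OF norm_triangle_ineq4] add_mono norm_Pair_le C x)
    then show ?thesis using sine_series_bounds[OF c, of x] by (simp add: C'_def)
  qed
  then show "\<exists>C. \<forall>x\<in>unit_cube. norm (E x) \<le> C" by blast
  have F_bd: "norm (F x) \<le> C'" and G_bd: "norm (G x) \<le> C'" if x: "x \<in> unit_cube" for x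
    using E_bd[OF x] norm_fst_le[of "F x" "G x"] norm_snd_le[of "G x" "F x"] by (simp_all add: F_def G_def)
  note int_bd = set_integrable_bounded[OF _ bounded_unit_cube unit_cube_borel]
  have intF: "set_integrable lebesgue unit_cube (\<lambda>x. (F x)\<^sup>2)"
  proof (rule int_bd[where C = "C'\<^sup>2"])
    fix x :: "real^'d" assume "x \<in> unit_cube"
    from power_mono[OF F_bd[OF this], of 2] show "norm ((F x)\<^sup>2) \<le> C'\<^sup>2" by simp
  qed measurable
  have intG: "set_integrable lebesgue unit_cube (\<lambda>x. (norm (G x))\<^sup>2)"
    using G_bd by (intro int_bd[where C = "C'\<^sup>2"]) (auto intro!: power_mono)
  have wkF: "has_weak_gradient unit_cube F G"
    unfolding FG by (rule has_weak_gradient_diff[OF unit_cube_borel has_weak_gradient_sine_series[OF c] wk(1)])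
  have "set_integrable lebesgue unit_cube (\<lambda>x. cutoff x * v x)"
  proof (rule int_bd)
    show "(\<lambda>x. cutoff x * v x) \<in> borel_measurable borel" unfolding v_def by measurable
    show "norm (cutoff x * v x) \<le> C" if "x \<in> unit_cube" for x
      using C[OF that] norm_fst_le[of "cutoff x * v x" "snd (lift_cutoff (v x) (g x) x)"] by (simp add: lift_cutoff_def)
  qed
  then have f: "set_integrable lebesgue unit_cube ?f" using u by (intro set_integral_diff(1))
  have AE: "AE x in lebesgue. x \<in> unit_cube \<longrightarrow> ?f x = F x"
    using AE_eq_sine_series[OF u c] by eventually_elim (simp add: FG)
  have wkf: "has_weak_gradient unit_cube ?f G"
    by (rule has_weak_gradient_cong_AE[OF unit_cube_borel wkF set_integrable_imp_locally_integrable[OF f] AE])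
  have sqG: "square_integrable unit_cube G"
    unfolding square_integrable_def
  proof
    show "set_borel_measurable lebesgue unit_cube G"
      unfolding set_borel_measurable_def by (intro measurable_completion) measurable
  qed (fact intG)
  have AE2: "AE x in lebesgue. indicator unit_cube x *\<^sub>R (F x)\<^sup>2 = indicator unit_cube x *\<^sub>R (?f x)\<^sup>2"
    using AE by eventually_elim (auto simp: indicator_def)
  have measF: "(\<lambda>x. indicator unit_cube x *\<^sub>R (F x)\<^sup>2) \<in> borel_measurable lebesgue"
    using intF unfolding set_integrable_def by (rule borel_measurable_integrable)
  note measf = borel_measurable_AE[OF measF AE2]
  have intf: "set_integrable lebesgue unit_cube (\<lambda>x. (?f x)\<^sup>2)"
    using intF unfolding set_integrable_def by (rule iffD1[OF integrable_cong_AE[OF measF measf AE2]])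
  have sqf: "square_integrable unit_cube ?f"
    unfolding square_integrable_def
  proof
    show "set_borel_measurable lebesgue unit_cube ?f"
      using f unfolding set_integrable_def set_borel_measurable_def by (rule borel_measurable_integrable)
    show "set_integrable lebesgue unit_cube (\<lambda>x. (norm (?f x))\<^sup>2)" using intf by simp
  qed
  show "?f \<in> H1_space unit_cube" unfolding H1_space_def using sqf sqG wkf by blast
  have "(LINT x:unit_cube|lebesgue. (?f x)\<^sup>2) = (LINT x:unit_cube|lebesgue. (F x)\<^sup>2)"
    unfolding set_lebesgue_integral_def by (rule integral_cong_AE[OF measF measf AE2, symmetric])
  then have "(LINT x:unit_cube|lebesgue. (?f x)\<^sup>2) + (LINT x:unit_cube|lebesgue. (norm (G x))\<^sup>2) =
      (LINT x:unit_cube|lebesgue. (F x)\<^sup>2 + (norm (G x))\<^sup>2)"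
    using set_integral_add(2)[OF intF intG] by simp
  also have "(\<lambda>x. (F x)\<^sup>2 + (norm (G x))\<^sup>2) = (\<lambda>x. (norm (E x))\<^sup>2)"
    by (simp add: F_def G_def norm_prod_def)
  finally show "H1_norm unit_cube ?f = sqrt (LINT x:unit_cube|lebesgue. (norm (E x))\<^sup>2)"
    unfolding H1_norm_eq[OF open_unit_cube wkf sqG] by (simp only:)
qed

section \<open>The approximation theorem\<close>

text \<open>
  The atoms are the single units with sign, scaled by the mass bound \<open>M\<close>, and the zero function; each
  has norm at most \<open>11M\<close> after multiplication by the cut-off function.
\<close>

lemma maurey_for_networks:
  fixes N :: "(real \<times> (real^'d) \<times> real) list"
  assumes adm: "admissible N" and mass: "mass N \<le> M" and M: "M > 0" and m: "m > 0"
  shows "\<exists>\<gamma> w t. (\<forall>i<m. l1_norm (w i) = 1 \<and> \<bar>t i\<bar> \<le> 1) \<and> (\<Sum>i<m. \<bar>\<gamma> i\<bar>) \<le> M \<and>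
    (LINT x:unit_cube|lebesgue. (norm (lift_cutoff (c + net N x) (net_grad N x) x -
        lift_cutoff (shallow_net m c \<gamma> w t x) (shallow_net_grad m \<gamma> w t x) x))\<^sup>2) \<le> (11 * M)\<^sup>2 / real m"
proof -
  define n where "n = length N"
  define a where "a j = fst (N ! j)" for j
  define \<omega> where "\<omega> j = fst (snd (N ! j))" for j
  define \<tau> where "\<tau> j = snd (snd (N ! j))" for j
  have adm': "l1_norm (\<omega> j) = 1" "\<bar>\<tau> j\<bar> \<le> 1" if "j < n" for j
  proof -
    have "N ! j \<in> set N" using that by (simp add: n_def)
    from bspec[OF adm[unfolded admissible_def] this]
    show "l1_norm (\<omega> j) = 1" "\<bar>\<tau> j\<bar> \<le> 1" by (simp_all add: \<omega>_def \<tau>_def case_prod_unfold)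
  qed
  define T where "T w t x = lift_cutoff (relu (w \<bullet> x - t)) (heaviside (w \<bullet> x - t) *\<^sub>R w) x" for w :: "real^'d" and t x
  have T_bd: "norm (T (\<omega> j) (\<tau> j) x) \<le> 11" if "j < n" "x \<in> unit_cube" for j x
  proof -
    note r = relu_unit_bounds[OF adm'[OF that(1)] that(2)]
    have "norm (T (\<omega> j) (\<tau> j) x) \<le> (1 + pi) * \<bar>relu (\<omega> j \<bullet> x - \<tau> j)\<bar> + norm (heaviside (\<omega> j \<bullet> x - \<tau> j) *\<^sub>R \<omega> j)"
      unfolding T_def by (rule norm_lift_cutoff_le[OF that(2)])
    also have "(1 + pi) * \<bar>relu (\<omega> j \<bullet> x - \<tau> j)\<bar> \<le> 5 * 2"
      using r pi_less_4 by (intro mult_mono) auto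
    also have "norm (heaviside (\<omega> j \<bullet> x - \<tau> j) *\<^sub>R \<omega> j) \<le> 1 * 1"
      using heaviside_bounds[of "\<omega> j \<bullet> x - \<tau> j"] norm_le_l1_norm[of "\<omega> j"] adm'(1)[OF that(1)]
      unfolding norm_scaleR by (intro mult_mono) auto
    finally show ?thesis by simp
  qed
  have T_meas: "T w t \<in> borel_measurable borel" for w t
    unfolding T_def[abs_def] lift_cutoff_def by measurable
  define f where "f x = (\<Sum>j<n. a j *\<^sub>R T (\<omega> j) (\<tau> j) x)" for x
  have net: "lift_cutoff (net N x) (net_grad N x) x = f x" for x
  proof -
    have "net N x = (\<Sum>j<n. a j * relu (\<omega> j \<bullet> x - \<tau> j))"
      by (simp add: net_def sum_list_sum_nth a_def \<omega>_def \<tau>_def n_def case_prod_unfold atLeast0LessThan)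
    moreover have "net_grad N x = (\<Sum>j<n. a j *\<^sub>R (heaviside (\<omega> j \<bullet> x - \<tau> j) *\<^sub>R \<omega> j))"
      by (simp add: net_grad_def sum_list_sum_nth a_def \<omega>_def \<tau>_def n_def case_prod_unfold atLeast0LessThan)
    ultimately show ?thesis
      by (simp only: lift_cutoff_sum lift_cutoff_scaleR f_def T_def)
  qed
  have mass_eq: "mass N = (\<Sum>j<n. \<bar>a j\<bar>)"
    by (simp add: mass_def sum_list_sum_nth a_def n_def case_prod_unfold atLeast0LessThan)
  \<comment> \<open>Index \<open>n\<close> stands for the zero atom, which takes the weight that the mass leaves over.\<close>
  define l where "l j = (if j < n then \<bar>a j\<bar> / M else 1 - mass N / M)" for j
  define g where "g j x = (if j < n then (M * sgn (a j)) *\<^sub>R T (\<omega> j) (\<tau> j) x else 0)" for j x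
  have upto: "{..n} = insert n {..<n}" by auto
  have l_sum: "(\<Sum>j\<le>n. l j) = 1"
    unfolding upto by (simp add: l_def mass_eq sum_divide_distrib[symmetric])
  have f_eq: "f x = (\<Sum>j\<le>n. l j *\<^sub>R g j x)" for x
  proof -
    have "(\<Sum>j\<le>n. l j *\<^sub>R g j x) = (\<Sum>j<n. l j *\<^sub>R g j x)"
      unfolding upto by (simp add: g_def)
    also have "\<dots> = f x"
      unfolding f_def
    proof (rule sum.cong[OF refl])
      fix j assume "j \<in> {..<n}"
      moreover have "\<bar>a j\<bar> / M * (M * sgn (a j)) = a j" using M by (simp add: abs_mult_sgn)
      ultimately show "l j *\<^sub>R g j x = a j *\<^sub>R T (\<omega> j) (\<tau> j) x" by (simp add: l_def g_def)
    qed
    finally show ?thesis by simp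
  qed
  have "\<exists>\<sigma>. (\<forall>i<m. \<sigma> i \<in> {..n}) \<and>
     (LINT x|lebesgue_on unit_cube. (norm (\<Sum>i<m. f x - g (\<sigma> i) x))\<^sup>2) \<le> real m * (11 * M)\<^sup>2"
  proof (rule maurey_sampling[OF lebesgue_on_unit_cube(1) _ _ _ l_sum])
    show "measure (lebesgue_on (unit_cube :: (real^'d) set)) (space (lebesgue_on unit_cube)) \<le> 1"
      using lebesgue_on_unit_cube(2)[where 'd = 'd] by simp
    show "0 \<le> l j" for j using M mass by (simp add: l_def)
    have "g j \<in> borel_measurable borel" for j
      using T_meas[of "\<omega> j" "\<tau> j"] unfolding g_def[abs_def] by (cases "j < n") auto
    then show "g j \<in> borel_measurable (lebesgue_on unit_cube)" for j
      by (intro measurable_restrict_space1 measurable_completion) simp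
    show "norm (g j x) \<le> 11 * M" if "x \<in> space (lebesgue_on unit_cube)" for j x
    proof (cases "j < n")
      case True
      have "norm (g j x) = \<bar>sgn (a j)\<bar> * M * norm (T (\<omega> j) (\<tau> j) x)"
        using True M by (simp add: g_def abs_mult)
      also have "\<dots> \<le> 1 * M * 11"
        using T_bd[OF True, of x] that M by (intro mult_mono) (auto simp: sgn_if)
      finally show ?thesis by simp
    qed (use M in \<open>simp add: g_def\<close>)
  qed (use f_eq in auto)
  then obtain \<sigma> where \<sigma>: "(LINT x|lebesgue_on unit_cube. (norm (\<Sum>i<m. f x - g (\<sigma> i) x))\<^sup>2) \<le> real m * (11 * M)\<^sup>2"
    by blast
  define \<gamma> where "\<gamma> i = (if \<sigma> i < n then M * sgn (a (\<sigma> i)) / real m else 0)" for i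
  \<comment> \<open>Where the zero atom was drawn the outer weight is \<open>0\<close>; any admissible direction and threshold
    serve there.\<close>
  define w where "w i = (if \<sigma> i < n then \<omega> (\<sigma> i) else axis undefined 1)" for i
  define t where "t i = (if \<sigma> i < n then \<tau> (\<sigma> i) else 0)" for i
  have "l1_norm (w i) = 1 \<and> \<bar>t i\<bar> \<le> 1" for i
    using adm' by (auto simp: w_def t_def l1_norm_axis)
  moreover have "(\<Sum>i<m. \<bar>\<gamma> i\<bar>) \<le> M"
  proof -
    have "(\<Sum>i<m. \<bar>\<gamma> i\<bar>) \<le> (\<Sum>i<m. M / real m)"
      using M by (intro sum_mono) (auto simp: \<gamma>_def abs_mult sgn_if)
    then show ?thesis using m by simp
  qed
  moreover have "(LINT x:unit_cube|lebesgue. (norm (lift_cutoff (c + net N x) (net_grad N x) x -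
        lift_cutoff (shallow_net m c \<gamma> w t x) (shallow_net_grad m \<gamma> w t x) x))\<^sup>2) \<le> (11 * M)\<^sup>2 / real m"
  proof -
    have gT: "\<gamma> i *\<^sub>R T (w i) (t i) x = (1 / real m) *\<^sub>R g (\<sigma> i) x" for i x
      by (simp add: \<gamma>_def w_def t_def g_def)
    have "lift_cutoff (c + net N x) (net_grad N x) x -
        lift_cutoff (shallow_net m c \<gamma> w t x) (shallow_net_grad m \<gamma> w t x) x =
        (1 / real m) *\<^sub>R (\<Sum>i<m. f x - g (\<sigma> i) x)" for x
    proof -
      have "lift_cutoff (c + net N x) (net_grad N x) x -
        lift_cutoff (shallow_net m c \<gamma> w t x) (shallow_net_grad m \<gamma> w t x) x =
        f x - lift_cutoff (\<Sum>i<m. \<gamma> i * relu (w i \<bullet> x - t i)) (\<Sum>i<m. \<gamma> i *\<^sub>R (heaviside (w i \<bullet> x - t i) *\<^sub>R w i)) x"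
        unfolding lift_cutoff_diff[symmetric] net[symmetric] by (simp add: shallow_net_def shallow_net_grad_def)
      also have "\<dots> = f x - (\<Sum>i<m. (1 / real m) *\<^sub>R g (\<sigma> i) x)"
        by (simp only: lift_cutoff_sum lift_cutoff_scaleR T_def[symmetric] gT)
      also have "\<dots> = (1 / real m) *\<^sub>R (\<Sum>i<m. f x - g (\<sigma> i) x)"
        using m by (simp add: sum_subtractf scaleR_diff_right scaleR_sum_right sum_constant_scaleR)
      finally show ?thesis .
    qed
    then have "(LINT x:unit_cube|lebesgue. (norm (lift_cutoff (c + net N x) (net_grad N x) x -
        lift_cutoff (shallow_net m c \<gamma> w t x) (shallow_net_grad m \<gamma> w t x) x))\<^sup>2) =
      (LINT x|lebesgue_on unit_cube. (1 / real m)\<^sup>2 * (norm (\<Sum>i<m. f x - g (\<sigma> i) x))\<^sup>2)"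
      unfolding set_integral_unit_cube_eq by (simp only: norm_scaleR power_mult_distrib power2_abs)
    also have "\<dots> = (1 / real m)\<^sup>2 * (LINT x|lebesgue_on unit_cube. (norm (\<Sum>i<m. f x - g (\<sigma> i) x))\<^sup>2)"
      by (rule integral_mult_right_zero)
    also have "\<dots> \<le> (1 / real m)\<^sup>2 * (real m * (11 * M)\<^sup>2)"
      by (intro mult_left_mono \<sigma>) simp
    also have "\<dots> = (11 * M)\<^sup>2 / real m" using m by (simp add: power2_eq_square)
    finally show ?thesis .
  qed
  ultimately show ?thesis by blast
qed

text \<open>
  Truncating the series costs \<open>\<delta>\<close> in value and \<open>\<delta>\<close> in gradient, and replacing the quotient of the
  truncated series by a network costs at most \<open>(1 + \<pi>)\<delta> + \<delta>\<close>.
\<close>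

lemma approximate_sine_series_by_net:
  fixes c :: "nat^'d \<Rightarrow> real" and s :: real
  defines "W \<equiv> \<lambda>k. (1 + pi powr s * freq k powr s) * \<bar>c k\<bar>"
  assumes s: "3 \<le> s" and W: "W summable_on pos_multi_indices" and \<delta>: "\<delta> > 0"
  shows "\<exists>b N. \<bar>b\<bar> \<le> infsum W pos_multi_indices \<and> admissible N \<and> mass N \<le> infsum W pos_multi_indices \<and>
    (\<forall>x\<in>unit_cube. norm ((sine_series c x, sine_series_grad c x) - lift_cutoff (b + net N x) (net_grad N x) x) \<le> 8 * \<delta>)"
proof -
  let ?P = "pos_multi_indices :: (nat^'d) set"
  have W0: "0 \<le> W k" for k by (simp add: W_def add_nonneg_nonneg)
  note wb = barron_weight_bounds[OF freq_ge_1 s]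
  have maj: "sine_majorant c summable_on ?P"
    using s W unfolding W_def by (rule sine_majorant_summable)
  obtain K where K: "finite K" "K \<subseteq> ?P"
    "\<And>x. \<bar>sine_series c x - (\<Sum>k\<in>K. c k * sine_basis k x)\<bar> \<le> \<delta>"
    "\<And>x. norm (sine_series_grad c x - (\<Sum>k\<in>K. c k *\<^sub>R sine_grad k x)) \<le> \<delta>"
    using sine_series_uniform_approx[OF maj \<delta> finite.emptyI empty_subsetI] by auto
  let ?h = "\<lambda>x. \<Sum>k\<in>K. c k * sine_quotient k x"
  have W_sum: "(\<Sum>k\<in>K. W k) \<le> infsum W ?P"
    by (rule finite_sum_le_infsum[OF W K(1,2) W0])
  have "approximable (\<Sum>k\<in>K. \<bar>c k\<bar> * (freq k * (pi * freq k + 2 * (pi * freq k)\<^sup>2))) (\<Sum>k\<in>K. \<bar>c k\<bar> * freq k) ?h"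
    by (intro approximable_sum approximable_cmult approximable_sine_quotient K(1))
  moreover have "(\<Sum>k\<in>K. \<bar>c k\<bar> * (freq k * (pi * freq k + 2 * (pi * freq k)\<^sup>2))) \<le> (\<Sum>k\<in>K. W k)"
    using K(2) unfolding W_def mult.commute[of _ "\<bar>c _\<bar>"] by (intro sum_mono mult_left_mono wb(3)) auto
  moreover have "(\<Sum>k\<in>K. \<bar>c k\<bar> * freq k) \<le> (\<Sum>k\<in>K. W k)"
    using K(2) unfolding W_def mult.commute[of _ "\<bar>c _\<bar>"] by (intro sum_mono mult_left_mono wb(2)) auto
  ultimately have "approximable (infsum W ?P) (infsum W ?P) ?h"
    using W_sum by (meson approximable_mono order_trans)
  from approximableE[OF this \<delta>] obtain b N
    where N: "\<bar>b\<bar> \<le> infsum W ?P" "admissible N" "mass N \<le> infsum W ?P" "C1_close \<delta> b N ?h" .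
  have "norm ((sine_series c x, sine_series_grad c x) - lift_cutoff (b + net N x) (net_grad N x) x) \<le> 8 * \<delta>"
    if x: "x \<in> unit_cube" for x
  proof -
    obtain g where h: "\<bar>?h x - (b + net N x)\<bar> \<le> \<delta>"
      and g: "(?h has_derivative (\<lambda>v. g \<bullet> v)) (at x)" "norm (g - net_grad N x) \<le> \<delta>"
      using N(4) x unfolding C1_close_def by blast
    have "(sine_series c x, sine_series_grad c x) - lift_cutoff (b + net N x) (net_grad N x) x =
      ((sine_series c x, sine_series_grad c x) - (\<Sum>k\<in>K. c k * sine_basis k x, \<Sum>k\<in>K. c k *\<^sub>R sine_grad k x)) +
      lift_cutoff (?h x - (b + net N x)) (g - net_grad N x) x"
      unfolding sine_polynomial_eq_lift_cutoff[OF x g(1)] lift_cutoff_diff by simp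
    also have "norm \<dots> \<le> (\<delta> + \<delta>) + ((1 + pi) * \<delta> + \<delta>)"
    proof (rule norm_triangle_mono)
      show "norm ((sine_series c x, sine_series_grad c x) - (\<Sum>k\<in>K. c k * sine_basis k x, \<Sum>k\<in>K. c k *\<^sub>R sine_grad k x)) \<le> \<delta> + \<delta>"
        unfolding diff_Pair using K(3,4)[of x] by (intro order_trans[OF norm_Pair_le] add_mono) auto
      show "norm (lift_cutoff (?h x - (b + net N x)) (g - net_grad N x) x) \<le> (1 + pi) * \<delta> + \<delta>"
        using g(2) h pi_gt_zero
        by (intro order_trans[OF norm_lift_cutoff_le[OF x]] add_mono mult_left_mono) auto
    qed
    also have "\<dots> \<le> 8 * \<delta>" using mult_right_mono[of pi 4 \<delta>] pi_less_4 \<delta> by (simp add: distrib_right)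
    finally show ?thesis .
  qed
  with N(1-3) show ?thesis by blast
qed

lemma shallow_net_in_networks:
  assumes "\<bar>c\<bar> \<le> B" "\<forall>i<m. l1_norm (w i) = 1 \<and> \<bar>t i\<bar> \<le> 1" "(\<Sum>i<m. \<bar>\<gamma> i\<bar>) \<le> 4 * B"
  shows "shallow_net m c \<gamma> w t \<in> networks relu m B"
  unfolding networks_def shallow_net_def[abs_def] using assms by blast

text \<open>
  A network of width \<open>m\<close> is sampled from a wide network that is within \<open>I/\<surd>m\<close> of the series, where \<open>I\<close> is
  the sum of the weights \<open>W\<close>.  If \<open>I = 0\<close> no such accuracy is available, but then the series is zero.
\<close>

lemma sine_series_approximation:
  fixes c :: "nat^'d \<Rightarrow> real" and s :: real
  defines "W \<equiv> \<lambda>k. (1 + pi powr s * freq k powr s) * \<bar>c k\<bar>"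
  assumes s: "3 \<le> s" and W: "W summable_on pos_multi_indices" and m: "0 < m"
  shows "\<exists>b \<gamma> w t. \<bar>b\<bar> \<le> infsum W pos_multi_indices \<and> (\<forall>i<m. l1_norm (w i) = 1 \<and> \<bar>t i\<bar> \<le> 1) \<and>
    (\<Sum>i<m. \<bar>\<gamma> i\<bar>) \<le> infsum W pos_multi_indices \<and>
    (LINT x:unit_cube|lebesgue. (norm ((sine_series c x, sine_series_grad c x) -
        lift_cutoff (shallow_net m b \<gamma> w t x) (shallow_net_grad m \<gamma> w t x) x))\<^sup>2)
      \<le> 244 * (infsum W pos_multi_indices)\<^sup>2 / real m"
proof -
  let ?P = "pos_multi_indices :: (nat^'d) set"
  define I where "I = infsum W ?P"
  have I0: "0 \<le> I" unfolding I_def by (rule infsum_nonneg) (simp add: W_def add_nonneg_nonneg)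
  have maj: "sine_majorant c summable_on ?P"
    using s W unfolding W_def by (rule sine_majorant_summable)
  note UG_borel = sine_series_borel[OF maj]
  define UG where "UG x = (sine_series c x, sine_series_grad c x)" for x
  have UG_meas: "UG \<in> borel_measurable borel"
    using UG_borel unfolding UG_def[abs_def] by measurable
  have maj_I: "infsum (sine_majorant c) ?P \<le> I"
    unfolding I_def W_def by (rule infsum_mono[OF maj W[unfolded W_def] sine_majorant_le[OF s]])
  have UG_bd: "norm (UG x) \<le> 2 * I" for x
    unfolding UG_def using sine_series_bounds[OF maj, of x] maj_I
    by (intro order_trans[OF norm_Pair_le]) simp
  show ?thesis
  proof (cases "I = 0")
    case True
    let ?w = "\<lambda>_::nat. axis undefined 1 :: real^'d" and ?z = "\<lambda>_::nat. 0::real"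
    have "norm (UG x - lift_cutoff (shallow_net m 0 ?z ?w ?z x) (shallow_net_grad m ?z ?w ?z x) x) = 0" for x
      using UG_bd[of x] True by (simp add: shallow_net_def shallow_net_grad_def lift_cutoff_0)
    then show ?thesis
      unfolding UG_def I_def[symmetric] True
      by (intro exI[of _ 0] exI[of _ ?z] exI[of _ ?w]) (simp add: l1_norm_axis)
  next
    case False
    with I0 have I: "I > 0" by simp
    define \<eta> where "\<eta> = I / sqrt (real m)"
    have \<eta>: "\<eta> > 0" using I m by (simp add: \<eta>_def)
    have \<eta>2: "\<eta>\<^sup>2 = I\<^sup>2 / real m" using m by (simp add: \<eta>_def power_divide)
    \<comment> \<open>Accuracy \<open>\<eta>/8\<close> in the approximation lemma yields total error \<open>\<eta>\<close>.\<close>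
    from \<eta> have "\<eta> / 8 > 0" by simp
    from approximate_sine_series_by_net[OF s W[unfolded W_def] this, folded W_def]
    obtain b N where N: "\<bar>b\<bar> \<le> I" "admissible N" "mass N \<le> I"
      "\<And>x. x \<in> unit_cube \<Longrightarrow> norm (UG x - lift_cutoff (b + net N x) (net_grad N x) x) \<le> \<eta>"
      unfolding I_def UG_def by auto
    obtain \<gamma> w t where net: "\<forall>i<m. l1_norm (w i) = 1 \<and> \<bar>t i\<bar> \<le> 1" "(\<Sum>i<m. \<bar>\<gamma> i\<bar>) \<le> I"
      "(LINT x:unit_cube|lebesgue. (norm (lift_cutoff (b + net N x) (net_grad N x) x -
        lift_cutoff (shallow_net m b \<gamma> w t x) (shallow_net_grad m \<gamma> w t x) x))\<^sup>2) \<le> (11 * I)\<^sup>2 / real m"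
      using maurey_for_networks[OF N(2,3) I m, of b] by blast
    define L where "L x = lift_cutoff (shallow_net m b \<gamma> w t x) (shallow_net_grad m \<gamma> w t x) x" for x
    define A where "A x = lift_cutoff (b + net N x) (net_grad N x) x" for x
    have L_meas: "L \<in> borel_measurable borel" and A_meas: "A \<in> borel_measurable borel"
      unfolding L_def[abs_def] A_def[abs_def] lift_cutoff_def by measurable
    have wt: "\<And>i. i < m \<Longrightarrow> l1_norm (w i) = 1" "\<And>i. i < m \<Longrightarrow> \<bar>t i\<bar> \<le> 1" using net(1) by auto
    obtain C where C: "\<And>x. x \<in> unit_cube \<Longrightarrow> norm (L x) \<le> C"
      using has_weak_gradient_cutoff_net(2)[where m = m and w = w and t = t and c = b and \<gamma> = \<gamma>, OF wt]
      unfolding L_def by blast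
    have A_bd: "norm (A x) \<le> 2 * I + \<eta>" if "x \<in> unit_cube" for x
    proof -
      have "norm (A x) \<le> norm (UG x) + norm (UG x - A x)"
        using norm_triangle_ineq4[of "UG x" "UG x - A x"] by simp
      then show ?thesis using UG_bd[of x] N(4)[OF that] by (simp add: A_def)
    qed
    have int: "set_integrable lebesgue unit_cube (\<lambda>x. (norm (f x - L x))\<^sup>2)"
      if f: "f \<in> borel_measurable borel" "\<And>x. x \<in> unit_cube \<Longrightarrow> norm (f x) \<le> C'" for f and C' :: real
    proof (rule set_integrable_bounded[OF _ bounded_unit_cube unit_cube_borel])
      show "(\<lambda>x. (norm (f x - L x))\<^sup>2) \<in> borel_measurable borel"
        using f(1) L_meas by measurable
      fix x :: "real^'d" assume x: "x \<in> unit_cube"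
      have "norm (f x - L x) \<le> C' + C"
        by (intro order_trans[OF norm_triangle_ineq4] add_mono f(2) C x)
      from power_mono[OF this, of 2] show "norm ((norm (f x - L x))\<^sup>2) \<le> (C' + C)\<^sup>2" by simp
    qed
    have int_const: "set_integrable lebesgue unit_cube (\<lambda>x::real^'d. 2 * \<eta>\<^sup>2)"
      by (rule set_integrable_bounded[OF _ bounded_unit_cube unit_cube_borel order_refl]) simp
    have intA: "set_integrable lebesgue unit_cube (\<lambda>x. 2 * (norm (A x - L x))\<^sup>2)"
      by (rule set_integrable_mult_right) (rule int[OF A_meas A_bd])
    have "(LINT x:unit_cube|lebesgue. (norm (UG x - L x))\<^sup>2) \<le>
        (LINT x:unit_cube|lebesgue. 2 * \<eta>\<^sup>2 + 2 * (norm (A x - L x))\<^sup>2)"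
    proof (rule set_integral_mono[OF int[OF UG_meas UG_bd] set_integral_add(1)[OF int_const intA]])
      fix x :: "real^'d" assume x: "x \<in> unit_cube"
      have "norm (UG x - L x) \<le> norm (UG x - A x) + norm (A x - L x)"
        using norm_triangle_ineq[of "UG x - A x" "A x - L x"] by simp
      also have "\<dots> \<le> \<eta> + norm (A x - L x)" using N(4)[OF x] by (simp add: A_def)
      finally have "(norm (UG x - L x))\<^sup>2 \<le> (\<eta> + norm (A x - L x))\<^sup>2" by (rule power_mono) simp
      also have "\<dots> \<le> 2 * \<eta>\<^sup>2 + 2 * (norm (A x - L x))\<^sup>2"
        using zero_le_power2[of "\<eta> - norm (A x - L x)"] by (simp add: power2_sum power2_diff)
      finally show "(norm (UG x - L x))\<^sup>2 \<le> 2 * \<eta>\<^sup>2 + 2 * (norm (A x - L x))\<^sup>2" .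
    qed
    also have "\<dots> = (LINT x:(unit_cube :: (real^'d) set)|lebesgue. 2 * \<eta>\<^sup>2) + (LINT x:unit_cube|lebesgue. 2 * (norm (A x - L x))\<^sup>2)"
      by (rule set_integral_add(2)[OF int_const intA])
    also have "(LINT x:unit_cube|lebesgue. 2 * (norm (A x - L x))\<^sup>2) = 2 * (LINT x:unit_cube|lebesgue. (norm (A x - L x))\<^sup>2)"
      by (rule set_integral_mult_right)
    also have "(LINT x:(unit_cube :: (real^'d) set)|lebesgue. 2 * \<eta>\<^sup>2) = 2 * \<eta>\<^sup>2"
      using measure_unit_cube[where 'd = 'd] emeasure_unit_cube[where 'd = 'd]
      by (subst set_integral_const) auto
    also have "(LINT x:unit_cube|lebesgue. (norm (A x - L x))\<^sup>2) \<le> (11 * I)\<^sup>2 / real m"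
      using net(3) unfolding A_def L_def .
    also have "2 * \<eta>\<^sup>2 + 2 * ((11 * I)\<^sup>2 / real m) = 244 * I\<^sup>2 / real m"
      unfolding \<eta>2 by (simp add: power_mult_distrib)
    finally show ?thesis
      using N(1) net(1,2) unfolding UG_def L_def I_def by (intro exI conjI) auto
  qed
qed

theorem theorem3:
  fixes u :: "real ^ 'd \<Rightarrow> real" and s B :: real and m :: nat
  assumes "3 \<le> s"
    and "u \<in> barron_space s"
    and "B = (1 + 2 * real CARD('d) / (pi * s)) * barron_norm s u"
    and "0 < m"
  shows "\<exists>v\<in>networks relu m B.
           (\<lambda>x. u x - cutoff x * v x) \<in> H1_space unit_cube \<and>
           H1_norm unit_cube (\<lambda>x. u x - cutoff x * v x) \<le> 28 * B / sqrt (real m)"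
proof -
  let ?c = "sine_coeff u" and ?P = "pos_multi_indices :: (nat^'d) set"
  define W where "W k = (1 + pi powr s * freq k powr s) * \<bar>?c k\<bar>" for k
  have W_eq: "barron_term s u = W"
    by (rule ext) (simp add: barron_term_def W_def freq_def)
  have u: "set_integrable lebesgue unit_cube u" and W: "W summable_on ?P"
    using assms(2) by (simp_all add: barron_space_def W_eq)
  have N: "barron_norm s u = infsum W ?P" by (simp add: barron_norm_def W_eq)
  have W0: "0 \<le> W k" for k by (simp add: W_def add_nonneg_nonneg)
  have N0: "0 \<le> infsum W ?P" by (rule infsum_nonneg) (rule W0)
  have NB: "infsum W ?P \<le> B"
    using mult_right_mono[of 1 "1 + 2 * real CARD('d) / (pi * s)" "infsum W ?P"] N0 assms(1)
    by (simp add: assms(3) N)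
  have maj: "sine_majorant ?c summable_on ?P"
    by (rule sine_majorant_summable[OF assms(1) W[unfolded W_def]])
  from sine_series_approximation[OF assms(1) W[unfolded W_def] assms(4), folded W_def]
  obtain b \<gamma> w t where net: "\<bar>b\<bar> \<le> infsum W ?P" "\<forall>i<m. l1_norm (w i) = 1 \<and> \<bar>t i\<bar> \<le> 1"
      "(\<Sum>i<m. \<bar>\<gamma> i\<bar>) \<le> infsum W ?P"
      "(LINT x:unit_cube|lebesgue. (norm ((sine_series ?c x, sine_series_grad ?c x) -
        lift_cutoff (shallow_net m b \<gamma> w t x) (shallow_net_grad m \<gamma> w t x) x))\<^sup>2) \<le> 244 * (infsum W ?P)\<^sup>2 / real m"
    by blast
  let ?v = "shallow_net m b \<gamma> w t"
  have v: "?v \<in> networks relu m B"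
    using net(1-3) NB N0 by (intro shallow_net_in_networks) auto
  have wt: "\<And>i. i < m \<Longrightarrow> l1_norm (w i) = 1" "\<And>i. i < m \<Longrightarrow> \<bar>t i\<bar> \<le> 1" using net(2) by auto
  have H1: "(\<lambda>x. u x - cutoff x * ?v x) \<in> H1_space unit_cube"
    by (rule H1_error_eq(1)[OF u maj wt])
  have H1_norm: "H1_norm unit_cube (\<lambda>x. u x - cutoff x * ?v x) =
      sqrt (LINT x:unit_cube|lebesgue. (norm ((sine_series ?c x, sine_series_grad ?c x) -
        lift_cutoff (?v x) (shallow_net_grad m \<gamma> w t x) x))\<^sup>2)"
    by (rule H1_error_eq(2)[OF u maj wt])
  \<comment> \<open>\<open>244 \<le> 784 = 28\<^sup>2\<close>\<close>
  have "244 * (infsum W ?P)\<^sup>2 / real m \<le> 784 * B\<^sup>2 / real m"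
  proof (rule divide_right_mono)
    show "244 * (infsum W ?P)\<^sup>2 \<le> 784 * B\<^sup>2"
      using power_mono[OF NB N0, of 2] zero_le_power2[of B] by linarith
  qed simp
  also have "\<dots> = (28 * B / sqrt (real m))\<^sup>2"
    by (simp add: power_divide power_mult_distrib)
  finally have "H1_norm unit_cube (\<lambda>x. u x - cutoff x * ?v x) \<le> sqrt ((28 * B / sqrt (real m))\<^sup>2)"
    using net(4) unfolding H1_norm by (intro real_sqrt_le_mono) linarith
  also have "\<dots> = 28 * B / sqrt (real m)"
    using NB N0 by (subst real_sqrt_abs) simp
  finally show ?thesis using v H1 by blast
qed

end
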